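(* Let $\mathsf{k}$ be a field (concentrated in degree zero), $E$ a finite directed graph and $A$ a $\mathbb Z$-graded $\mathsf{k}$-algebra. Let $\phi:T_E\to\mathcal V^{\mathrm{gr}}(A)$ be a $\mathbb Z$-monoid homomorphism with $\phi(1_E)=[A]$. Then there exists a unital $\mathbb Z$-graded $\mathsf{k}$-algebra homomorphism $\psi:L_{\mathsf{k}}(E)\to A$ such that $\mathcal V^{\mathrm{gr}}(\psi)=\phi$ (under the identification $T_E\cong\mathcal V^{\mathrm{gr}}(L_{\mathsf{k}}(E))$). Furthermore, if $\phi(v)\neq0$ for all $v\in E^0$, then $\psi$ is a monomorphism.
   Context: Rings are unital, modules are left modules. $E=(E^0,E^1,r,s)$ is a directed graph with vertex set $E^0$, edge set $E^1$, range and source maps $r,s:E^1\to E^0$. $L_{\mathsf{k}}(E)$, the Leavitt path algebra of the finite graph $E$, is the $\mathsf{k}$-algebra generated by $\{v,e,e^*\mid v\in E^0,e\in E^1\}$ with relations: $uv=\delta_{uv}u$; $s(e)e=e=e\,r(e)$, $r(e)e^*=e^*=e^*s(e)$; $\sum_{e\in s^{-1}(v)}ee^*=v$ for every $v$ with $s^{-1}(v)\neq\emptyset$; $e^*f=\delta_{ef}r(e)$ for $e,f\in E^1$. It is $\mathbb Z$-graded by $\deg v=0$, $\deg e=1$, $\deg e^*=-1$. The talented monoid $T_E$ is the commutative monoid generated by $\{v(i)\mid v\in E^0,i\in\mathbb Z\}$ subject to $v(i)=\sum_{e\in s^{-1}(v)}r(e)(i+1)$ for all $i\in\mathbb Z$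 and all $v\in E^0$ that are not sinks, with $\mathbb Z$-action ${}^nv(i)=v(i+n)$; write $v=v(0)$ and $1_E=\sum_{v\in E^0}v$. For a $\mathbb Z$-graded ring $R$, $\mathcal V^{\mathrm{gr}}(R)$ is the monoid of graded isomorphism classes $[P]$ of graded finitely generated projective $R$-modules under $\oplus$, with $\mathbb Z$-action ${}^n[P]=[P(n)]$, $P(n)_k=P_{n+k}$. A graded homomorphism $\psi:R\to S$ induces $\mathcal V^{\mathrm{gr}}(\psi):[P]\mapsto[S\otimes_RP]$. There is a $\mathbb Z$-monoid isomorphism $T_E\cong\mathcal V^{\mathrm{gr}}(L_{\mathsf{k}}(E))$ given by $v(i)\mapsto[(L_{\mathsf{k}}(E)v)(i)]$. A $\mathbb Z$-monoid homomorphism is a monoid homomorphism commuting with the $\mathbb Z$-actions. *)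

theory Defs
  imports
    "HOL-Algebra.Algebra"
    "HOL-Library.Multiset"
    "Graph_Theory.Digraph"
begin

section \<open>Graded rings, algebras and modules\<close>

text \<open>One record serves for graded rings, graded algebras and graded left modules. As with
  \<^locale>\<open>module\<close>, the multiplication and unit of a record used as a module are ignored; the scalar
  multiplication of a record used only as a ring is ignored.\<close>

record ('r, 'm) gmodule = "('r, 'm) module" +
  grade :: "int \<Rightarrow> 'm set"

text \<open>The library locale \<^locale>\<open>module\<close> is restricted to commutative rings of scalars.\<close>

locale left_module = R?: ring R + M?: abelian_group M
  for R :: "('r, 'y) ring_scheme" (structure) and M :: "('r, 'm, 'z) module_scheme" (structure) +
  assumes smult_closed:
      "\<lbrakk>a \<in> carrier R; x \<in> carrier M\<rbrakk> \<Longrightarrow> a \<odot>\<^bsub>M\<^esub> x \<in> carrier M"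
    and smult_l_distr:
      "\<lbrakk>a \<in> carrier R; b \<in> carrier R; x \<in> carrier M\<rbrakk> \<Longrightarrow>
        (a \<oplus>\<^bsub>R\<^esub> b) \<odot>\<^bsub>M\<^esub> x = a \<odot>\<^bsub>M\<^esub> x \<oplus>\<^bsub>M\<^esub> b \<odot>\<^bsub>M\<^esub> x"
    and smult_r_distr:
      "\<lbrakk>a \<in> carrier R; x \<in> carrier M; y \<in> carrier M\<rbrakk> \<Longrightarrow>
        a \<odot>\<^bsub>M\<^esub> (x \<oplus>\<^bsub>M\<^esub> y) = a \<odot>\<^bsub>M\<^esub> x \<oplus>\<^bsub>M\<^esub> a \<odot>\<^bsub>M\<^esub> y"
    and smult_assoc1:
      "\<lbrakk>a \<in> carrier R; b \<in> carrier R; x \<in> carrier M\<rbrakk> \<Longrightarrow>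
        (a \<otimes>\<^bsub>R\<^esub> b) \<odot>\<^bsub>M\<^esub> x = a \<odot>\<^bsub>M\<^esub> (b \<odot>\<^bsub>M\<^esub> x)"
    and smult_one:
      "x \<in> carrier M \<Longrightarrow> \<one>\<^bsub>R\<^esub> \<odot>\<^bsub>M\<^esub> x = x"

text \<open>The additive group of \<open>M\<close> is the internal direct sum of the subgroups \<open>grade M n\<close>.\<close>

definition is_grading :: "('r, 'm) gmodule \<Rightarrow> bool" where
  "is_grading M \<longleftrightarrow>
     (\<forall>n. additive_subgroup (grade M n) M) \<and>
     (\<forall>x \<in> carrier M. \<exists>!c. (\<forall>n. c n \<in> grade M n) \<and> finite {n. c n \<noteq> \<zero>\<^bsub>M\<^esub>} \<and>
        x = (\<Oplus>\<^bsub>M\<^esub> n \<in> {n. c n \<noteq> \<zero>\<^bsub>M\<^esub>}. c n))"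

definition graded_algebra :: "('k, 'z) ring_scheme \<Rightarrow> ('k, 'a) gmodule \<Rightarrow> bool" where
  "graded_algebra K A \<longleftrightarrow>
     field K \<and> ring A \<and> module K A \<and>
     (\<forall>c \<in> carrier K. \<forall>x \<in> carrier A. \<forall>y \<in> carrier A.
        (c \<odot>\<^bsub>A\<^esub> x) \<otimes>\<^bsub>A\<^esub> y = c \<odot>\<^bsub>A\<^esub> (x \<otimes>\<^bsub>A\<^esub> y) \<and>
        x \<otimes>\<^bsub>A\<^esub> (c \<odot>\<^bsub>A\<^esub> y) = c \<odot>\<^bsub>A\<^esub> (x \<otimes>\<^bsub>A\<^esub> y)) \<and>
     is_grading A \<and>
     (\<forall>m n. \<forall>x \<in> grade A m. \<forall>y \<in> grade A n. x \<otimes>\<^bsub>A\<^esub> y \<in> grade A (m + n)) \<and>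
     (\<forall>n. \<forall>c \<in> carrier K. \<forall>x \<in> grade A n. c \<odot>\<^bsub>A\<^esub> x \<in> grade A n)"

definition graded_algebra_hom ::
    "('k, 'z) ring_scheme \<Rightarrow> ('k, 'a) gmodule \<Rightarrow> ('k, 'b) gmodule \<Rightarrow> ('a \<Rightarrow> 'b) set" where
  "graded_algebra_hom K A B =
     {h \<in> ring_hom A B.
        (\<forall>c \<in> carrier K. \<forall>x \<in> carrier A. h (c \<odot>\<^bsub>A\<^esub> x) = c \<odot>\<^bsub>B\<^esub> h x) \<and>
        (\<forall>n. h ` grade A n \<subseteq> grade B n)}"

definition graded_module :: "('k, 'a) gmodule \<Rightarrow> ('a, 'm) gmodule \<Rightarrow> bool" where
  "graded_module A M \<longleftrightarrow>
     left_module A M \<and> is_grading M \<and>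
     (\<forall>m n. \<forall>a \<in> grade A m. \<forall>x \<in> grade M n. a \<odot>\<^bsub>M\<^esub> x \<in> grade M (m + n))"

definition graded_module_hom ::
    "('k, 'a) gmodule \<Rightarrow> ('a, 'm) gmodule \<Rightarrow> ('a, 'n) gmodule \<Rightarrow> ('m \<Rightarrow> 'n) set" where
  "graded_module_hom A M N =
     {h \<in> carrier M \<rightarrow> carrier N.
        (\<forall>x \<in> carrier M. \<forall>y \<in> carrier M. h (x \<oplus>\<^bsub>M\<^esub> y) = h x \<oplus>\<^bsub>N\<^esub> h y) \<and>
        (\<forall>a \<in> carrier A. \<forall>x \<in> carrier M. h (a \<odot>\<^bsub>M\<^esub> x) = a \<odot>\<^bsub>N\<^esub> h x) \<and>
        (\<forall>n. h ` grade M n \<subseteq> grade N n)}"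

definition graded_isomorphic ::
    "('k, 'a) gmodule \<Rightarrow> ('a, 'm) gmodule \<Rightarrow> ('a, 'n) gmodule \<Rightarrow> bool" where
  "graded_isomorphic A M N \<longleftrightarrow>
     (\<exists>h \<in> graded_module_hom A M N. bij_betw h (carrier M) (carrier N))"


section \<open>Constructions with graded modules\<close>

definition regular_module :: "('k, 'a) gmodule \<Rightarrow> ('a, 'a) gmodule" where
  "regular_module A =
     \<lparr>carrier = carrier A, monoid.mult = monoid.mult A, one = one A,
      ring.zero = ring.zero A, add = add A, smult = monoid.mult A, grade = grade A\<rparr>"

text \<open>The graded left ideal \<open>A a\<close> generated by a homogeneous element \<open>a\<close>.
  It is graded by \<open>A\<^sub>n \<inter> A a\<close> when \<open>a\<close> is an idempotent of degree \<open>0\<close>.\<close>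

definition principal_left_ideal :: "('k, 'a) gmodule \<Rightarrow> 'a \<Rightarrow> ('a, 'a) gmodule" where
  "principal_left_ideal A a =
     (regular_module A)
       \<lparr>carrier := {x \<otimes>\<^bsub>A\<^esub> a | x. x \<in> carrier A},
        grade := \<lambda>n. grade A n \<inter> {x \<otimes>\<^bsub>A\<^esub> a | x. x \<in> carrier A}\<rparr>"

definition shift :: "int \<Rightarrow> ('a, 'm) gmodule \<Rightarrow> ('a, 'm) gmodule" where
  "shift n M = M\<lparr>grade := \<lambda>k. grade M (n + k)\<rparr>"

definition direct_sum ::
    "('a, 'm) gmodule \<Rightarrow> ('a, 'n) gmodule \<Rightarrow> ('a, 'm \<times> 'n) gmodule" where
  "direct_sum M N =
     \<lparr>carrier = carrier M \<times> carrier N,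
      monoid.mult = undefined, one = undefined,
      ring.zero = (\<zero>\<^bsub>M\<^esub>, \<zero>\<^bsub>N\<^esub>),
      add = \<lambda>x y. (fst x \<oplus>\<^bsub>M\<^esub> fst y, snd x \<oplus>\<^bsub>N\<^esub> snd y),
      smult = \<lambda>a x. (a \<odot>\<^bsub>M\<^esub> fst x, a \<odot>\<^bsub>N\<^esub> snd x),
      grade = \<lambda>n. grade M n \<times> grade N n\<rparr>"

text \<open>The graded free module \<open>A(d 0) \<oplus> \<dots> \<oplus> A(d (n - 1))\<close>.\<close>

definition graded_free_module ::
    "('k, 'a) gmodule \<Rightarrow> nat \<Rightarrow> (nat \<Rightarrow> int) \<Rightarrow> ('a, nat \<Rightarrow> 'a) gmodule" where
  "graded_free_module A n d =
     \<lparr>carrier = {..<n} \<rightarrow>\<^sub>E carrier A,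
      monoid.mult = undefined, one = undefined,
      ring.zero = (\<lambda>j \<in> {..<n}. \<zero>\<^bsub>A\<^esub>),
      add = \<lambda>f g. (\<lambda>j \<in> {..<n}. f j \<oplus>\<^bsub>A\<^esub> g j),
      smult = \<lambda>a f. (\<lambda>j \<in> {..<n}. a \<otimes>\<^bsub>A\<^esub> f j),
      grade = \<lambda>k. (\<Pi>\<^sub>E j \<in> {..<n}. grade (shift (d j) (regular_module A)) k)\<rparr>"

text \<open>Graded finitely generated projective modules are the graded direct summands of graded free
  modules of finite rank. A complement is itself isomorphic to a submodule of the free module, so
  it is no restriction to look for it among modules whose elements have type \<^typ>\<open>nat \<Rightarrow> 'a\<close>.\<close>

definition graded_fg_projective :: "('k, 'a) gmodule \<Rightarrow> ('a, 'm) gmodule \<Rightarrow> bool" where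
  "graded_fg_projective A P \<longleftrightarrow>
     graded_module A P \<and>
     (\<exists>(Q :: ('a, nat \<Rightarrow> 'a) gmodule) n d. graded_module A Q \<and>
        graded_isomorphic A (direct_sum P Q) (graded_free_module A n d))"

text \<open>The extension of scalars \<open>S \<otimes>\<^bsub>R\<^esub> P\<close> along \<open>\<psi> : R \<rightarrow> S\<close>, where \<open>S\<close> is a right \<open>R\<close>-module
  through \<open>\<psi>\<close>: the free abelian group on \<open>S \<times> P\<close> modulo the subgroup generated by the usual
  relations. The component of degree \<open>n\<close> is generated by the \<open>s \<otimes> p\<close> with
  \<open>deg s + deg p = n\<close>.\<close>

definition tensor_relations ::
    "('k, 'r) gmodule \<Rightarrow> ('k, 's) gmodule \<Rightarrow> ('r \<Rightarrow> 's) \<Rightarrow> ('r, 'p) gmodule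
      \<Rightarrow> (('s \<times> 'p) \<Rightarrow>\<^sub>0 int) set" where
  "tensor_relations R S \<psi> P =
     {frag_of (s \<oplus>\<^bsub>S\<^esub> s', p) - frag_of (s, p) - frag_of (s', p) | s s' p.
        s \<in> carrier S \<and> s' \<in> carrier S \<and> p \<in> carrier P} \<union>
     {frag_of (s, p \<oplus>\<^bsub>P\<^esub> p') - frag_of (s, p) - frag_of (s, p') | s p p'.
        s \<in> carrier S \<and> p \<in> carrier P \<and> p' \<in> carrier P} \<union>
     {frag_of (s \<otimes>\<^bsub>S\<^esub> \<psi> r, p) - frag_of (s, r \<odot>\<^bsub>P\<^esub> p) | s r p.
        s \<in> carrier S \<and> r \<in> carrier R \<and> p \<in> carrier P}"

definition extension_of_scalars ::
    "('k, 'r) gmodule \<Rightarrow> ('k, 's) gmodule \<Rightarrow> ('r \<Rightarrow> 's) \<Rightarrow> ('r, 'p) gmodule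
      \<Rightarrow> ('s, (('s \<times> 'p) \<Rightarrow>\<^sub>0 int) set) gmodule" where
  "extension_of_scalars R S \<psi> P =
     (let F = free_Abelian_group (carrier S \<times> carrier P);
          N = generate F (tensor_relations R S \<psi> P);
          T = F Mod N
      in \<lparr>carrier = carrier T,
          monoid.mult = undefined, one = undefined,
          ring.zero = \<one>\<^bsub>T\<^esub>,
          add = monoid.mult T,
          smult = \<lambda>a U. \<Union>x\<in>U. N #>\<^bsub>F\<^esub> frag_extend (\<lambda>(s, p). frag_of (a \<otimes>\<^bsub>S\<^esub> s, p)) x,
          grade = \<lambda>n. generate T
            {N #>\<^bsub>F\<^esub> frag_of (s, p) | s p i j. s \<in> grade S i \<and> p \<in> grade P j \<and> i + j = n}\<rparr>)"


section \<open>Commutative monoids with a \<open>\<int>\<close>-action and the monoid \<open>\<V>\<^sup>g\<^sup>r\<close>\<close>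

text \<open>The (additive) operation of these monoids is the library's multiplication, their zero
  is the library's \<open>\<one>\<close>.\<close>

record 'm zmonoid = "'m monoid" +
  zact :: "int \<Rightarrow> 'm \<Rightarrow> 'm"

definition zmonoid_hom :: "'m zmonoid \<Rightarrow> 'n zmonoid \<Rightarrow> ('m \<Rightarrow> 'n) set" where
  "zmonoid_hom G H =
     {h \<in> hom G H. h \<one>\<^bsub>G\<^esub> = \<one>\<^bsub>H\<^esub> \<and> (\<forall>n. \<forall>x \<in> carrier G. h (zact G n x) = zact H n (h x))}"

text \<open>The graded isomorphism class of a graded finitely generated projective module \<open>P\<close> with elements
  of any type, represented by its members whose elements have type \<^typ>\<open>nat \<Rightarrow> 'a\<close>. Every such \<open>P\<close> has
  an isomorphic copy there, namely inside a graded free module of finite rank.\<close>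

definition Vgr_class ::
    "('k, 'a) gmodule \<Rightarrow> ('a, 'm) gmodule \<Rightarrow> ('a, nat \<Rightarrow> 'a) gmodule set" where
  "Vgr_class A P = {M. graded_fg_projective A M \<and> graded_isomorphic A M P}"

definition Vgr :: "('k, 'a) gmodule \<Rightarrow> ('a, nat \<Rightarrow> 'a) gmodule set zmonoid" where
  "Vgr A =
     \<lparr>carrier = {Vgr_class A P | P :: ('a, nat \<Rightarrow> 'a) gmodule. graded_fg_projective A P},
      monoid.mult = \<lambda>U V. \<Union>P\<in>U. \<Union>Q\<in>V. Vgr_class A (direct_sum P Q),
      one = {P. graded_fg_projective A P \<and> carrier P = {\<zero>\<^bsub>P\<^esub>}},
      zact = \<lambda>n U. \<Union>P\<in>U. Vgr_class A (shift n P)\<rparr>"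

definition Vgr_map ::
    "('k, 'r) gmodule \<Rightarrow> ('k, 's) gmodule \<Rightarrow> ('r \<Rightarrow> 's)
      \<Rightarrow> ('r, nat \<Rightarrow> 'r) gmodule set \<Rightarrow> ('s, nat \<Rightarrow> 's) gmodule set" where
  "Vgr_map R S \<psi> U = (\<Union>P\<in>U. Vgr_class S (extension_of_scalars R S \<psi> P))"


section \<open>Leavitt path algebras\<close>

text \<open>Graphs are AFP digraphs: \<^const>\<open>tail\<close> is the source map, \<^const>\<open>head\<close> the range map, and
  \<open>out_arcs E v\<close> is \<open>s\<^sup>-\<^sup>1(v)\<close>. Loops and parallel edges are allowed.\<close>

datatype ('v, 'e) lpa_gen = Vert 'v | Edge 'e | Ghost 'e

fun gen_degree :: "('v, 'e) lpa_gen \<Rightarrow> int" where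
  "gen_degree (Vert v) = 0"
| "gen_degree (Edge e) = 1"
| "gen_degree (Ghost e) = - 1"

definition lpa_gens :: "('v, 'e) pre_digraph \<Rightarrow> ('v, 'e) lpa_gen set" where
  "lpa_gens E = Vert ` verts E \<union> Edge ` arcs E \<union> Ghost ` arcs E"

text \<open>The free unital associative \<open>K\<close>-algebra on the set \<open>G\<close>: finitely supported functions on the
  words over \<open>G\<close>. The product of \<open>f\<close> and \<open>g\<close> sums over all factorizations of a word.\<close>

definition free_algebra ::
    "('k, 'z) ring_scheme \<Rightarrow> 'x set \<Rightarrow> ('x \<Rightarrow> int) \<Rightarrow> ('k, 'x list \<Rightarrow> 'k) gmodule" where
  "free_algebra K G wt =
     (let C = {f. range f \<subseteq> carrier K \<and> finite {w. f w \<noteq> \<zero>\<^bsub>K\<^esub>} \<and>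
                  (\<forall>w. f w \<noteq> \<zero>\<^bsub>K\<^esub> \<longrightarrow> set w \<subseteq> G)}
      in \<lparr>carrier = C,
          monoid.mult =
            \<lambda>f g w. \<Oplus>\<^bsub>K\<^esub> i \<in> {..length w}. f (take i w) \<otimes>\<^bsub>K\<^esub> g (drop i w),
          one = \<lambda>w. if w = [] then \<one>\<^bsub>K\<^esub> else \<zero>\<^bsub>K\<^esub>,
          ring.zero = \<lambda>w. \<zero>\<^bsub>K\<^esub>,
          add = \<lambda>f g w. f w \<oplus>\<^bsub>K\<^esub> g w,
          smult = \<lambda>c f w. c \<otimes>\<^bsub>K\<^esub> f w,
          grade = \<lambda>n. {f \<in> C. \<forall>w. f w \<noteq> \<zero>\<^bsub>K\<^esub> \<longrightarrow> (\<Sum>x\<leftarrow>w. wt x) = n}\<rparr>)"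

abbreviation lpa_free ::
    "('k, 'z) ring_scheme \<Rightarrow> ('v, 'e) pre_digraph
      \<Rightarrow> ('k, ('v, 'e) lpa_gen list \<Rightarrow> 'k) gmodule" where
  "lpa_free K E \<equiv> free_algebra K (lpa_gens E) gen_degree"

definition lpa_var ::
    "('k, 'z) ring_scheme \<Rightarrow> ('v, 'e) lpa_gen \<Rightarrow> ('v, 'e) lpa_gen list \<Rightarrow> 'k" where
  "lpa_var K x = (\<lambda>w. if w = [x] then \<one>\<^bsub>K\<^esub> else \<zero>\<^bsub>K\<^esub>)"

inductive_set lpa_relations ::
    "('k, 'z) ring_scheme \<Rightarrow> ('v, 'e) pre_digraph
      \<Rightarrow> ((('v, 'e) lpa_gen list \<Rightarrow> 'k) \<times> (('v, 'e) lpa_gen list \<Rightarrow> 'k)) set"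
  for K :: "('k, 'z) ring_scheme" and E :: "('v, 'e) pre_digraph" where
  vertex_vertex: "u \<in> verts E \<Longrightarrow> v \<in> verts E \<Longrightarrow>
    (lpa_var K (Vert u) \<otimes>\<^bsub>lpa_free K E\<^esub> lpa_var K (Vert v),
     if u = v then lpa_var K (Vert u) else \<zero>\<^bsub>lpa_free K E\<^esub>) \<in> lpa_relations K E"
| source_edge: "e \<in> arcs E \<Longrightarrow>
    (lpa_var K (Vert (tail E e)) \<otimes>\<^bsub>lpa_free K E\<^esub> lpa_var K (Edge e),
     lpa_var K (Edge e)) \<in> lpa_relations K E"
| edge_range: "e \<in> arcs E \<Longrightarrow>
    (lpa_var K (Edge e) \<otimes>\<^bsub>lpa_free K E\<^esub> lpa_var K (Vert (head E e)),
     lpa_var K (Edge e)) \<in> lpa_relations K E"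
| range_ghost: "e \<in> arcs E \<Longrightarrow>
    (lpa_var K (Vert (head E e)) \<otimes>\<^bsub>lpa_free K E\<^esub> lpa_var K (Ghost e),
     lpa_var K (Ghost e)) \<in> lpa_relations K E"
| ghost_source: "e \<in> arcs E \<Longrightarrow>
    (lpa_var K (Ghost e) \<otimes>\<^bsub>lpa_free K E\<^esub> lpa_var K (Vert (tail E e)),
     lpa_var K (Ghost e)) \<in> lpa_relations K E"
| edge_ghost: "v \<in> verts E \<Longrightarrow> out_arcs E v \<noteq> {} \<Longrightarrow>
    (\<Oplus>\<^bsub>lpa_free K E\<^esub> e \<in> out_arcs E v. lpa_var K (Edge e) \<otimes>\<^bsub>lpa_free K E\<^esub> lpa_var K (Ghost e),
     lpa_var K (Vert v)) \<in> lpa_relations K E"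
| ghost_edge: "e \<in> arcs E \<Longrightarrow> f \<in> arcs E \<Longrightarrow>
    (lpa_var K (Ghost e) \<otimes>\<^bsub>lpa_free K E\<^esub> lpa_var K (Edge f),
     if e = f then lpa_var K (Vert (head E e)) else \<zero>\<^bsub>lpa_free K E\<^esub>) \<in> lpa_relations K E"

definition lpa_ideal ::
    "('k, 'z) ring_scheme \<Rightarrow> ('v, 'e) pre_digraph \<Rightarrow> (('v, 'e) lpa_gen list \<Rightarrow> 'k) set" where
  "lpa_ideal K E =
     Idl\<^bsub>lpa_free K E\<^esub> {x \<ominus>\<^bsub>lpa_free K E\<^esub> y | x y. (x, y) \<in> lpa_relations K E}"

text \<open>The presentation by generators and relations is one of algebras that are not assumed unital:
  there is no relation mentioning a unit, and for a finite graph the quotient turns out to have the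
  unit \<open>\<Sum>v\<in>E\<^sup>0. v\<close>. The free non-unital algebra is the set of \<open>f\<close> with \<open>f [] = 0\<close> in the free unital
  one. It contains the relations, and the ideal they generate in it is also an ideal of the free
  unital algebra.\<close>

definition leavitt ::
    "('k, 'z) ring_scheme \<Rightarrow> ('v, 'e) pre_digraph
      \<Rightarrow> ('k, (('v, 'e) lpa_gen list \<Rightarrow> 'k) set) gmodule" where
  "leavitt K E =
     (let F = lpa_free K E; I = lpa_ideal K E
      in \<lparr>carrier = {I +>\<^bsub>F\<^esub> f | f. f \<in> carrier F \<and> f [] = \<zero>\<^bsub>K\<^esub>},
          monoid.mult = monoid.mult (F Quot I),
          one = I +>\<^bsub>F\<^esub> (\<Oplus>\<^bsub>F\<^esub> v \<in> verts E. lpa_var K (Vert v)),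
          ring.zero = ring.zero (F Quot I),
          add = add (F Quot I),
          smult = \<lambda>c U. \<Union>f\<in>U. I +>\<^bsub>F\<^esub> (c \<odot>\<^bsub>F\<^esub> f),
          grade = \<lambda>n. {I +>\<^bsub>F\<^esub> f | f. f \<in> grade F n \<and> f [] = \<zero>\<^bsub>K\<^esub>}\<rparr>)"

definition leavitt_vertex ::
    "('k, 'z) ring_scheme \<Rightarrow> ('v, 'e) pre_digraph \<Rightarrow> 'v
      \<Rightarrow> (('v, 'e) lpa_gen list \<Rightarrow> 'k) set" where
  "leavitt_vertex K E v = lpa_ideal K E +>\<^bsub>lpa_free K E\<^esub> lpa_var K (Vert v)"


section \<open>The talented monoid\<close>

text \<open>The free commutative monoid on the symbols \<open>v(i)\<close> consists of the finite multisets of pairs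
  \<open>(v, i)\<close>; the relations generate a congruence on it.\<close>

inductive talented_cong ::
    "('v, 'e) pre_digraph \<Rightarrow> ('v \<times> int) multiset \<Rightarrow> ('v \<times> int) multiset \<Rightarrow> bool"
  for E :: "('v, 'e) pre_digraph" where
  relation: "v \<in> verts E \<Longrightarrow> out_arcs E v \<noteq> {} \<Longrightarrow>
    talented_cong E {#(v, i)#} {#(head E e, i + 1). e \<in># mset_set (out_arcs E v)#}"
| refl: "set_mset a \<subseteq> verts E \<times> UNIV \<Longrightarrow> talented_cong E a a"
| sym: "talented_cong E a b \<Longrightarrow> talented_cong E b a"
| trans: "talented_cong E a b \<Longrightarrow> talented_cong E b c \<Longrightarrow> talented_cong E a c"
| add: "talented_cong E a b \<Longrightarrow> talented_cong E c d \<Longrightarrow> talented_cong E (a + c) (b + d)"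

definition talented_class ::
    "('v, 'e) pre_digraph \<Rightarrow> ('v \<times> int) multiset \<Rightarrow> ('v \<times> int) multiset set" where
  "talented_class E a = {b. talented_cong E a b}"

definition talented_monoid ::
    "('v, 'e) pre_digraph \<Rightarrow> ('v \<times> int) multiset set zmonoid" where
  "talented_monoid E =
     \<lparr>carrier = {talented_class E a | a. set_mset a \<subseteq> verts E \<times> UNIV},
      monoid.mult = \<lambda>U V. \<Union>a\<in>U. \<Union>b\<in>V. talented_class E (a + b),
      one = talented_class E {#},
      zact = \<lambda>n U. \<Union>a\<in>U. talented_class E {#(v, i + n). (v, i) \<in># a#}\<rparr>"

definition talented_gen :: "('v, 'e) pre_digraph \<Rightarrow> 'v \<Rightarrow> int \<Rightarrow> ('v \<times> int) multiset set" where
  "talented_gen E v i = talented_class E {#(v, i)#}"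

definition talented_unit :: "('v, 'e) pre_digraph \<Rightarrow> ('v \<times> int) multiset set" where
  "talented_unit E = talented_class E {#(v, 0). v \<in># mset_set (verts E)#}"

text \<open>The identification of the talented monoid with \<open>\<V>\<^sup>g\<^sup>r\<close> of the Leavitt path algebra: the unique
  homomorphism with \<open>v(i) \<mapsto> [(L v)(i)]\<close>. It is known to be an isomorphism.
  \<^const>\<open>extensional\<close> only pins down its values outside the carrier.\<close>

definition talented_to_Vgr ::
    "('k, 'z) ring_scheme \<Rightarrow> ('v, 'e) pre_digraph \<Rightarrow> ('v \<times> int) multiset set
      \<Rightarrow> ((('v, 'e) lpa_gen list \<Rightarrow> 'k) set,
          nat \<Rightarrow> (('v, 'e) lpa_gen list \<Rightarrow> 'k) set) gmodule set" where
  "talented_to_Vgr K E =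
     (THE \<theta>. \<theta> \<in> zmonoid_hom (talented_monoid E) (Vgr (leavitt K E)) \<and>
        \<theta> \<in> extensional (carrier (talented_monoid E)) \<and>
        (\<forall>v \<in> verts E. \<forall>i. \<theta> (talented_gen E v i) =
           Vgr_class (leavitt K E)
             (shift i (principal_left_ideal (leavitt K E) (leavitt_vertex K E v)))))"

end

theory Submission
  imports Defs
begin

text \<open>Let \<open>\<phi>(v) = [P\<^sub>v]\<close>. Since \<open>\<phi>(1\<^sub>E) = [A]\<close>, there is a graded isomorphism of \<open>A\<close> with the direct sum of
  the \<open>P\<^sub>v\<close>. It yields orthogonal idempotents \<open>p\<^sub>v\<close> of degree \<open>0\<close> with sum \<open>1\<close> and \<open>A p\<^sub>v \<cong> P\<^sub>v\<close>. If \<open>v\<close> is not a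
  sink, the relation \<open>v = \<Sum> r(e)(1)\<close> becomes a graded isomorphism of \<open>A p\<^sub>v\<close> with the direct sum of the
  \<open>(A p\<^sub>r\<^sub>(\<^sub>e\<^sub>))(1)\<close>. Its matrix and the inverse matrix have entries \<open>x\<^sub>e\<close> of degree \<open>1\<close> and \<open>y\<^sub>e\<close> of degree \<open>-1\<close>, and
  that they are inverse to each other means precisely that \<open>v \<mapsto> p\<^sub>v\<close>, \<open>e \<mapsto> x\<^sub>e\<close>, \<open>e\<^sup>* \<mapsto> y\<^sub>e\<close> respects the
  relations of the Leavitt path algebra \<open>L\<close>. This is \<open>\<psi>\<close>. It induces \<open>\<phi>\<close> because a homomorphism out of the
  talented monoid is determined by its values at the vertices and \<open>A \<otimes>\<^sub>L (L v)(i) \<cong> (A p\<^sub>v)(i)\<close>.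

  The kernel of \<open>\<psi>\<close> is graded. If \<open>u\<close> is a homogeneous element of it, so are all \<open>u e\<close> and all \<open>u w\<close> with \<open>w\<close> a
  sink, and \<open>u = 0\<close> if they all vanish. Multiplying often enough leaves a combination of paths of
  one length. Multiplying on the left by adjoint paths of that length then isolates the multiples
  \<open>c v\<close> of single vertices, and \<open>\<psi>(c v) = c p\<^sub>v\<close> vanishes only if \<open>c = 0\<close>, as \<open>p\<^sub>v \<noteq> 0\<close>.\<close>


section \<open>Graded abelian groups\<close>

text \<open>The encoding shapes the argument in three ways. Elements of \<open>Vgr\<close> are sets
  of modules over one element type, and the class of a module with another element type may a priori
  be empty. So equality of classes yields an isomorphism only through a common member, and members
  are supplied by the fact that \<phi> takes values in the carrier. Secondly, direct sums occur over
  vertices, edges, positions in a list and disjoint unions; \<open>graded_sum\<close> allows any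
  index type, and \<open>mset_sum\<close> returns to \<open>nat\<close>. Thirdly,
  \<open>talented_to_Vgr\<close> is a definite description. The map \<open>theta\<close> that
  satisfies it is built for every family of homogeneous elements obeying the relations of
  \<open>L\<close>. Over \<open>A\<close> the same construction is \<phi> itself, so the claim on
  \<open>Vgr_map\<close> compares two instances of \<open>theta\<close> and comes down to tensoring
  a direct sum of shifted left ideals. Left ideals \<open>A p\<close> are handled as fixed points of
  right multiplication by \<open>p\<close>, and left module maps between them are right
  multiplications. This is why an isomorphism amounts to a pair of mutually inverse
  matrices.\<close>

definition component :: "('r, 'm) gmodule \<Rightarrow> int \<Rightarrow> 'm \<Rightarrow> 'm" where
  "component M n x = (THE c. (\<forall>n. c n \<in> grade M n) \<and> finite {n. c n \<noteq> \<zero>\<^bsub>M\<^esub>} \<and>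
     x = (\<Oplus>\<^bsub>M\<^esub> n \<in> {n. c n \<noteq> \<zero>\<^bsub>M\<^esub>}. c n)) n"

text \<open>Only additivity on the carrier and the value at zero are asked for, so that coordinate
  projections, coset maps and evaluations can be moved past sums before more is known about
  them.\<close>

lemma finsum_additive:
  assumes "abelian_monoid M" "abelian_monoid N" "finite S" "f \<in> S \<rightarrow> carrier M"
    and "h \<in> carrier M \<rightarrow> carrier N"
    and "\<And>x y. x \<in> carrier M \<Longrightarrow> y \<in> carrier M \<Longrightarrow> h (x \<oplus>\<^bsub>M\<^esub> y) = h x \<oplus>\<^bsub>N\<^esub> h y"
    and "h \<zero>\<^bsub>M\<^esub> = \<zero>\<^bsub>N\<^esub>"
  shows "h (finsum M f S) = finsum N (\<lambda>i. h (f i)) S"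
proof -
  interpret M: abelian_monoid M by fact
  interpret N: abelian_monoid N by fact
  show ?thesis using assms(3,4)
  proof (induction S)
    case (insert i S)
    then have "(\<lambda>i. h (f i)) \<in> S \<rightarrow> carrier N" "h (f i) \<in> carrier N" using assms(5) by auto
    moreover have "f i \<in> carrier M" "f \<in> S \<rightarrow> carrier M" using insert by auto
    ultimately show ?case using insert assms(6) by (simp add: M.finsum_closed)
  qed (use assms(7) in auto)
qed

lemma additive_zero:
  assumes "abelian_group M" "abelian_group N" and "h \<in> carrier M \<rightarrow> carrier N"
    and "\<And>x y. x \<in> carrier M \<Longrightarrow> y \<in> carrier M \<Longrightarrow> h (x \<oplus>\<^bsub>M\<^esub> y) = h x \<oplus>\<^bsub>N\<^esub> h y"
  shows "h \<zero>\<^bsub>M\<^esub> = \<zero>\<^bsub>N\<^esub>"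
proof -
  interpret M: abelian_group M by fact
  interpret N: abelian_group N by fact
  have c: "h \<zero>\<^bsub>M\<^esub> \<in> carrier N" using assms(3) by auto
  have "h \<zero>\<^bsub>M\<^esub> \<oplus>\<^bsub>N\<^esub> h \<zero>\<^bsub>M\<^esub> = h \<zero>\<^bsub>M\<^esub>" using assms(4)[of "\<zero>\<^bsub>M\<^esub>" "\<zero>\<^bsub>M\<^esub>"] by simp
  then show ?thesis using c by (metis N.add.l_cancel_one')
qed

lemma (in abelian_group) minus_zeroD:
  "x \<in> carrier G \<Longrightarrow> y \<in> carrier G \<Longrightarrow> x \<ominus> y = \<zero> \<Longrightarrow> x = y"
  unfolding a_minus_def by (drule minus_equality) auto

locale graded_group = abelian_group M for M :: "('r, 'm) gmodule" (structure) +
  assumes grading: "is_grading M"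
begin

lemma grade_subgroup: "additive_subgroup (grade M n) M"
  using grading by (simp add: is_grading_def)

lemma grade_closed: "x \<in> grade M n \<Longrightarrow> x \<in> carrier M"
  using additive_subgroup.a_subset[OF grade_subgroup] by blast

lemma grade_zero: "\<zero> \<in> grade M n"
  by (rule additive_subgroup.zero_closed[OF grade_subgroup])

lemma grade_add: "x \<in> grade M n \<Longrightarrow> y \<in> grade M n \<Longrightarrow> x \<oplus> y \<in> grade M n"
  by (rule additive_subgroup.a_closed[OF grade_subgroup])

lemma grade_neg: "x \<in> grade M n \<Longrightarrow> \<ominus> x \<in> grade M n"
  by (rule additive_subgroup.a_inv_closed[OF grade_subgroup])

lemma grade_minus: "x \<in> grade M n \<Longrightarrow> y \<in> grade M n \<Longrightarrow> x \<ominus> y \<in> grade M n"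
  by (simp add: a_minus_def grade_add grade_neg)

lemma grade_finsum: "finite S \<Longrightarrow> (\<And>i. i \<in> S \<Longrightarrow> f i \<in> grade M n) \<Longrightarrow> finsum M f S \<in> grade M n"
proof (induction S rule: finite_induct)
  case (insert i S)
  then have "f \<in> S \<rightarrow> carrier M" "f i \<in> carrier M" using grade_closed by auto
  then show ?case using insert by (simp add: grade_add)
qed (simp add: grade_zero)

lemma component_decomp:
  assumes "x \<in> carrier M"
  shows "component M n x \<in> grade M n" "finite {n. component M n x \<noteq> \<zero>}"
    "x = (\<Oplus>n \<in> {n. component M n x \<noteq> \<zero>}. component M n x)"
proof -
  let ?P = "\<lambda>c. (\<forall>n. c n \<in> grade M n) \<and> finite {n. c n \<noteq> \<zero>} \<and> x = (\<Oplus>n \<in> {n. c n \<noteq> \<zero>}. c n)"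
  define c where "c = (THE c. ?P c)"
  have e: "component M n x = c n" for n by (simp add: component_def c_def)
  have "\<exists>!c. ?P c" using grading assms by (simp add: is_grading_def)
  then have P: "?P c" unfolding c_def by (rule theI')
  show "component M n x \<in> grade M n" unfolding e by (rule conjunct1[OF P, THEN spec])
  show "finite {n. component M n x \<noteq> \<zero>}" unfolding e by (rule conjunct1[OF conjunct2[OF P]])
  show "x = (\<Oplus>n \<in> {n. component M n x \<noteq> \<zero>}. component M n x)"
    unfolding e by (rule conjunct2[OF conjunct2[OF P]])
qed

text \<open>Uniqueness in \<open>is_grading\<close> concerns a family indexed by its exact support.
  Allowing any finite \<open>S\<close> outside which \<open>c\<close> vanishes lets two elements be
  decomposed over a common index set, as \<open>component_add\<close> needs.\<close>

lemma component_eqI: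
  assumes c: "\<And>n. c n \<in> grade M n" "finite S" "\<And>n. n \<notin> S \<Longrightarrow> c n = \<zero>" and x: "x = finsum M c S"
  shows "component M n x = c n"
proof -
  let ?P = "\<lambda>c. (\<forall>n. c n \<in> grade M n) \<and> finite {n. c n \<noteq> \<zero>} \<and> x = (\<Oplus>n \<in> {n. c n \<noteq> \<zero>}. c n)"
  have e: "(\<lambda>n. component M n x) = (THE c. ?P c)" by (rule ext) (simp add: component_def)
  have cc: "c n \<in> carrier M" for n using c(1) grade_closed by blast
  have sub: "{n. c n \<noteq> \<zero>} \<subseteq> S" using c(3) by auto
  have "finsum M c S = finsum M c {n. c n \<noteq> \<zero>}"
    by (rule add.finprod_mono_neutral_cong_right) (use sub cc c(2) in auto)
  then have P: "?P c" using c x sub finite_subset[OF sub] by auto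
  have "x \<in> carrier M" unfolding x by (rule finsum_closed) (use cc in auto)
  then have "\<exists>!c. ?P c" using grading by (simp add: is_grading_def)
  then have "(THE c. ?P c) = c" using P by (rule the1_equality[of ?P])
  then show ?thesis using e by metis
qed

lemma component_closed: "x \<in> carrier M \<Longrightarrow> component M n x \<in> carrier M"
  using component_decomp(1) grade_closed by blast

lemma component_sum:
  assumes "x \<in> carrier M" "finite S" "\<And>n. n \<notin> S \<Longrightarrow> component M n x = \<zero>"
  shows "x = (\<Oplus>n\<in>S. component M n x)"
proof -
  have "finsum M (\<lambda>n. component M n x) S = finsum M (\<lambda>n. component M n x) {n. component M n x \<noteq> \<zero>}"
    by (rule add.finprod_mono_neutral_cong_right)
      (use assms component_closed in auto)
  then show ?thesis using component_decomp(3)[OF assms(1)] by simp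
qed

lemma component_add:
  assumes "x \<in> carrier M" "y \<in> carrier M"
  shows "component M n (x \<oplus> y) = component M n x \<oplus> component M n y"
proof (rule component_eqI)
  let ?S = "{n. component M n x \<noteq> \<zero>} \<union> {n. component M n y \<noteq> \<zero>}"
  show "finite ?S" using component_decomp(2) assms by auto
  show "component M n x \<oplus> component M n y \<in> grade M n" for n
    using component_decomp(1) grade_add assms by auto
  show "component M n x \<oplus> component M n y = \<zero>" if "n \<notin> ?S" for n using that by auto
  have x: "x = (\<Oplus>n\<in>?S. component M n x)"
    by (rule component_sum) (use assms \<open>finite ?S\<close> in auto)
  have y: "y = (\<Oplus>n\<in>?S. component M n y)"
    by (rule component_sum) (use assms \<open>finite ?S\<close> in auto)
  have "(\<Oplus>n\<in>?S. component M n x \<oplus> component M n y) =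
      (\<Oplus>n\<in>?S. component M n x) \<oplus> (\<Oplus>n\<in>?S. component M n y)"
    by (rule finsum_addf) (use component_closed assms in auto)
  moreover have "x \<oplus> y = (\<Oplus>n\<in>?S. component M n x) \<oplus> (\<Oplus>n\<in>?S. component M n y)"
    by (rule arg_cong2[OF x y])
  ultimately show "x \<oplus> y = (\<Oplus>n\<in>?S. component M n x \<oplus> component M n y)" by argo
qed

lemma component_grade: "x \<in> grade M n \<Longrightarrow> component M m x = (if m = n then x else \<zero>)"
proof (rule component_eqI[where S = "{n}"])
  assume "x \<in> grade M n"
  then show "x = (\<Oplus>k\<in>{n}. if k = n then x else \<zero>)" using grade_closed[of x n] by simp
qed (auto simp: grade_zero)

lemma component_zero_imp: "x \<in> carrier M \<Longrightarrow> (\<And>n. component M n x = \<zero>) \<Longrightarrow> x = \<zero>"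
  using component_sum[of x "{}"] by simp

text \<open>Reduces identities that are additive in \<open>x\<close> to homogeneous elements. There
  is no separate case for zero, which counts as homogeneous of degree 0.\<close>

lemma graded_induct [consumes 1, case_names homogeneous add]:
  assumes x: "x \<in> carrier M"
    and hom: "\<And>n y. y \<in> grade M n \<Longrightarrow> P y"
    and add: "\<And>y z. y \<in> carrier M \<Longrightarrow> z \<in> carrier M \<Longrightarrow> P y \<Longrightarrow> P z \<Longrightarrow> P (y \<oplus> z)"
  shows "P x"
proof -
  have "finite S \<Longrightarrow> P (\<Oplus>n\<in>S. component M n x)" for S
  proof (induction S rule: finite_induct)
    case empty
    then show ?case using hom[OF grade_zero[of 0]] by simp
  next
    case (insert i S)
    have c: "component M n x \<in> carrier M" for n using component_closed x by auto
    then have "P (component M i x \<oplus> (\<Oplus>n\<in>S. component M n x))"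
      using insert component_decomp(1)[OF x] by (intro add hom[of "component M i x" i] finsum_closed) auto
    then show ?case using insert c by auto
  qed
  then show ?thesis using component_decomp(2,3)[OF x] by metis
qed

end

text \<open>Joint injectivity of the projections replaces the condition that every element is the sum of its
  components, so that no sums have to be handled when a grading is constructed.\<close>

lemma is_gradingI:
  assumes ag: "abelian_group M"
    and sg: "\<And>n. additive_subgroup (grade M n) M"
    and pr: "\<And>n x. x \<in> carrier M \<Longrightarrow> pr n x \<in> grade M n"
    and pr_add: "\<And>n x y. x \<in> carrier M \<Longrightarrow> y \<in> carrier M \<Longrightarrow> pr n (x \<oplus>\<^bsub>M\<^esub> y) = pr n x \<oplus>\<^bsub>M\<^esub> pr n y"
    and pr_grade: "\<And>m n x. x \<in> grade M n \<Longrightarrow> pr m x = (if m = n then x else \<zero>\<^bsub>M\<^esub>)"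
    and fin: "\<And>x. x \<in> carrier M \<Longrightarrow> finite {n. pr n x \<noteq> \<zero>\<^bsub>M\<^esub>}"
    and inj: "\<And>x. x \<in> carrier M \<Longrightarrow> (\<And>n. pr n x = \<zero>\<^bsub>M\<^esub>) \<Longrightarrow> x = \<zero>\<^bsub>M\<^esub>"
  shows "is_grading M"
proof -
  interpret abelian_group M by fact
  have gc: "x \<in> grade M n \<Longrightarrow> x \<in> carrier M" for n x
    using additive_subgroup.a_subset[OF sg] by blast
  have prc: "pr n x \<in> carrier M" if "x \<in> carrier M" for n x using pr gc that by blast
  have pr0: "pr n \<zero>\<^bsub>M\<^esub> = \<zero>\<^bsub>M\<^esub>" for n
    by (rule additive_zero[OF ag ag]) (use prc pr_add in auto)
  have prsum: "pr n (finsum M c S) = c n" if c: "\<And>n. c n \<in> grade M n" and S: "finite S" "\<And>n. n \<notin> S \<Longrightarrow> c n = \<zero>\<^bsub>M\<^esub>"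
    for c S n
  proof -
    have cc: "c n \<in> carrier M" for n using gc c by blast
    have "pr n (finsum M c S) = finsum M (\<lambda>i. pr n (c i)) S"
      by (rule finsum_additive) (use abelian_monoid_axioms S cc prc pr_add pr0 in auto)
    also have "... = finsum M (\<lambda>i. if i = n then c i else \<zero>\<^bsub>M\<^esub>) S"
      by (rule finsum_cong') (use pr_grade[OF c] cc in auto)
    \<comment> \<open>\<open>n\<close> may lie outside \<open>S\<close>, where \<open>c\<close>
      vanishes; it is inserted before the other indices are dropped.\<close>
    also have "... = finsum M (\<lambda>i. if i = n then c i else \<zero>\<^bsub>M\<^esub>) (insert n S)"
      by (rule add.finprod_mono_neutral_cong_left) (use S cc in auto)
    also have "... = finsum M (\<lambda>i. if i = n then c i else \<zero>\<^bsub>M\<^esub>) {n}"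
      by (rule add.finprod_mono_neutral_cong_right) (use S cc in auto)
    also have "... = c n" using cc by simp
    finally show ?thesis .
  qed
  have neg: "pr n (\<ominus>\<^bsub>M\<^esub> x) = \<ominus>\<^bsub>M\<^esub> pr n x" if "x \<in> carrier M" for n x
    using pr_add[of "\<ominus>\<^bsub>M\<^esub> x" x n] that pr0 prc
    by (metis a_inv_closed l_neg minus_equality)
  show ?thesis unfolding is_grading_def
  proof (intro conjI allI ballI)
    fix x assume x: "x \<in> carrier M"
    let ?S = "{n. pr n x \<noteq> \<zero>\<^bsub>M\<^esub>}"
    have s: "(\<Oplus>\<^bsub>M\<^esub>n\<in>?S. pr n x) \<in> carrier M" by (rule finsum_closed) (use prc x in auto)
\<comment> \<open>The difference of \<open>x\<close> and the sum of its projections is killed by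
  every projection; \<open>inj\<close> then makes it zero.\<close>
have "pr m (x \<ominus>\<^bsub>M\<^esub> (\<Oplus>\<^bsub>M\<^esub>n\<in>?S. pr n x)) = \<zero>\<^bsub>M\<^esub>" for m
    proof -
      have "pr m (\<Oplus>\<^bsub>M\<^esub>n\<in>?S. pr n x) = pr m x"
        by (rule prsum) (use pr[OF x] fin[OF x] in auto)
      then have "pr m (\<ominus>\<^bsub>M\<^esub> (\<Oplus>\<^bsub>M\<^esub>n\<in>?S. pr n x)) = \<ominus>\<^bsub>M\<^esub> pr m x" using neg[OF s] by simp
      then show ?thesis
        unfolding a_minus_def using pr_add[OF x a_inv_closed[OF s], of m] r_neg[OF prc[OF x]] by metis
    qed
    then have "x \<ominus>\<^bsub>M\<^esub> (\<Oplus>\<^bsub>M\<^esub>n\<in>?S. pr n x) = \<zero>\<^bsub>M\<^esub>" by (rule inj[rotated]) (use x s in auto)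
    then have xs: "x = (\<Oplus>\<^bsub>M\<^esub>n\<in>?S. pr n x)" using x s by (simp add: minus_zeroD)
    show "\<exists>!c. (\<forall>n. c n \<in> grade M n) \<and> finite {n. c n \<noteq> \<zero>\<^bsub>M\<^esub>} \<and> x = (\<Oplus>\<^bsub>M\<^esub>n\<in>{n. c n \<noteq> \<zero>\<^bsub>M\<^esub>}. c n)"
    proof (rule ex1I)
      show "(\<forall>n. pr n x \<in> grade M n) \<and> finite ?S \<and> x = (\<Oplus>\<^bsub>M\<^esub>n\<in>?S. pr n x)"
        using pr[OF x] fin[OF x] xs by blast
      fix c assume c: "(\<forall>n. c n \<in> grade M n) \<and> finite {n. c n \<noteq> \<zero>\<^bsub>M\<^esub>} \<and> x = (\<Oplus>\<^bsub>M\<^esub>n\<in>{n. c n \<noteq> \<zero>\<^bsub>M\<^esub>}. c n)"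
      have "pr n x = c n" for n
      proof -
        have "pr n (\<Oplus>\<^bsub>M\<^esub>n\<in>{n. c n \<noteq> \<zero>\<^bsub>M\<^esub>}. c n) = c n" by (rule prsum) (use c in blast)+
        then show ?thesis using c by argo
      qed
      then show "c = (\<lambda>n. pr n x)" by auto
    qed
  qed (rule sg)
qed

text \<open>Applying \<open>h\<close> to the decomposition of \<open>x\<close> gives a decomposition
  of \<open>h x\<close>, and decompositions are unique. This makes kernels of graded maps graded,
  and inverses of bijective graded maps as well.\<close>

lemma component_hom:
  assumes "graded_group M" "graded_group N" "h \<in> carrier M \<rightarrow> carrier N"
    and add: "\<And>x y. x \<in> carrier M \<Longrightarrow> y \<in> carrier M \<Longrightarrow> h (x \<oplus>\<^bsub>M\<^esub> y) = h x \<oplus>\<^bsub>N\<^esub> h y"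
    and gr: "\<And>n. h ` grade M n \<subseteq> grade N n" and x: "x \<in> carrier M"
  shows "component N n (h x) = h (component M n x)"
proof -
  interpret M: graded_group M by fact
  interpret N: graded_group N by fact
  have h0: "h \<zero>\<^bsub>M\<^esub> = \<zero>\<^bsub>N\<^esub>"
    by (rule additive_zero[OF M.abelian_group_axioms N.abelian_group_axioms]) (use assms in auto)
  show ?thesis
  proof (rule N.component_eqI)
    let ?S = "{n. component M n x \<noteq> \<zero>\<^bsub>M\<^esub>}"
    show "finite ?S" using M.component_decomp x by auto
    show "h (component M n x) \<in> grade N n" for n using gr M.component_decomp(1)[OF x] by blast
    show "n \<notin> ?S \<Longrightarrow> h (component M n x) = \<zero>\<^bsub>N\<^esub>" for n using h0 by simp
    have "h x = h (\<Oplus>\<^bsub>M\<^esub>n\<in>?S. component M n x)" using M.component_decomp(3)[OF x] by simp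
    also have "... = (\<Oplus>\<^bsub>N\<^esub>n\<in>?S. h (component M n x))"
      by (rule finsum_additive)
        (use assms h0 M.component_closed[OF x] M.component_decomp(2)[OF x] M.abelian_monoid_axioms N.abelian_monoid_axioms in auto)
    finally show "h x = (\<Oplus>\<^bsub>N\<^esub>n\<in>?S. h (component M n x))" .
  qed
qed

section \<open>Isomorphisms and direct sums of graded modules\<close>

text \<open>\<open>shift\<close> changes the grading only, so the additive group structure passes to
  it by comparing \<open>add_monoid\<close>.\<close>

lemma abelian_group_add_cong:
  "add_monoid M = add_monoid N \<Longrightarrow> abelian_group M = abelian_group N"
  by (simp add: abelian_group_def abelian_monoid_def abelian_group_axioms_def)

text \<open>The negative is asked for as a witness: in a newly built record it is known by a
  formula, while \<open>a_inv\<close> is a definite description.\<close>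

lemma (in abelian_group) additive_subgroupI2:
  assumes "H \<subseteq> carrier G" "\<zero> \<in> H" "\<And>x y. x \<in> H \<Longrightarrow> y \<in> H \<Longrightarrow> x \<oplus> y \<in> H"
    and neg: "\<And>x. x \<in> H \<Longrightarrow> \<exists>y\<in>H. y \<oplus> x = \<zero>"
  shows "additive_subgroup H G"
proof (rule additive_subgroup.intro, rule add.subgroupI)
  show "\<ominus> x \<in> H" if "x \<in> H" for x
    using neg[OF that] assms(1) that by (metis minus_equality subsetD)
qed (use assms in auto)

lemma graded_moduleD:
  assumes "graded_module A M"
  shows "graded_group M" "left_module A M" "ring A" "abelian_group M"
proof -
  show l: "left_module A M" using assms by (simp add: graded_module_def)
  interpret left_module A M by fact
  show "abelian_group M" "ring A" by unfold_locales
  then show "graded_group M"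
    using assms by (simp add: graded_group_def graded_group_axioms_def graded_module_def)
qed

lemma graded_module_smult_grade:
  "graded_module A M \<Longrightarrow> a \<in> grade A m \<Longrightarrow> x \<in> grade M n \<Longrightarrow> a \<odot>\<^bsub>M\<^esub> x \<in> grade M (m + n)"
  unfolding graded_module_def by blast

lemma graded_hom_closed: "h \<in> graded_module_hom A M N \<Longrightarrow> x \<in> carrier M \<Longrightarrow> h x \<in> carrier N"
  by (auto simp: graded_module_hom_def)

lemma graded_hom_add:
  "h \<in> graded_module_hom A M N \<Longrightarrow> x \<in> carrier M \<Longrightarrow> y \<in> carrier M \<Longrightarrow> h (x \<oplus>\<^bsub>M\<^esub> y) = h x \<oplus>\<^bsub>N\<^esub> h y"
  by (auto simp: graded_module_hom_def)

lemma graded_hom_smult: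
  "h \<in> graded_module_hom A M N \<Longrightarrow> a \<in> carrier A \<Longrightarrow> x \<in> carrier M \<Longrightarrow> h (a \<odot>\<^bsub>M\<^esub> x) = a \<odot>\<^bsub>N\<^esub> h x"
  by (auto simp: graded_module_hom_def)

lemma graded_hom_grade: "h \<in> graded_module_hom A M N \<Longrightarrow> x \<in> grade M n \<Longrightarrow> h x \<in> grade N n"
  unfolding graded_module_hom_def by blast

lemma graded_hom_zero:
  assumes "h \<in> graded_module_hom A M N" "abelian_group M" "abelian_group N"
  shows "h \<zero>\<^bsub>M\<^esub> = \<zero>\<^bsub>N\<^esub>"
  by (rule additive_zero[OF assms(2,3)]) (use assms(1) graded_hom_closed graded_hom_add in auto)

lemma graded_module_homI:
  assumes "\<And>x. x \<in> carrier M \<Longrightarrow> h x \<in> carrier N"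
    and "\<And>x y. x \<in> carrier M \<Longrightarrow> y \<in> carrier M \<Longrightarrow> h (x \<oplus>\<^bsub>M\<^esub> y) = h x \<oplus>\<^bsub>N\<^esub> h y"
    and "\<And>a x. a \<in> carrier A \<Longrightarrow> x \<in> carrier M \<Longrightarrow> h (a \<odot>\<^bsub>M\<^esub> x) = a \<odot>\<^bsub>N\<^esub> h x"
    and "\<And>n x. x \<in> grade M n \<Longrightarrow> h x \<in> grade N n"
  shows "h \<in> graded_module_hom A M N"
  using assms by (auto simp: graded_module_hom_def)

lemma graded_isoI:
  assumes "h \<in> graded_module_hom A M N" "g \<in> carrier N \<rightarrow> carrier M"
    and "\<And>x. x \<in> carrier M \<Longrightarrow> g (h x) = x" "\<And>y. y \<in> carrier N \<Longrightarrow> h (g y) = y"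
  shows "graded_isomorphic A M N"
proof -
  have "bij_betw h (carrier M) (carrier N)"
    by (rule bij_betw_byWitness[where f' = g]) (use assms graded_hom_closed[OF assms(1)] in auto)
  then show ?thesis using assms(1) by (auto simp: graded_isomorphic_def)
qed

text \<open>\<open>graded_isomorphic\<close> asks for a bijective graded homomorphism. Its inverse
  respects sums and scalars by injectivity, and degrees because of
  \<open>component_hom\<close>.\<close>

lemma graded_isoE:
  assumes "graded_module A M" "graded_module A N" "graded_isomorphic A M N"
  obtains h g where "h \<in> graded_module_hom A M N" "g \<in> graded_module_hom A N M"
    "\<And>x. x \<in> carrier M \<Longrightarrow> g (h x) = x" "\<And>y. y \<in> carrier N \<Longrightarrow> h (g y) = y"
proof -
  obtain h where h: "h \<in> graded_module_hom A M N" "bij_betw h (carrier M) (carrier N)"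
    using assms(3) by (auto simp: graded_isomorphic_def)
  interpret M: graded_group M using graded_moduleD[OF assms(1)] by simp
  interpret N: graded_group N using graded_moduleD[OF assms(2)] by simp
  interpret L: left_module A M using graded_moduleD[OF assms(1)] by simp
  define g where "g = inv_into (carrier M) h"
  have gh: "g (h x) = x" if "x \<in> carrier M" for x
    unfolding g_def using h(2) that by (simp add: bij_betw_inv_into_left)
  have hg: "h (g y) = y" if "y \<in> carrier N" for y
    unfolding g_def using h(2) that by (simp add: bij_betw_inv_into_right)
  have gc: "g y \<in> carrier M" if "y \<in> carrier N" for y
    unfolding g_def using h(2) that by (metis bij_betw_imp_surj_on inv_into_into)
  have inj: "x = y" if "x \<in> carrier M" "y \<in> carrier M" "h x = h y" for x y
    using gh that by metis
  have "g \<in> graded_module_hom A N M"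
  proof (rule graded_module_homI)
    fix x y assume "x \<in> carrier N" "y \<in> carrier N"
    then show "g (x \<oplus>\<^bsub>N\<^esub> y) = g x \<oplus>\<^bsub>M\<^esub> g y"
      by (intro inj) (simp_all add: hg gc graded_hom_add[OF h(1)])
  next
    fix a x assume ax: "a \<in> carrier A" "x \<in> carrier N"
    then have "h (a \<odot>\<^bsub>M\<^esub> g x) = a \<odot>\<^bsub>N\<^esub> x" by (simp add: hg gc graded_hom_smult[OF h(1)])
    then show "g (a \<odot>\<^bsub>N\<^esub> x) = a \<odot>\<^bsub>M\<^esub> g x" using gh gc ax L.smult_closed by metis
  next
    fix n y assume y: "y \<in> grade N n"
    then have yc: "y \<in> carrier N" by (rule N.grade_closed)
    \<comment> \<open>The component of degree \<open>n\<close> of \<open>g y\<close> has the same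
      image \<open>y\<close> as \<open>g y\<close> itself; injectivity then puts \<open>g y\<close>
      in degree \<open>n\<close>.\<close>
    have "h (component M n (g y)) = component N n (h (g y))"
      by (rule component_hom[symmetric])
        (use h(1) gc[OF yc] M.graded_group_axioms N.graded_group_axioms in \<open>auto simp: graded_module_hom_def\<close>)
    also have "... = y" using N.component_grade[OF y] hg[OF yc] by simp
    finally have "component M n (g y) = g y" using gh M.component_closed gc[OF yc] by metis
    then show "g y \<in> grade M n" using M.component_decomp(1)[OF gc[OF yc]] by metis
  qed (rule gc)
  then show ?thesis using that h(1) gh hg by blast
qed

lemma graded_iso_refl: "graded_isomorphic A M M"
  by (rule graded_isoI[where h = id and g = id]) (auto simp: graded_module_hom_def)

lemma graded_iso_sym:
  assumes "graded_module A M" "graded_module A N" "graded_isomorphic A M N"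
  shows "graded_isomorphic A N M"
proof -
  obtain h g where "h \<in> graded_module_hom A M N" "g \<in> graded_module_hom A N M"
    "\<And>x. x \<in> carrier M \<Longrightarrow> g (h x) = x" "\<And>y. y \<in> carrier N \<Longrightarrow> h (g y) = y"
    using graded_isoE[OF assms] by blast
  then show ?thesis by (intro graded_isoI[of g _ _ _ h]) (auto simp: graded_hom_closed)
qed

lemma graded_hom_comp:
  "h \<in> graded_module_hom A M N \<Longrightarrow> g \<in> graded_module_hom A N P \<Longrightarrow> g \<circ> h \<in> graded_module_hom A M P"
  by (rule graded_module_homI)
    (simp_all add: graded_hom_closed graded_hom_add graded_hom_smult graded_hom_grade)

lemma graded_iso_trans [trans]:
  assumes "graded_isomorphic A M N" "graded_isomorphic A N P"
  shows "graded_isomorphic A M P"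
  using assms unfolding graded_isomorphic_def by (meson bij_betw_trans graded_hom_comp)

subsection \<open>Shifts\<close>

lemma shift_simps [simp]:
  "carrier (shift n M) = carrier M" "add (shift n M) = add M" "ring.zero (shift n M) = ring.zero M"
  "smult (shift n M) = smult M" "grade (shift n M) k = grade M (n + k)"
  by (simp_all add: shift_def)

lemma shift_shift: "shift m (shift n M) = shift (m + n) M"
  by (simp add: shift_def ac_simps)

lemma shift_0: "shift 0 M = M"
  by (simp add: shift_def)

lemma shift_graded:
  assumes "graded_module A M"
  shows "graded_module A (shift n M)"
proof -
  interpret M: graded_group M using graded_moduleD[OF assms] by simp
  interpret L: left_module A M using graded_moduleD[OF assms] by simp
  have ag: "abelian_group (shift n M)"
    using M.abelian_group_axioms abelian_group_add_cong[of M "shift n M"] by (simp add: shift_def)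
  have "left_module A (shift n M)"
    using ag L.ring_axioms
    by (simp add: left_module_def left_module_axioms_def L.smult_closed L.smult_l_distr
        L.smult_r_distr L.smult_assoc1 L.smult_one)
  moreover have "is_grading (shift n M)"
  proof (rule is_gradingI[where pr = "\<lambda>k. component M (n + k)", OF ag])
    show "additive_subgroup (grade (shift n M) k) (shift n M)" for k
      using M.grade_subgroup[of "n + k"] by (simp add: additive_subgroup_def)
    show "finite {k. component M (n + k) x \<noteq> \<zero>\<^bsub>shift n M\<^esub>}" if "x \<in> carrier (shift n M)" for x
    proof -
      have "{k. component M (n + k) x \<noteq> \<zero>\<^bsub>M\<^esub>} = (\<lambda>k. k - n) ` {k. component M k x \<noteq> \<zero>\<^bsub>M\<^esub>}"
        by (auto simp: image_iff) (metis add_diff_cancel_left')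
      then show ?thesis using M.component_decomp(2)[of x] that by simp
    qed
    show "x = \<zero>\<^bsub>shift n M\<^esub>" if "x \<in> carrier (shift n M)" "\<And>k. component M (n + k) x = \<zero>\<^bsub>shift n M\<^esub>" for x
    proof -
      have "component M k x = \<zero>\<^bsub>M\<^esub>" for k using that(2)[of "k - n"] by simp
      then show ?thesis using M.component_zero_imp[of x] that by simp
    qed
  qed (auto simp: M.component_decomp M.component_add M.component_grade)
  moreover have "a \<odot>\<^bsub>M\<^esub> x \<in> grade M (n + (m + k))" if "a \<in> grade A m" "x \<in> grade M (n + k)" for a x m k
    using assms that unfolding graded_module_def by (metis add.left_commute)
  ultimately show ?thesis by (simp add: graded_module_def)
qed

lemma shift_hom: "h \<in> graded_module_hom A M N \<Longrightarrow> h \<in> graded_module_hom A (shift n M) (shift n N)"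
  by (auto simp: graded_module_hom_def)

lemma shift_iso: "graded_isomorphic A M N \<Longrightarrow> graded_isomorphic A (shift n M) (shift n N)"
  unfolding graded_isomorphic_def by (metis shift_hom shift_simps(1))

subsection \<open>Finite direct sums\<close>

text \<open>Functions are used in place of iterated pairs, whose type would grow with each summand.
  With index set \<open>{..<n}\<close> and shifted regular modules this is
  \<open>graded_free_module\<close> itself, not just an isomorphic copy.\<close>

definition graded_sum :: "'i set \<Rightarrow> ('i \<Rightarrow> ('a, 'm) gmodule) \<Rightarrow> ('a, 'i \<Rightarrow> 'm) gmodule" where
  "graded_sum I P = \<lparr>carrier = (\<Pi>\<^sub>E j\<in>I. carrier (P j)), monoid.mult = undefined, one = undefined,
     ring.zero = (\<lambda>j\<in>I. \<zero>\<^bsub>P j\<^esub>), add = (\<lambda>f g. \<lambda>j\<in>I. f j \<oplus>\<^bsub>P j\<^esub> g j),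
     smult = (\<lambda>a f. \<lambda>j\<in>I. a \<odot>\<^bsub>P j\<^esub> f j), grade = (\<lambda>k. \<Pi>\<^sub>E j\<in>I. grade (P j) k)\<rparr>"

lemma graded_sum_simps [simp]:
  "carrier (graded_sum I P) = (\<Pi>\<^sub>E j\<in>I. carrier (P j))" "\<zero>\<^bsub>graded_sum I P\<^esub> = (\<lambda>j\<in>I. \<zero>\<^bsub>P j\<^esub>)"
  "f \<oplus>\<^bsub>graded_sum I P\<^esub> g = (\<lambda>j\<in>I. f j \<oplus>\<^bsub>P j\<^esub> g j)" "a \<odot>\<^bsub>graded_sum I P\<^esub> f = (\<lambda>j\<in>I. a \<odot>\<^bsub>P j\<^esub> f j)"
  "grade (graded_sum I P) k = (\<Pi>\<^sub>E j\<in>I. grade (P j) k)"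
  by (simp_all add: graded_sum_def)

lemma direct_sum_simps [simp]:
  "carrier (direct_sum M N) = carrier M \<times> carrier N" "\<zero>\<^bsub>direct_sum M N\<^esub> = (\<zero>\<^bsub>M\<^esub>, \<zero>\<^bsub>N\<^esub>)"
  "x \<oplus>\<^bsub>direct_sum M N\<^esub> y = (fst x \<oplus>\<^bsub>M\<^esub> fst y, snd x \<oplus>\<^bsub>N\<^esub> snd y)"
  "a \<odot>\<^bsub>direct_sum M N\<^esub> x = (a \<odot>\<^bsub>M\<^esub> fst x, a \<odot>\<^bsub>N\<^esub> snd x)"
  "grade (direct_sum M N) n = grade M n \<times> grade N n"
  by (simp_all add: direct_sum_def)

lemma shift_graded_sum: "shift n (graded_sum I P) = graded_sum I (\<lambda>j. shift n (P j))"
  by (simp add: shift_def graded_sum_def)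

lemma shift_direct_sum: "shift n (direct_sum M N) = direct_sum (shift n M) (shift n N)"
  by (simp add: shift_def direct_sum_def)

text \<open>Equality of records rather than isomorphism, since \<open>restrict\<close> and the
  extensional products cut off everything outside the index set.\<close>

lemma graded_sum_cong: "I = J \<Longrightarrow> (\<And>j. j \<in> J \<Longrightarrow> P j = Q j) \<Longrightarrow> graded_sum I P = graded_sum J Q"
  unfolding graded_sum_def by (auto simp: fun_eq_iff restrict_def PiE_def Pi_def)

lemma abelian_group_graded_sum:
  assumes "\<And>j. j \<in> I \<Longrightarrow> abelian_group (P j)"
  shows "abelian_group (graded_sum I P)"
proof -
  note m = assms[THEN abelian_group.axioms(1)]
  show ?thesis
  proof (rule abelian_groupI)
    fix x assume x: "x \<in> carrier (graded_sum I P)"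
    have "(\<lambda>j\<in>I. \<ominus>\<^bsub>P j\<^esub> x j) \<in> carrier (graded_sum I P)"
      using x assms by (auto intro!: abelian_group.a_inv_closed)
    moreover have "(\<lambda>j\<in>I. \<ominus>\<^bsub>P j\<^esub> x j) \<oplus>\<^bsub>graded_sum I P\<^esub> x = \<zero>\<^bsub>graded_sum I P\<^esub>"
      using x assms by (auto intro!: restrict_ext abelian_group.l_neg)
    ultimately show "\<exists>y\<in>carrier (graded_sum I P). y \<oplus>\<^bsub>graded_sum I P\<^esub> x = \<zero>\<^bsub>graded_sum I P\<^esub>" by blast
  next
    fix x assume x: "x \<in> carrier (graded_sum I P)"
    have "(\<zero>\<^bsub>graded_sum I P\<^esub> \<oplus>\<^bsub>graded_sum I P\<^esub> x) j = x j" for j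
      using x m by (cases "j \<in> I") (auto simp: PiE_def Pi_def extensional_def intro!: abelian_monoid.l_zero)
    then show "\<zero>\<^bsub>graded_sum I P\<^esub> \<oplus>\<^bsub>graded_sum I P\<^esub> x = x" by blast
  qed (use m in \<open>auto intro!: restrict_ext abelian_monoid.a_closed abelian_monoid.zero_closed
        abelian_monoid.a_assoc abelian_monoid.a_comm\<close>)
qed

lemma graded_sum_graded_module:
  assumes "ring A" "finite I" and P: "\<And>j. j \<in> I \<Longrightarrow> graded_module A (P j)"
  shows "graded_module A (graded_sum I P)"
proof -
  note g = P[THEN graded_moduleD(1)] and l = P[THEN graded_moduleD(2)] and a = P[THEN graded_moduleD(4)]
  have gc: "x \<in> carrier (P j)" if "j \<in> I" "x \<in> grade (P j) k" for x j k
    using graded_group.grade_closed[OF g] that by blast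
  have ag: "abelian_group (graded_sum I P)" using a by (rule abelian_group_graded_sum)
  have "(\<lambda>j\<in>I. \<one>\<^bsub>A\<^esub> \<odot>\<^bsub>P j\<^esub> x j) = x" if "x \<in> (\<Pi>\<^sub>E j\<in>I. carrier (P j))" for x
    using that l by (auto simp: fun_eq_iff PiE_def extensional_def intro!: left_module.smult_one)
  then have "left_module_axioms A (graded_sum I P)"
    using l by unfold_locales
      (auto simp: PiE_def Pi_def intro!: restrict_ext left_module.smult_closed left_module.smult_l_distr
        left_module.smult_r_distr left_module.smult_assoc1)
  then have "left_module A (graded_sum I P)" using ag assms(1) by (simp add: left_module_def)
  moreover have "is_grading (graded_sum I P)"
  proof (rule is_gradingI[where pr = "\<lambda>k f. \<lambda>j\<in>I. component (P j) k (f j)", OF ag])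
    show "additive_subgroup (grade (graded_sum I P) k) (graded_sum I P)" for k
    proof (rule abelian_group.additive_subgroupI2[OF ag])
      fix x assume x: "x \<in> grade (graded_sum I P) k"
      have "(\<lambda>j\<in>I. \<ominus>\<^bsub>P j\<^esub> x j) \<in> grade (graded_sum I P) k"
        using x g by (auto intro!: graded_group.grade_neg)
      moreover have "(\<lambda>j\<in>I. \<ominus>\<^bsub>P j\<^esub> x j) \<oplus>\<^bsub>graded_sum I P\<^esub> x = \<zero>\<^bsub>graded_sum I P\<^esub>"
        using x a g by (auto simp: PiE_def Pi_def intro!: restrict_ext abelian_group.l_neg gc)
      ultimately show "\<exists>y\<in>grade (graded_sum I P) k. y \<oplus>\<^bsub>graded_sum I P\<^esub> x = \<zero>\<^bsub>graded_sum I P\<^esub>" by blast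
    qed (use g gc in \<open>auto simp: PiE_def Pi_def intro!: graded_group.grade_zero graded_group.grade_add\<close>)
    show "finite {k. (\<lambda>j\<in>I. component (P j) k (x j)) \<noteq> \<zero>\<^bsub>graded_sum I P\<^esub>}" if "x \<in> carrier (graded_sum I P)" for x
    proof (rule finite_subset)
      \<comment> \<open>A degree occurs in a tuple only if it occurs in some coordinate, and there
        are finitely many coordinates.\<close>
      show "{k. (\<lambda>j\<in>I. component (P j) k (x j)) \<noteq> \<zero>\<^bsub>graded_sum I P\<^esub>} \<subseteq> (\<Union>j\<in>I. {k. component (P j) k (x j) \<noteq> \<zero>\<^bsub>P j\<^esub>})"
        by (auto simp: fun_eq_iff)
      show "finite (\<Union>j\<in>I. {k. component (P j) k (x j) \<noteq> \<zero>\<^bsub>P j\<^esub>})"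
        using assms(2) g that by (auto intro!: graded_group.component_decomp(2))
    qed
    show "x = \<zero>\<^bsub>graded_sum I P\<^esub>" if x: "x \<in> carrier (graded_sum I P)"
      and 0: "\<And>k. (\<lambda>j\<in>I. component (P j) k (x j)) = \<zero>\<^bsub>graded_sum I P\<^esub>" for x
    proof
      fix j
      have "component (P j) k (x j) = \<zero>\<^bsub>P j\<^esub>" if "j \<in> I" for k
        using fun_cong[OF 0[of k], of j] that by simp
      then have "x j = \<zero>\<^bsub>P j\<^esub>" if "j \<in> I"
        by (rule graded_group.component_zero_imp[OF g[OF that], rotated]) (use x that in auto)
      then show "x j = \<zero>\<^bsub>graded_sum I P\<^esub> j"
        using x by (cases "j \<in> I") (auto simp: PiE_def extensional_def)
    qed
    show "(\<lambda>j\<in>I. component (P j) m (x j)) = (if m = n then x else \<zero>\<^bsub>graded_sum I P\<^esub>)" if x: "x \<in> grade (graded_sum I P) n" for m n x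
    proof
      fix j
      show "(\<lambda>j\<in>I. component (P j) m (x j)) j = (if m = n then x else \<zero>\<^bsub>graded_sum I P\<^esub>) j"
        using x graded_group.component_grade[OF g, of j "x j" n m]
        by (cases "j \<in> I") (auto simp: PiE_def Pi_def extensional_def)
    qed
  next
    fix x y k assume x: "x \<in> carrier (graded_sum I P)" and y: "y \<in> carrier (graded_sum I P)"
    have xy: "x j \<in> carrier (P j)" "y j \<in> carrier (P j)" if "j \<in> I" for j using x y that by auto
    show "(\<lambda>j\<in>I. component (P j) k (x j)) \<in> grade (graded_sum I P) k"
      using graded_group.component_decomp(1)[OF g xy(1)] by simp
    have "component (P j) k (x j \<oplus>\<^bsub>P j\<^esub> y j) = component (P j) k (x j) \<oplus>\<^bsub>P j\<^esub> component (P j) k (y j)"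
      if "j \<in> I" for j
      using graded_group.component_add[OF g[OF that] xy[OF that]] .
    then show "(\<lambda>j\<in>I. component (P j) k ((x \<oplus>\<^bsub>graded_sum I P\<^esub> y) j)) =
      (\<lambda>j\<in>I. component (P j) k (x j)) \<oplus>\<^bsub>graded_sum I P\<^esub> (\<lambda>j\<in>I. component (P j) k (y j))"
      by (auto intro!: restrict_ext)
  qed
  moreover have "\<forall>m n. \<forall>a\<in>grade A m. \<forall>x\<in>grade (graded_sum I P) n. a \<odot>\<^bsub>graded_sum I P\<^esub> x \<in> grade (graded_sum I P) (m + n)"
  proof (intro allI ballI)
    fix m n a x assume "a \<in> grade A m" "x \<in> grade (graded_sum I P) n"
    then have "a \<odot>\<^bsub>P j\<^esub> x j \<in> grade (P j) (m + n)" if "j \<in> I" for j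
      by (intro graded_module_smult_grade[OF P[OF that]]) (use that in auto)
    then show "a \<odot>\<^bsub>graded_sum I P\<^esub> x \<in> grade (graded_sum I P) (m + n)" by auto
  qed
  ultimately show ?thesis by (simp add: graded_module_def)
qed

lemma direct_sum_graded_module:
  assumes M: "graded_module A M" and N: "graded_module A N"
  shows "graded_module A (direct_sum M N)"
proof -
  interpret M: graded_group M using graded_moduleD[OF M] by simp
  interpret N: graded_group N using graded_moduleD[OF N] by simp
  interpret LM: left_module A M using graded_moduleD[OF M] by simp
  interpret LN: left_module A N using graded_moduleD[OF N] by simp
  have ag: "abelian_group (direct_sum M N)"
  proof (rule abelian_groupI)
    fix x assume "x \<in> carrier (direct_sum M N)"
    then have "(\<ominus>\<^bsub>M\<^esub> fst x, \<ominus>\<^bsub>N\<^esub> snd x) \<in> carrier (direct_sum M N)"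
      "(\<ominus>\<^bsub>M\<^esub> fst x, \<ominus>\<^bsub>N\<^esub> snd x) \<oplus>\<^bsub>direct_sum M N\<^esub> x = \<zero>\<^bsub>direct_sum M N\<^esub>"
      by (auto simp: M.l_neg N.l_neg)
    then show "\<exists>y\<in>carrier (direct_sum M N). y \<oplus>\<^bsub>direct_sum M N\<^esub> x = \<zero>\<^bsub>direct_sum M N\<^esub>" by blast
  qed (auto simp: M.a_ac N.a_ac)
  have "left_module_axioms A (direct_sum M N)"
    by unfold_locales (auto simp: LM.smult_closed LM.smult_l_distr LM.smult_r_distr LM.smult_assoc1
        LM.smult_one LN.smult_closed LN.smult_l_distr LN.smult_r_distr LN.smult_assoc1 LN.smult_one)
  then have "left_module A (direct_sum M N)"
    using ag LM.ring_axioms by (simp add: left_module_def)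
  moreover have "is_grading (direct_sum M N)"
  proof (rule is_gradingI[where pr = "\<lambda>k x. (component M k (fst x), component N k (snd x))", OF ag])
    show "additive_subgroup (grade (direct_sum M N) k) (direct_sum M N)" for k
    proof (rule abelian_group.additive_subgroupI2[OF ag])
      fix x assume "x \<in> grade (direct_sum M N) k"
      then have "(\<ominus>\<^bsub>M\<^esub> fst x, \<ominus>\<^bsub>N\<^esub> snd x) \<in> grade (direct_sum M N) k"
        "(\<ominus>\<^bsub>M\<^esub> fst x, \<ominus>\<^bsub>N\<^esub> snd x) \<oplus>\<^bsub>direct_sum M N\<^esub> x = \<zero>\<^bsub>direct_sum M N\<^esub>"
        using M.grade_closed[of "fst x"] N.grade_closed[of "snd x"]
        by (auto simp: M.grade_neg N.grade_neg M.l_neg N.l_neg)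
      then show "\<exists>y\<in>grade (direct_sum M N) k. y \<oplus>\<^bsub>direct_sum M N\<^esub> x = \<zero>\<^bsub>direct_sum M N\<^esub>" by blast
    qed (auto simp: M.grade_closed N.grade_closed M.grade_zero N.grade_zero M.grade_add N.grade_add)
    show "finite {k. (component M k (fst x), component N k (snd x)) \<noteq> \<zero>\<^bsub>direct_sum M N\<^esub>}"
      if "x \<in> carrier (direct_sum M N)" for x
    proof (rule finite_subset)
      show "finite ({k. component M k (fst x) \<noteq> \<zero>\<^bsub>M\<^esub>} \<union> {k. component N k (snd x) \<noteq> \<zero>\<^bsub>N\<^esub>})"
        using that M.component_decomp(2)[of "fst x"] N.component_decomp(2)[of "snd x"] by auto
    qed auto
    show "x = \<zero>\<^bsub>direct_sum M N\<^esub>" if "x \<in> carrier (direct_sum M N)"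
      "\<And>k. (component M k (fst x), component N k (snd x)) = \<zero>\<^bsub>direct_sum M N\<^esub>" for x
      using that M.component_zero_imp[of "fst x"] N.component_zero_imp[of "snd x"]
      by (simp add: prod_eq_iff mem_Times_iff)
  qed (auto simp: M.component_decomp(1) M.component_add M.component_grade
        N.component_decomp(1) N.component_add N.component_grade split: if_splits)
  ultimately show ?thesis
    using graded_module_smult_grade[OF M] graded_module_smult_grade[OF N]
    by (auto simp: graded_module_def)
qed

lemma direct_sum_iso:
  assumes "graded_isomorphic A M M'" "graded_isomorphic A N N'"
  shows "graded_isomorphic A (direct_sum M N) (direct_sum M' N')"
proof -
  obtain h k where h: "h \<in> graded_module_hom A M M'" "bij_betw h (carrier M) (carrier M')"
    and k: "k \<in> graded_module_hom A N N'" "bij_betw k (carrier N) (carrier N')"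
    using assms by (auto simp: graded_isomorphic_def)
  have "map_prod h k \<in> graded_module_hom A (direct_sum M N) (direct_sum M' N')"
    using h k by (intro graded_module_homI)
      (auto simp: graded_hom_closed graded_hom_add graded_hom_smult graded_hom_grade)
  moreover have "bij_betw (map_prod h k) (carrier (direct_sum M N)) (carrier (direct_sum M' N'))"
    using bij_betw_map_prod[OF h(2) k(2)] by (simp add: map_prod_def)
  ultimately show ?thesis by (auto simp: graded_isomorphic_def)
qed

lemma graded_sum_iso:
  assumes "\<And>j. j \<in> I \<Longrightarrow> graded_isomorphic A (P j) (Q j)"
  shows "graded_isomorphic A (graded_sum I P) (graded_sum I Q)"
proof -
  have "\<forall>j\<in>I. \<exists>h. h \<in> graded_module_hom A (P j) (Q j) \<and> bij_betw h (carrier (P j)) (carrier (Q j))"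
    using assms by (auto simp: graded_isomorphic_def)
  then obtain h where h: "\<And>j. j \<in> I \<Longrightarrow> h j \<in> graded_module_hom A (P j) (Q j)"
    and b: "\<And>j. j \<in> I \<Longrightarrow> bij_betw (h j) (carrier (P j)) (carrier (Q j))" by metis
  let ?g = "\<lambda>j. inv_into (carrier (P j)) (h j)"
  show ?thesis
  proof (rule graded_isoI[where h = "\<lambda>f. \<lambda>j\<in>I. h j (f j)" and g = "\<lambda>f. \<lambda>j\<in>I. ?g j (f j)"])
    show "(\<lambda>f. \<lambda>j\<in>I. h j (f j)) \<in> graded_module_hom A (graded_sum I P) (graded_sum I Q)"
    proof (rule graded_module_homI)
      fix x y assume "x \<in> carrier (graded_sum I P)" "y \<in> carrier (graded_sum I P)"
      then have xy: "x j \<in> carrier (P j)" "y j \<in> carrier (P j)" if "j \<in> I" for j using that by auto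
      then show "(\<lambda>j\<in>I. h j ((x \<oplus>\<^bsub>graded_sum I P\<^esub> y) j)) =
          (\<lambda>j\<in>I. h j (x j)) \<oplus>\<^bsub>graded_sum I Q\<^esub> (\<lambda>j\<in>I. h j (y j))"
        using graded_hom_add[OF h] by (auto intro!: restrict_ext)
      show "(\<lambda>j\<in>I. h j (x j)) \<in> carrier (graded_sum I Q)"
        using xy graded_hom_closed[OF h] by auto
      fix a assume "a \<in> carrier A"
      then show "(\<lambda>j\<in>I. h j ((a \<odot>\<^bsub>graded_sum I P\<^esub> x) j)) = a \<odot>\<^bsub>graded_sum I Q\<^esub> (\<lambda>j\<in>I. h j (x j))"
        using xy graded_hom_smult[OF h] by (auto intro!: restrict_ext)
    qed (use graded_hom_grade[OF h] in auto)
    show "(\<lambda>f. \<lambda>j\<in>I. ?g j (f j)) \<in> carrier (graded_sum I Q) \<rightarrow> carrier (graded_sum I P)"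
    proof -
      have "?g j y \<in> carrier (P j)" if "j \<in> I" "y \<in> carrier (Q j)" for j y
        using bij_betw_imp_surj_on[OF b[OF that(1)]] that(2) by (metis inv_into_into)
      then show ?thesis by (auto simp: PiE_def Pi_def)
    qed
    show "(\<lambda>j\<in>I. ?g j ((\<lambda>j\<in>I. h j (x j)) j)) = x" if x: "x \<in> carrier (graded_sum I P)" for x
    proof
      fix j show "(\<lambda>j\<in>I. ?g j ((\<lambda>j\<in>I. h j (x j)) j)) j = x j"
        using x bij_betw_inv_into_left[OF b, of j "x j"] by (cases "j \<in> I") (auto simp: PiE_def Pi_def extensional_def)
    qed
    show "(\<lambda>j\<in>I. h j ((\<lambda>j\<in>I. ?g j (x j)) j)) = x" if x: "x \<in> carrier (graded_sum I Q)" for x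
    proof
      fix j show "(\<lambda>j\<in>I. h j ((\<lambda>j\<in>I. ?g j (x j)) j)) j = x j"
        using x bij_betw_inv_into_right[OF b, of j "x j"] by (cases "j \<in> I") (auto simp: PiE_def Pi_def extensional_def)
    qed
  qed
qed

lemma graded_sum_reindex:
  assumes b: "bij_betw b J I"
  shows "graded_isomorphic A (graded_sum I P) (graded_sum J (\<lambda>j. P (b j)))"
proof (rule graded_isoI[where h = "\<lambda>f. \<lambda>j\<in>J. f (b j)" and g = "\<lambda>f. \<lambda>i\<in>I. f (inv_into J b i)"])
  have bI: "b j \<in> I" if "j \<in> J" for j using b that by (auto simp: bij_betw_def)
  have iJ: "inv_into J b i \<in> J" "b (inv_into J b i) = i" if "i \<in> I" for i
    using b that by (auto simp: bij_betw_def f_inv_into_f intro: inv_into_into)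
  have ib: "inv_into J b (b j) = j" if "j \<in> J" for j using b that by (auto simp: bij_betw_def)
  show "(\<lambda>f. \<lambda>j\<in>J. f (b j)) \<in> graded_module_hom A (graded_sum I P) (graded_sum J (\<lambda>j. P (b j)))"
    by (rule graded_module_homI) (use bI in \<open>auto intro!: restrict_ext\<close>)
  have "f (inv_into J b i) \<in> carrier (P i)" if "f \<in> (\<Pi>\<^sub>E j\<in>J. carrier (P (b j)))" "i \<in> I" for f i
    using PiE_mem[OF that(1) iJ(1)[OF that(2)]] iJ(2)[OF that(2)] by simp
  then show "(\<lambda>f. \<lambda>i\<in>I. f (inv_into J b i)) \<in> carrier (graded_sum J (\<lambda>j. P (b j))) \<rightarrow> carrier (graded_sum I P)"
    by auto
  show "(\<lambda>i\<in>I. (\<lambda>j\<in>J. x (b j)) (inv_into J b i)) = x" if x: "x \<in> carrier (graded_sum I P)" for x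
  proof
    fix i show "(\<lambda>i\<in>I. (\<lambda>j\<in>J. x (b j)) (inv_into J b i)) i = x i"
      using x iJ[of i] by (cases "i \<in> I") (auto simp: PiE_def extensional_def)
  qed
  show "(\<lambda>j\<in>J. (\<lambda>i\<in>I. x (inv_into J b i)) (b j)) = x" if x: "x \<in> carrier (graded_sum J (\<lambda>j. P (b j)))" for x
  proof
    fix j show "(\<lambda>j\<in>J. (\<lambda>i\<in>I. x (inv_into J b i)) (b j)) j = x j"
      using x ib bI by (cases "j \<in> J") (auto simp: PiE_def extensional_def)
  qed
qed

lemma graded_sum_union:
  assumes "I \<inter> J = {}"
  shows "graded_isomorphic A (graded_sum (I \<union> J) P) (direct_sum (graded_sum I P) (graded_sum J P))"
proof (rule graded_isoI[where h = "\<lambda>f. (restrict f I, restrict f J)"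
      and g = "\<lambda>x. \<lambda>j\<in>I \<union> J. if j \<in> I then fst x j else snd x j"])
  show "(\<lambda>f. (restrict f I, restrict f J)) \<in> graded_module_hom A (graded_sum (I \<union> J) P)
    (direct_sum (graded_sum I P) (graded_sum J P))"
    by (rule graded_module_homI) (auto intro!: restrict_ext)
  show "(\<lambda>j\<in>I \<union> J. if j \<in> I then fst (restrict x I, restrict x J) j else snd (restrict x I, restrict x J) j) = x"
    if x: "x \<in> carrier (graded_sum (I \<union> J) P)" for x
    using x by (auto simp: fun_eq_iff PiE_def extensional_def)
  show "(restrict (\<lambda>j\<in>I \<union> J. if j \<in> I then fst y j else snd y j) I,
      restrict (\<lambda>j\<in>I \<union> J. if j \<in> I then fst y j else snd y j) J) = y"
    if y: "y \<in> carrier (direct_sum (graded_sum I P) (graded_sum J P))" for y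
    using y assms by (auto simp: prod_eq_iff fun_eq_iff PiE_def extensional_def)
qed (auto simp: PiE_def Pi_def)

text \<open>Lets complements be chosen one summand at a time when a sum of left ideals is shown to
  be projective.\<close>

lemma graded_sum_pairs:
  "graded_isomorphic A (direct_sum (graded_sum I P) (graded_sum I Q)) (graded_sum I (\<lambda>j. direct_sum (P j) (Q j)))"
proof (rule graded_isoI[where h = "\<lambda>x. \<lambda>j\<in>I. (fst x j, snd x j)"
      and g = "\<lambda>f. (\<lambda>j\<in>I. fst (f j), \<lambda>j\<in>I. snd (f j))"])
  show "(\<lambda>x. \<lambda>j\<in>I. (fst x j, snd x j)) \<in> graded_module_hom A
     (direct_sum (graded_sum I P) (graded_sum I Q)) (graded_sum I (\<lambda>j. direct_sum (P j) (Q j)))"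
    by (rule graded_module_homI) (auto intro!: restrict_ext)
  show "(\<lambda>f. (\<lambda>j\<in>I. fst (f j), \<lambda>j\<in>I. snd (f j))) \<in> carrier (graded_sum I (\<lambda>j. direct_sum (P j) (Q j)))
     \<rightarrow> carrier (direct_sum (graded_sum I P) (graded_sum I Q))"
    by (auto simp: PiE_def Pi_def mem_Times_iff)
  show "((\<lambda>j\<in>I. fst ((\<lambda>j\<in>I. (fst x j, snd x j)) j)), (\<lambda>j\<in>I. snd ((\<lambda>j\<in>I. (fst x j, snd x j)) j))) = x"
    if "x \<in> carrier (direct_sum (graded_sum I P) (graded_sum I Q))" for x
    using that by (auto simp: prod_eq_iff fun_eq_iff PiE_def extensional_def)
  show "(\<lambda>j\<in>I. (fst ((\<lambda>j\<in>I. fst (y j)), (\<lambda>j\<in>I. snd (y j))) j, snd ((\<lambda>j\<in>I. fst (y j)), (\<lambda>j\<in>I. snd (y j))) j)) = y"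
    if "y \<in> carrier (graded_sum I (\<lambda>j. direct_sum (P j) (Q j)))" for y
    using that by (auto simp: prod_eq_iff fun_eq_iff PiE_def extensional_def)
qed

lemma graded_sum_singleton: "graded_isomorphic A (graded_sum {i} P) (P i)"
proof (rule graded_isoI[where h = "\<lambda>f. f i" and g = "\<lambda>x. \<lambda>j\<in>{i}. x"])
  show "(\<lambda>f. f i) \<in> graded_module_hom A (graded_sum {i} P) (P i)"
    by (rule graded_module_homI) auto
  show "(\<lambda>j\<in>{i}. x i) = x" if "x \<in> carrier (graded_sum {i} P)" for x
    using that by (auto simp: fun_eq_iff PiE_def extensional_def)
qed auto

lemma graded_sum_insert:
  assumes "i \<notin> I"
  shows "graded_isomorphic A (graded_sum (insert i I) P) (direct_sum (P i) (graded_sum I P))"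
  using graded_sum_union[of "{i}" I A P] assms
    direct_sum_iso[OF graded_sum_singleton[of A i P] graded_iso_refl[of A "graded_sum I P"]]
  by (auto intro: graded_iso_trans)

section \<open>Graded rings and homogeneous idempotents\<close>

locale graded_ring = ring A for A :: "('k, 'a) gmodule" (structure) +
  assumes is_grading_ring: "is_grading A"
    and grade_mult: "x \<in> grade A m \<Longrightarrow> y \<in> grade A n \<Longrightarrow> x \<otimes> y \<in> grade A (m + n)"

sublocale graded_ring \<subseteq> graded_group A
  by unfold_locales (rule is_grading_ring)

lemma graded_algebra_graded_ring: "graded_algebra K A \<Longrightarrow> graded_ring A"
  by (simp add: graded_algebra_def graded_ring_def graded_ring_axioms_def)

definition grade0_idempotent :: "('k, 'a) gmodule \<Rightarrow> 'a \<Rightarrow> bool" where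
  "grade0_idempotent A p \<longleftrightarrow> p \<in> grade A 0 \<and> p \<otimes>\<^bsub>A\<^esub> p = p"

context graded_ring
begin

lemma component_r_mult:
  assumes "x \<in> carrier A" "p \<in> grade A 0"
  shows "component A n (x \<otimes> p) = component A n x \<otimes> p"
  by (rule component_hom[OF graded_group_axioms graded_group_axioms])
    (use assms grade_closed grade_mult[OF _ assms(2)] l_distr in auto)

text \<open>\<open>graded_algebra\<close> does not place the unit in degree 0. Its component of
  degree 0 acts as a unit from the right on homogeneous elements, hence on all elements, and
  therefore equals the unit.\<close>

lemma one_grade: "\<one> \<in> grade A 0"
proof -
  let ?c = "component A 0 \<one>"
  have c: "?c \<in> grade A 0" by (rule component_decomp(1)) simp
  have "x \<otimes> ?c = x" if "x \<in> carrier A" for x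
    using that
  proof (induction rule: graded_induct)
    case (homogeneous n y)
    have y: "y \<in> carrier A" using homogeneous grade_closed by auto
    \<comment> \<open>For \<open>z\<close> the unit and \<open>k = 0\<close> the left side is the
      component of degree \<open>n\<close> of \<open>y\<close>, which is \<open>y\<close>.\<close>
    have "component A (n + k) (y \<otimes> z) = y \<otimes> component A k z" if "z \<in> carrier A" for k z
      using that
    proof (induction z rule: graded_induct)
      case (homogeneous m z)
      then show ?case
        using component_grade[OF grade_mult[OF \<open>y \<in> grade A n\<close> homogeneous]] component_grade[OF homogeneous] y
        by simp
    next
      case (add u z)
      then show ?case using y by (simp add: r_distr component_add component_closed)
    qed
    from this[of \<one> 0] show ?case using component_grade[OF homogeneous] y by simp
  next
    case (add y z)
    then show ?case using grade_closed[OF c] by (simp add: l_distr)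
  qed
  from this[of \<one>] show ?thesis using c grade_closed[OF c] by simp
qed

lemma regular_module_simps [simp]:
  "carrier (regular_module A) = carrier A" "\<zero>\<^bsub>regular_module A\<^esub> = \<zero>"
  "x \<oplus>\<^bsub>regular_module A\<^esub> y = x \<oplus> y" "x \<odot>\<^bsub>regular_module A\<^esub> y = x \<otimes> y"
  "grade (regular_module A) = grade A"
  by (simp_all add: regular_module_def)

section \<open>Left ideals generated by idempotents of degree 0\<close>

lemma principal_left_ideal_simps:
  "\<zero>\<^bsub>principal_left_ideal A p\<^esub> = \<zero>" "x \<oplus>\<^bsub>principal_left_ideal A p\<^esub> y = x \<oplus> y"
  "x \<odot>\<^bsub>principal_left_ideal A p\<^esub> y = x \<otimes> y"
  by (simp_all add: principal_left_ideal_def)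

lemma idempotent_closed: "grade0_idempotent A p \<Longrightarrow> p \<in> carrier A"
  by (auto simp: grade0_idempotent_def grade_closed)

text \<open>Idempotency turns membership in \<open>A p\<close> into the equation
  \<open>x \<otimes> p = x\<close>, the form in which later calculations with left ideals use
  it.\<close>

lemma principal_left_ideal_carrier:
  assumes "grade0_idempotent A p"
  shows "carrier (principal_left_ideal A p) = {x \<in> carrier A. x \<otimes> p = x}"
    "grade (principal_left_ideal A p) n = {x \<in> grade A n. x \<otimes> p = x}"
proof -
  have p: "p \<in> carrier A" "p \<otimes> p = p"
    using assms by (auto simp: grade0_idempotent_def grade_closed)
  have "{x \<otimes> p | x. x \<in> carrier A} = {x \<in> carrier A. x \<otimes> p = x}"
    using p by (auto simp: m_assoc) metis
  then show "carrier (principal_left_ideal A p) = {x \<in> carrier A. x \<otimes> p = x}"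
    "grade (principal_left_ideal A p) n = {x \<in> grade A n. x \<otimes> p = x}"
    using grade_closed by (auto simp: principal_left_ideal_def)
qed

lemmas left_ideal_simps = principal_left_ideal_simps principal_left_ideal_carrier

lemma principal_left_ideal_graded:
  assumes p: "grade0_idempotent A p"
  shows "graded_module A (principal_left_ideal A p)"
proof -
  note s = left_ideal_simps(1-3) left_ideal_simps(4,5)[OF p]
  have pc: "p \<in> carrier A" "p \<in> grade A 0" "p \<otimes> p = p"
    using p by (auto simp: grade0_idempotent_def grade_closed)
  have neg: "(\<ominus> x) \<otimes> p = \<ominus> x" if "x \<in> carrier A" "x \<otimes> p = x" for x
    using that pc by (simp add: l_minus)
  have ag: "abelian_group (principal_left_ideal A p)"
  proof (rule abelian_groupI)
    fix x assume "x \<in> carrier (principal_left_ideal A p)"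
    then have "\<ominus> x \<in> carrier (principal_left_ideal A p)"
      "\<ominus> x \<oplus>\<^bsub>principal_left_ideal A p\<^esub> x = \<zero>\<^bsub>principal_left_ideal A p\<^esub>"
      by (auto simp: s neg l_neg)
    then show "\<exists>y\<in>carrier (principal_left_ideal A p). y \<oplus>\<^bsub>principal_left_ideal A p\<^esub> x = \<zero>\<^bsub>principal_left_ideal A p\<^esub>"
      by blast
  qed (use pc in \<open>auto simp: s a_ac l_distr\<close>)
  have "left_module_axioms A (principal_left_ideal A p)"
    by unfold_locales (use pc in \<open>auto simp: s l_distr r_distr m_assoc\<close>)
  then have "left_module A (principal_left_ideal A p)"
    using ag ring_axioms by (simp add: left_module_def)
  moreover have "is_grading (principal_left_ideal A p)"
  proof (rule is_gradingI[where pr = "component A", OF ag])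
    show "additive_subgroup (grade (principal_left_ideal A p) k) (principal_left_ideal A p)" for k
    proof (rule abelian_group.additive_subgroupI2[OF ag])
      fix x assume "x \<in> grade (principal_left_ideal A p) k"
      then have "\<ominus> x \<in> grade (principal_left_ideal A p) k"
        "\<ominus> x \<oplus>\<^bsub>principal_left_ideal A p\<^esub> x = \<zero>\<^bsub>principal_left_ideal A p\<^esub>"
        by (auto simp: s neg l_neg grade_neg grade_closed)
      then show "\<exists>y\<in>grade (principal_left_ideal A p) k. y \<oplus>\<^bsub>principal_left_ideal A p\<^esub> x = \<zero>\<^bsub>principal_left_ideal A p\<^esub>"
        by blast
    qed (use pc in \<open>auto simp: s grade_closed grade_zero grade_add l_distr\<close>)
    show "component A n x \<in> grade (principal_left_ideal A p) n"
      if "x \<in> carrier (principal_left_ideal A p)" for n x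
      using that component_r_mult[of x p n] pc by (auto simp: s component_decomp(1))
  qed (auto simp: s component_add component_grade component_decomp(2) component_zero_imp)
  moreover have "\<forall>m n. \<forall>a\<in>grade A m. \<forall>x\<in>grade (principal_left_ideal A p) n.
      a \<odot>\<^bsub>principal_left_ideal A p\<^esub> x \<in> grade (principal_left_ideal A p) (m + n)"
    using grade_mult grade_closed pc by (auto simp: s m_assoc)
  ultimately show ?thesis by (simp add: graded_module_def)
qed

lemma regular_module_graded: "graded_module A (regular_module A)"
proof -
  have ag: "abelian_group (regular_module A)"
  proof (rule abelian_groupI)
    fix x assume "x \<in> carrier (regular_module A)"
    then have "\<ominus> x \<in> carrier (regular_module A)" "\<ominus> x \<oplus>\<^bsub>regular_module A\<^esub> x = \<zero>\<^bsub>regular_module A\<^esub>"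
      by (auto simp: l_neg)
    then show "\<exists>y\<in>carrier (regular_module A). y \<oplus>\<^bsub>regular_module A\<^esub> x = \<zero>\<^bsub>regular_module A\<^esub>" by blast
  qed (auto simp: a_ac)
  have "left_module_axioms A (regular_module A)"
    by unfold_locales (auto simp: l_distr r_distr m_assoc)
  moreover have "is_grading (regular_module A)"
  proof (rule is_gradingI[where pr = "component A", OF ag])
    show "additive_subgroup (grade (regular_module A) k) (regular_module A)" for k
    proof (rule abelian_group.additive_subgroupI2[OF ag])
      fix x assume "x \<in> grade (regular_module A) k"
      then have "\<ominus> x \<in> grade (regular_module A) k" "\<ominus> x \<oplus>\<^bsub>regular_module A\<^esub> x = \<zero>\<^bsub>regular_module A\<^esub>"
        by (auto simp: l_neg grade_neg grade_closed)
      then show "\<exists>y\<in>grade (regular_module A) k. y \<oplus>\<^bsub>regular_module A\<^esub> x = \<zero>\<^bsub>regular_module A\<^esub>" by blast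
    qed (auto simp: grade_closed grade_zero grade_add)
  qed (auto simp: component_decomp(1) component_add component_grade component_decomp(2) component_zero_imp)
  ultimately show ?thesis
    using ag ring_axioms grade_mult by (simp add: graded_module_def left_module_def)
qed

text \<open>Provides the complement that makes \<open>A p\<close> a graded direct summand of
  \<open>A\<close>; \<open>one_grade\<close> puts the complementary idempotent in degree 0.\<close>

lemma idempotent_complement:
  assumes p: "grade0_idempotent A p"
  shows "grade0_idempotent A (\<one> \<ominus> p)"
    "graded_isomorphic A (direct_sum (principal_left_ideal A p) (principal_left_ideal A (\<one> \<ominus> p))) (regular_module A)"
proof -
  have pc: "p \<in> carrier A" "p \<in> grade A 0" "p \<otimes> p = p"
    using p by (auto simp: grade0_idempotent_def grade_closed)
  have qc: "\<one> \<ominus> p \<in> carrier A" using pc by auto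
  have d: "x \<otimes> (\<one> \<ominus> p) = x \<ominus> x \<otimes> p" if "x \<in> carrier A" for x
    using that pc by (simp add: a_minus_def r_distr r_minus)
  have qp: "(\<one> \<ominus> p) \<otimes> p = \<zero>" using pc by (simp add: a_minus_def l_distr l_minus r_neg)
  have pq: "p \<otimes> (\<one> \<ominus> p) = \<zero>" using pc d[of p] by (simp add: a_minus_def r_neg)
  show q: "grade0_idempotent A (\<one> \<ominus> p)"
    using pc grade_minus[OF one_grade] qp d[OF qc] qc
    by (simp add: grade0_idempotent_def a_minus_def)
  note s = left_ideal_simps(1-3) left_ideal_simps(4,5)[OF p] left_ideal_simps(4,5)[OF q]
  have pqs: "x \<otimes> p \<oplus> x \<otimes> (\<one> \<ominus> p) = x" if "x \<in> carrier A" for x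
  proof -
    have "x \<otimes> p \<oplus> (x \<oplus> \<ominus> (x \<otimes> p)) = x \<oplus> (x \<otimes> p \<oplus> \<ominus> (x \<otimes> p))"
      using that pc by (intro a_lcomm) auto
    then show ?thesis using that pc d[OF that] by (simp add: a_minus_def[of A x] r_neg)
  qed
  show "graded_isomorphic A (direct_sum (principal_left_ideal A p) (principal_left_ideal A (\<one> \<ominus> p))) (regular_module A)"
  proof (rule graded_isoI[where h = "\<lambda>x. fst x \<oplus> snd x" and g = "\<lambda>x. (x \<otimes> p, x \<otimes> (\<one> \<ominus> p))"])
    show "(\<lambda>x. fst x \<oplus> snd x) \<in> graded_module_hom A
       (direct_sum (principal_left_ideal A p) (principal_left_ideal A (\<one> \<ominus> p))) (regular_module A)"
      by (rule graded_module_homI) (auto simp: s a_ac r_distr grade_add)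
    show "(\<lambda>x. (x \<otimes> p, x \<otimes> (\<one> \<ominus> p))) \<in> carrier (regular_module A) \<rightarrow>
        carrier (direct_sum (principal_left_ideal A p) (principal_left_ideal A (\<one> \<ominus> p)))"
      using pc qc q by (auto simp: s m_assoc grade0_idempotent_def)
    show "((fst x \<oplus> snd x) \<otimes> p, (fst x \<oplus> snd x) \<otimes> (\<one> \<ominus> p)) = x"
      if "x \<in> carrier (direct_sum (principal_left_ideal A p) (principal_left_ideal A (\<one> \<ominus> p)))" for x
    proof -
      obtain y z where x: "x = (y, z)" by (cases x)
      have y: "y \<in> carrier A" "y \<otimes> p = y" and z: "z \<in> carrier A" "z \<otimes> (\<one> \<ominus> p) = z"
        using that by (auto simp: s x)
      have "z \<otimes> p = \<zero>" using z pc qc qp by (metis m_assoc r_null)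
      moreover have "y \<otimes> (\<one> \<ominus> p) = \<zero>" using y pc qc pq by (metis m_assoc r_null)
      ultimately show ?thesis using y z pc qc by (simp add: x l_distr)
    qed
    show "fst (y \<otimes> p, y \<otimes> (\<one> \<ominus> p)) \<oplus> snd (y \<otimes> p, y \<otimes> (\<one> \<ominus> p)) = y" if "y \<in> carrier (regular_module A)" for y
      using that pqs by simp
  qed
qed

text \<open>The complement consists of the ideals of the complementary idempotents with the same
  shifts. Indices of type \<open>nat\<close> give it the element type that
  \<open>graded_fg_projective\<close> demands.\<close>

lemma sum_of_ideals_fg_projective:
  fixes n :: nat
  assumes p: "\<And>j. j < n \<Longrightarrow> grade0_idempotent A (p j)"
  shows "graded_fg_projective A (graded_sum {..<n} (\<lambda>j. shift (d j) (principal_left_ideal A (p j))))"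
proof -
  let ?P = "\<lambda>j. shift (d j) (principal_left_ideal A (p j))"
  let ?Q = "\<lambda>j. shift (d j) (principal_left_ideal A (\<one> \<ominus> p j))"
  have P: "graded_module A (graded_sum {..<n} ?P)"
    by (rule graded_sum_graded_module[OF ring_axioms finite_lessThan])
      (auto intro!: shift_graded principal_left_ideal_graded p)
  have Q: "graded_module A (graded_sum {..<n} ?Q)"
    by (rule graded_sum_graded_module[OF ring_axioms finite_lessThan])
      (auto intro!: shift_graded principal_left_ideal_graded idempotent_complement p)
  have "graded_isomorphic A (graded_sum {..<n} (\<lambda>j. direct_sum (?P j) (?Q j)))
      (graded_sum {..<n} (\<lambda>j. shift (d j) (regular_module A)))"
    by (rule graded_sum_iso)
      (auto simp flip: shift_direct_sum intro!: shift_iso idempotent_complement(2) p)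
  also have "graded_sum {..<n} (\<lambda>j. shift (d j) (regular_module A)) = graded_free_module A n d"
    by (simp add: graded_sum_def graded_free_module_def shift_def regular_module_def)
  finally have "graded_isomorphic A (direct_sum (graded_sum {..<n} ?P) (graded_sum {..<n} ?Q))
      (graded_free_module A n d)"
    by (rule graded_iso_trans[OF graded_sum_pairs])
  then show ?thesis using P Q unfolding graded_fg_projective_def by blast
qed

end

section \<open>The monoid of graded finitely generated projective modules\<close>

lemma fg_projective_graded: "graded_fg_projective A P \<Longrightarrow> graded_module A P"
  by (simp add: graded_fg_projective_def)

lemma Vgr_class_self: "graded_fg_projective A M \<Longrightarrow> M \<in> Vgr_class A M"
  by (simp add: Vgr_class_def graded_iso_refl)

text \<open>Reversing an isomorphism requires both sides to be graded modules. Assuming both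
  directions makes the lemma applicable to \<open>extension_of_scalars\<close>, for which only the
  two isomorphisms are constructed.\<close>

lemma Vgr_class_eqI:
  assumes "graded_isomorphic A P Q" "graded_isomorphic A Q P"
  shows "Vgr_class A P = Vgr_class A Q"
  using assms by (auto simp: Vgr_class_def intro: graded_iso_trans)

lemma Vgr_class_eq:
  assumes "graded_module A P" "graded_module A Q" "graded_isomorphic A P Q"
  shows "Vgr_class A P = Vgr_class A Q"
  using Vgr_class_eqI assms graded_iso_sym by metis

text \<open>A common member is required: if both classes were empty, their equality would carry no
  information.\<close>

lemma Vgr_class_eqD:
  assumes "M \<in> Vgr_class A P" "M \<in> Vgr_class A Q" "graded_module A P"
  shows "graded_isomorphic A P Q"
proof -
  have "graded_isomorphic A M P" "graded_isomorphic A M Q" "graded_module A M"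
    using assms by (auto simp: Vgr_class_def fg_projective_graded)
  then show ?thesis using graded_iso_sym graded_iso_trans assms(3) by metis
qed

text \<open>A product in \<open>Vgr\<close> is a union over representatives. They all give the same
  class, and the members \<open>M\<close> and \<open>N\<close> keep the union from being
  empty.\<close>

lemma Vgr_mult:
  assumes "M \<in> Vgr_class A P" "N \<in> Vgr_class A Q" "graded_module A P" "graded_module A Q"
  shows "Vgr_class A P \<otimes>\<^bsub>Vgr A\<^esub> Vgr_class A Q = Vgr_class A (direct_sum P Q)"
proof -
  have "Vgr_class A (direct_sum M' N') = Vgr_class A (direct_sum P Q)"
    if "M' \<in> Vgr_class A P" "N' \<in> Vgr_class A Q" for M' N'
    using that assms(3,4)
    by (intro Vgr_class_eq direct_sum_graded_module direct_sum_iso) (auto simp: Vgr_class_def fg_projective_graded)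
  then show ?thesis using assms(1,2) by (auto simp: Vgr_def)
qed

lemma Vgr_zact:
  assumes "M \<in> Vgr_class A P" "graded_module A P"
  shows "zact (Vgr A) n (Vgr_class A P) = Vgr_class A (shift n P)"
proof -
  have "Vgr_class A (shift n M') = Vgr_class A (shift n P)" if "M' \<in> Vgr_class A P" for M'
    using that assms(2)
    by (intro Vgr_class_eq shift_graded shift_iso) (auto simp: Vgr_class_def fg_projective_graded)
  then show ?thesis using assms(1) by (auto simp: Vgr_def)
qed

text \<open>The unit of \<open>Vgr\<close> is the set of all zero modules, so the members isomorphic
  to a zero module \<open>P\<close> of any element type must be shown to be exactly these.\<close>

lemma Vgr_one:
  fixes A :: "('k, 'a) gmodule"
  assumes P: "graded_module A P" "carrier P = {\<zero>\<^bsub>P\<^esub>}"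
  shows "Vgr_class A P = \<one>\<^bsub>Vgr A\<^esub>"
proof -
  have "graded_isomorphic A M P \<longleftrightarrow> carrier M = {\<zero>\<^bsub>M\<^esub>}" if M: "graded_fg_projective A M" for M :: "('a, nat \<Rightarrow> 'a) gmodule"
  proof -
    interpret M: graded_group M using graded_moduleD M by (metis fg_projective_graded)
    interpret L: left_module A M using graded_moduleD M by (metis fg_projective_graded)
    interpret P: graded_group P using graded_moduleD P(1) by metis
    interpret LP: left_module A P using graded_moduleD P(1) by metis
    show ?thesis
    proof
      assume "graded_isomorphic A M P"
      then obtain h where h: "bij_betw h (carrier M) {\<zero>\<^bsub>P\<^esub>}"
        using P(2) by (auto simp: graded_isomorphic_def)
      have "x = \<zero>\<^bsub>M\<^esub>" if x: "x \<in> carrier M" for x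
      proof (rule inj_onD[OF bij_betw_imp_inj_on[OF h] _ x M.zero_closed])
        show "h x = h \<zero>\<^bsub>M\<^esub>" using bij_betwE[OF h] x M.zero_closed by (metis singletonD)
      qed
      then show "carrier M = {\<zero>\<^bsub>M\<^esub>}" using M.zero_closed by blast
    next
      assume c: "carrier M = {\<zero>\<^bsub>M\<^esub>}"
      have "a \<odot>\<^bsub>P\<^esub> \<zero>\<^bsub>P\<^esub> = \<zero>\<^bsub>P\<^esub>" if "a \<in> carrier A" for a
        using LP.smult_closed[OF that, of "\<zero>\<^bsub>P\<^esub>"] P(2) by simp
      then have "(\<lambda>_. \<zero>\<^bsub>P\<^esub>) \<in> graded_module_hom A M P"
        by (intro graded_module_homI) (simp_all add: P.grade_zero)
      then show "graded_isomorphic A M P"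
        using c P(2) by (intro graded_isoI[of "\<lambda>_. \<zero>\<^bsub>P\<^esub>" _ _ _ "\<lambda>_. \<zero>\<^bsub>M\<^esub>"]) simp_all
    qed
  qed
  then show ?thesis by (auto simp: Vgr_class_def Vgr_def)
qed

section \<open>The talented monoid\<close>

lemma talented_class_eq: "talented_cong E a b \<Longrightarrow> talented_class E a = talented_class E b"
  unfolding talented_class_def by (blast intro: talented_cong.sym talented_cong.trans)

lemma talented_class_self: "set_mset a \<subseteq> verts E \<times> UNIV \<Longrightarrow> a \<in> talented_class E a"
  by (simp add: talented_class_def talented_cong.refl)

lemma talented_class_carrier:
  "set_mset a \<subseteq> verts E \<times> UNIV \<Longrightarrow> talented_class E a \<in> carrier (talented_monoid E)"
  by (auto simp: talented_monoid_def)

lemma talented_carrierE: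
  assumes "t \<in> carrier (talented_monoid E)"
  obtains a where "set_mset a \<subseteq> verts E \<times> UNIV" "t = talented_class E a"
  using assms by (auto simp: talented_monoid_def)

lemma UN2_const:
  assumes "a \<in> U" "b \<in> V" "\<And>a' b'. a' \<in> U \<Longrightarrow> b' \<in> V \<Longrightarrow> F a' b' = C"
  shows "(\<Union>a'\<in>U. \<Union>b'\<in>V. F a' b') = C"
  using assms by blast

lemma talented_mult:
  assumes "set_mset a \<subseteq> verts E \<times> UNIV" "set_mset b \<subseteq> verts E \<times> UNIV"
  shows "talented_class E a \<otimes>\<^bsub>talented_monoid E\<^esub> talented_class E b = talented_class E (a + b)"
proof -
  have "talented_class E (a' + b') = talented_class E (a + b)"
    if "a' \<in> talented_class E a" "b' \<in> talented_class E b" for a' b'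
    using talented_class_eq[of E "a + b" "a' + b'"] talented_cong.add[of E a a' b b'] that
    by (simp add: talented_class_def)
  then have "(\<Union>a'\<in>talented_class E a. \<Union>b'\<in>talented_class E b. talented_class E (a' + b')) =
      talented_class E (a + b)"
    by (rule UN2_const[OF talented_class_self[OF assms(1)] talented_class_self[OF assms(2)]])
  then show ?thesis by (simp add: talented_monoid_def)
qed

lemma talented_cong_shift:
  "talented_cong E a b \<Longrightarrow> talented_cong E {#(v, i + n). (v, i) \<in># a#} {#(v, i + n). (v, i) \<in># b#}"
proof (induction rule: talented_cong.induct)
  case (relation v i)
  then show ?case
    using talented_cong.relation[of v E "i + n"] by (simp add: image_mset.compositionality o_def ac_simps)
next
  case (refl a)
  then show ?case by (intro talented_cong.refl) auto
qed (auto intro: talented_cong.intros)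

lemma talented_zact:
  assumes "set_mset a \<subseteq> verts E \<times> UNIV"
  shows "zact (talented_monoid E) n (talented_class E a) = talented_class E {#(v, i + n). (v, i) \<in># a#}"
proof -
  have "talented_class E {#(v, i + n). (v, i) \<in># a'#} = talented_class E {#(v, i + n). (v, i) \<in># a#}"
    if "a' \<in> talented_class E a" for a'
    using talented_class_eq[OF talented_cong_shift[of E a a' n]] that by (simp add: talented_class_def)
  then have "(\<Union>a'\<in>talented_class E a. talented_class E {#(v, i + n). (v, i) \<in># a'#}) =
      talented_class E {#(v, i + n). (v, i) \<in># a#}"
    using talented_class_self[OF assms] by blast
  then show ?thesis by (simp add: talented_monoid_def)
qed

lemma mset_index: "image_mset ((!) l) (mset_set {..<length l}) = mset l"
  by (metis atLeast0LessThan map_nth mset_map mset_upt)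

text \<open>Remove an index \<open>i\<close> and some \<open>j\<close> with the same label, and
  induct. This is why a direct sum depends, up to isomorphism, only on the multiset of its
  labels.\<close>

lemma image_mset_bijection:
  assumes "finite I" "finite J" "image_mset f (mset_set I) = image_mset g (mset_set J)"
  shows "\<exists>b. bij_betw b I J \<and> (\<forall>i\<in>I. f i = g (b i))"
  using assms
proof (induction I arbitrary: J rule: finite_induct)
  case empty
  then show ?case by (auto simp: mset_set_empty_iff bij_betw_def)
next
  case (insert i I)
  then have "f i \<in># image_mset g (mset_set J)" by (metis image_mset_add_mset mset_set.insert union_single_eq_member)
  then obtain j where j: "j \<in> J" "g j = f i" using insert by auto
  then have "mset_set J = add_mset j (mset_set (J - {j}))" using insert by (simp add: mset_set.remove)
  then have "image_mset f (mset_set I) = image_mset g (mset_set (J - {j}))" using insert j by simp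
  then obtain b where b: "bij_betw b I (J - {j})" "\<forall>i\<in>I. f i = g (b i)" using insert by (meson finite_Diff)
  have "bij_betw (b(i := j)) I (J - {j}) = bij_betw b I (J - {j})"
    by (rule bij_betw_cong) (use insert(2) in auto)
  then have "bij_betw (b(i := j)) I (J - {j})" using b(1) by simp
  then have "bij_betw (b(i := j)) (insert i I) J"
    using notIn_Un_bij_betw[of i I "b(i := j)" "J - {j}"] insert(2) j by (simp add: insert_absorb)
  moreover have "\<forall>k\<in>insert i I. f k = g ((b(i := j)) k)" using b(2) j insert(2) by auto
  ultimately show ?case by blast
qed

lemma Vgr_carrier_nonempty: "U \<in> carrier (Vgr A) \<Longrightarrow> \<exists>M. M \<in> U"
  using Vgr_class_self by (fastforce simp: Vgr_def)

lemma Vgr_classI: "graded_fg_projective A P \<Longrightarrow> Vgr_class A P \<in> carrier (Vgr A)" for P :: "('a, nat \<Rightarrow> 'a) gmodule"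
  by (auto simp: Vgr_def)

text \<open>The generator of degree \<open>i\<close> at a vertex is the shift by \<open>i\<close> of
  the one of degree 0, so \<open>h\<close> is determined by its values at the vertices. The element
  type of \<open>M\<close> is left free: modules chosen in classes and left ideals both
  occur.\<close>

lemma zmonoid_hom_talented_sum:
  fixes M :: "'v \<Rightarrow> ('a, 'm) gmodule"
  assumes h: "h \<in> zmonoid_hom (talented_monoid E) (Vgr A)" and A: "ring A"
    and gen: "\<And>v. v \<in> verts E \<Longrightarrow> h (talented_gen E v 0) = Vgr_class A (M v)"
    and M: "\<And>v. v \<in> verts E \<Longrightarrow> graded_module A (M v)"
    and "finite I" "\<And>j. j \<in> I \<Longrightarrow> g j \<in> verts E"
  shows "h (talented_class E {#(g j, d j). j \<in># mset_set I#}) = Vgr_class A (graded_sum I (\<lambda>j. shift (d j) (M (g j))))"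
  using assms(5,6)
proof (induction I rule: finite_induct)
  case empty
  have "graded_module A (graded_sum {} (\<lambda>j. shift (d j) (M (g j))))"
    by (rule graded_sum_graded_module[OF A]) auto
  from Vgr_one[OF this]
  have "Vgr_class A (graded_sum {} (\<lambda>j. shift (d j) (M (g j)))) = \<one>\<^bsub>Vgr A\<^esub>" by (simp add: restrict_def)
  moreover have "talented_class E {#} = \<one>\<^bsub>talented_monoid E\<^esub>" by (simp add: talented_monoid_def)
  moreover have "h \<one>\<^bsub>talented_monoid E\<^esub> = \<one>\<^bsub>Vgr A\<^esub>" using h by (simp add: zmonoid_hom_def)
  ultimately show ?case by simp
next
  case (insert i I)
  let ?S = "\<lambda>I. graded_sum I (\<lambda>j. shift (d j) (M (g j)))"
  let ?c = "talented_class E {#(g i, d i)#}" and ?r = "talented_class E {#(g j, d j). j \<in># mset_set I#}"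
  have gi: "g i \<in> verts E" and gI: "\<And>j. j \<in> I \<Longrightarrow> g j \<in> verts E" using insert by auto
  have s1: "set_mset {#(g i, d i)#} \<subseteq> verts E \<times> UNIV" and s2: "set_mset {#(g j, d j). j \<in># mset_set I#} \<subseteq> verts E \<times> UNIV"
    and s0: "set_mset {#(g i, 0)#} \<subseteq> verts E \<times> UNIV"
    using insert by auto
  have hc: "h t \<in> carrier (Vgr A)" if "t \<in> carrier (talented_monoid E)" for t
    using h that by (auto simp: zmonoid_hom_def hom_def)
  have "?c = zact (talented_monoid E) (d i) (talented_gen E (g i) 0)"
    using talented_zact[OF s0] by (simp add: talented_gen_def)
  then have "h ?c = zact (Vgr A) (d i) (Vgr_class A (M (g i)))"
    using h gen[OF gi] talented_class_carrier[OF s0] by (simp add: zmonoid_hom_def talented_gen_def)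
  \<comment> \<open>The class is a value of \<open>h\<close>, so it belongs to the carrier of
    \<open>Vgr\<close> and is not empty.\<close>
  moreover obtain N where "N \<in> Vgr_class A (M (g i))"
    using hc[OF talented_class_carrier[OF s0]] gen[OF gi] Vgr_carrier_nonempty by (metis talented_gen_def)
  ultimately have hc1: "h ?c = Vgr_class A (shift (d i) (M (g i)))"
    using Vgr_zact M[OF gi] by metis
  have hr: "h ?r = Vgr_class A (?S I)" using insert gI by blast
  have P: "graded_module A (shift (d i) (M (g i)))" using M[OF gi] by (rule shift_graded)
  have Q: "graded_module A (?S J)" if "finite J" "J \<subseteq> insert i I" for J
    by (rule graded_sum_graded_module[OF A]) (use that insert M in \<open>auto intro!: shift_graded\<close>)
  have "h (?c \<otimes>\<^bsub>talented_monoid E\<^esub> ?r) = h ?c \<otimes>\<^bsub>Vgr A\<^esub> h ?r"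
    using h talented_class_carrier[OF s1] talented_class_carrier[OF s2] by (simp add: zmonoid_hom_def hom_mult)
  also have "... = Vgr_class A (direct_sum (shift (d i) (M (g i))) (?S I))"
  proof -
    obtain N1 where N1: "N1 \<in> Vgr_class A (shift (d i) (M (g i)))"
      using Vgr_carrier_nonempty[OF hc[OF talented_class_carrier[OF s1]]] unfolding hc1 by (rule exE)
    obtain N2 where N2: "N2 \<in> Vgr_class A (?S I)"
      using Vgr_carrier_nonempty[OF hc[OF talented_class_carrier[OF s2]]] unfolding hr by (rule exE)
    show ?thesis unfolding hc1 hr by (rule Vgr_mult[OF N1 N2 P Q]) (use insert(1) in auto)
  qed
  also have "... = Vgr_class A (?S (insert i I))"
    using Vgr_class_eq[OF Q[of "insert i I"] direct_sum_graded_module[OF P Q[of I]] graded_sum_insert]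
      insert by auto
  also have "?c \<otimes>\<^bsub>talented_monoid E\<^esub> ?r = talented_class E {#(g j, d j). j \<in># mset_set (insert i I)#}"
    using talented_mult[OF s1 s2] insert by simp
  finally show ?case .
qed

section \<open>Leavitt families\<close>

text \<open>Usually called a Leavitt \<open>E\<close>-family, here with the degrees of the
  generators imposed. It is instantiated twice: by elements of \<open>A\<close> obtained from
  \<phi>, and by the generators of the Leavitt path algebra.\<close>

locale leavitt_family = graded_ring A + fin_digraph E
  for A :: "('k, 'a) gmodule" (structure) and E :: "('v, 'e) pre_digraph" +
  fixes p :: "'v \<Rightarrow> 'a" and x y :: "'e \<Rightarrow> 'a"
  assumes p_idem: "v \<in> verts E \<Longrightarrow> grade0_idempotent A (p v)"
    and p_orth: "u \<in> verts E \<Longrightarrow> v \<in> verts E \<Longrightarrow> u \<noteq> v \<Longrightarrow> p u \<otimes> p v = \<zero>"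
    and p_one: "(\<Oplus>v\<in>verts E. p v) = \<one>"
    and x_grade: "e \<in> arcs E \<Longrightarrow> x e \<in> grade A 1"
    and y_grade: "e \<in> arcs E \<Longrightarrow> y e \<in> grade A (- 1)"
    and p_x: "e \<in> arcs E \<Longrightarrow> p (tail E e) \<otimes> x e = x e"
    and x_p: "e \<in> arcs E \<Longrightarrow> x e \<otimes> p (head E e) = x e"
    and p_y: "e \<in> arcs E \<Longrightarrow> p (head E e) \<otimes> y e = y e"
    and y_p: "e \<in> arcs E \<Longrightarrow> y e \<otimes> p (tail E e) = y e"
    and y_x: "e \<in> arcs E \<Longrightarrow> f \<in> arcs E \<Longrightarrow> y e \<otimes> x f = (if e = f then p (head E e) else \<zero>)"
    and x_y: "v \<in> verts E \<Longrightarrow> out_arcs E v \<noteq> {} \<Longrightarrow> (\<Oplus>e\<in>out_arcs E v. x e \<otimes> y e) = p v"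
begin

lemma finite_out_arcs: "finite (out_arcs E v)"
  by (rule finite_subset[OF _ finite_arcs]) auto

lemma p_closed: "v \<in> verts E \<Longrightarrow> p v \<in> carrier A"
  using p_idem idempotent_closed by blast

lemma x_closed: "e \<in> arcs E \<Longrightarrow> x e \<in> carrier A" and y_closed: "e \<in> arcs E \<Longrightarrow> y e \<in> carrier A"
  using x_grade y_grade grade_closed by blast+

abbreviation "Ap v \<equiv> principal_left_ideal A (p v)"

lemmas Ap_simps = left_ideal_simps(1-3) left_ideal_simps(4,5)[OF p_idem]

lemma Ap_graded: "v \<in> verts E \<Longrightarrow> graded_module A (Ap v)"
  by (simp add: p_idem principal_left_ideal_graded)

text \<open>The maps are right multiplication by the row of all \<open>x e\<close> and by the column
  of all \<open>y e\<close>. They are mutually inverse by \<open>x_y\<close> in one order and by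
  \<open>y_x\<close> in the other; the shift by 1 absorbs the degree of \<open>x e\<close>.\<close>

lemma Ap_decomposition:
  assumes v: "v \<in> verts E" "out_arcs E v \<noteq> {}"
  shows "graded_isomorphic A (Ap v) (graded_sum (out_arcs E v) (\<lambda>e. shift 1 (Ap (head E e))))"
proof (rule graded_isoI[where h = "\<lambda>a. \<lambda>e\<in>out_arcs E v. a \<otimes> x e" and g = "\<lambda>f. \<Oplus>e\<in>out_arcs E v. f e \<otimes> y e"])
  have o: "e \<in> arcs E" "tail E e = v" "head E e \<in> verts E" if "e \<in> out_arcs E v" for e
    using that by auto
  note [simp del] = in_out_arcs_conv
  have yp: "y e \<otimes> p v = y e" if "e \<in> out_arcs E v" for e using y_p[OF o(1)[OF that]] o(2)[OF that] by simp
  have fin: "finite (out_arcs E v)" by (rule finite_out_arcs)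
  note s = Ap_simps(1-3) Ap_simps(4,5)[OF v(1)] Ap_simps(4,5)[OF o(3)]
  show "(\<lambda>a. \<lambda>e\<in>out_arcs E v. a \<otimes> x e) \<in> graded_module_hom A (Ap v)
      (graded_sum (out_arcs E v) (\<lambda>e. shift 1 (Ap (head E e))))"
  proof (rule graded_module_homI)
    fix n a assume "a \<in> grade (Ap v) n"
    then have "a \<otimes> x e \<in> grade (Ap (head E e)) (1 + n)" if "e \<in> out_arcs E v" for e
      using grade_mult[of a n "x e" 1] x_grade[OF o(1)[OF that]] that o[OF that] x_p p_closed x_closed grade_closed[of a n]
      by (simp add: s add.commute m_assoc)
    then show "(\<lambda>e\<in>out_arcs E v. a \<otimes> x e) \<in> grade (graded_sum (out_arcs E v) (\<lambda>e. shift 1 (Ap (head E e)))) n"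
      by auto
  qed (use o x_p x_closed p_closed in \<open>auto simp: s l_distr m_assoc intro!: restrict_ext\<close>)
  have f: "f e \<in> carrier A" "f e \<otimes> p (head E e) = f e"
    if "f \<in> carrier (graded_sum (out_arcs E v) (\<lambda>e. shift 1 (Ap (head E e))))" "e \<in> out_arcs E v" for f e
  proof -
    have "f e \<in> carrier (Ap (head E e))" using that by auto
    then show "f e \<in> carrier A" "f e \<otimes> p (head E e) = f e" unfolding Ap_simps(4)[OF o(3)[OF that(2)]] by auto
  qed
  show "(\<lambda>f. \<Oplus>e\<in>out_arcs E v. f e \<otimes> y e) \<in> carrier (graded_sum (out_arcs E v) (\<lambda>e. shift 1 (Ap (head E e)))) \<rightarrow> carrier (Ap v)"
  proof
    fix f assume F: "f \<in> carrier (graded_sum (out_arcs E v) (\<lambda>e. shift 1 (Ap (head E e))))"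
    have c: "(\<lambda>e. f e \<otimes> y e) \<in> out_arcs E v \<rightarrow> carrier A" using f[OF F] y_closed o by auto
    have "(\<Oplus>e\<in>out_arcs E v. f e \<otimes> y e) \<otimes> p v = (\<Oplus>e\<in>out_arcs E v. f e \<otimes> y e \<otimes> p v)"
      by (rule finsum_ldistr) (use c fin v p_closed in auto)
    also have "... = (\<Oplus>e\<in>out_arcs E v. f e \<otimes> y e)"
      by (rule finsum_cong') (use c f[OF F] y_closed o yp p_closed v in \<open>auto simp: m_assoc\<close>)
    finally show "(\<Oplus>e\<in>out_arcs E v. f e \<otimes> y e) \<in> carrier (Ap v)"
      using finsum_closed[OF c] by (simp add: s)
  qed
  show "(\<Oplus>e\<in>out_arcs E v. (\<lambda>e\<in>out_arcs E v. a \<otimes> x e) e \<otimes> y e) = a" if "a \<in> carrier (Ap v)" for a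
  proof -
    have a: "a \<in> carrier A" "a \<otimes> p v = a" using that by (auto simp: s)
    have "(\<Oplus>e\<in>out_arcs E v. (\<lambda>e\<in>out_arcs E v. a \<otimes> x e) e \<otimes> y e) = (\<Oplus>e\<in>out_arcs E v. a \<otimes> (x e \<otimes> y e))"
      by (rule finsum_cong') (use a x_closed y_closed o in \<open>auto simp: m_assoc\<close>)
    also have "... = a \<otimes> (\<Oplus>e\<in>out_arcs E v. x e \<otimes> y e)"
      by (rule finsum_rdistr[symmetric]) (use a x_closed y_closed o fin in auto)
    finally show ?thesis using a x_y[OF v] by simp
  qed
  show "(\<lambda>e'\<in>out_arcs E v. (\<Oplus>e\<in>out_arcs E v. f e \<otimes> y e) \<otimes> x e') = f"
    if F: "f \<in> carrier (graded_sum (out_arcs E v) (\<lambda>e. shift 1 (Ap (head E e))))" for f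
  proof
    fix e' show "(\<lambda>e'\<in>out_arcs E v. (\<Oplus>e\<in>out_arcs E v. f e \<otimes> y e) \<otimes> x e') e' = f e'"
    proof (cases "e' \<in> out_arcs E v")
      case True
      have "(\<Oplus>e\<in>out_arcs E v. f e \<otimes> y e) \<otimes> x e' = (\<Oplus>e\<in>out_arcs E v. f e \<otimes> y e \<otimes> x e')"
        by (rule finsum_ldistr) (use f[OF F] y_closed x_closed o True fin in auto)
      also have "... = (\<Oplus>e\<in>out_arcs E v. if e' = e then f e else \<zero>)"
        by (rule finsum_cong') (use f[OF F] y_closed x_closed o True y_x in \<open>auto simp: m_assoc\<close>)
      also have "... = f e'"
        using add.finprod_singleton[OF True fin, of f] f[OF F] by auto
      finally show ?thesis using True by simp
    qed (use F in \<open>auto simp: PiE_def extensional_def\<close>)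
  qed
qed

section \<open>Direct sums of shifted left ideals indexed by multisets\<close>

definition ideal_sum :: "'i set \<Rightarrow> ('i \<Rightarrow> 'v \<times> int) \<Rightarrow> ('a, 'i \<Rightarrow> 'a) gmodule" where
  "ideal_sum I f = graded_sum I (\<lambda>j. shift (snd (f j)) (Ap (fst (f j))))"

lemma ideal_sum_graded:
  assumes "finite I" "f ` I \<subseteq> verts E \<times> UNIV"
  shows "graded_module A (ideal_sum I f)"
  unfolding ideal_sum_def
  by (rule graded_sum_graded_module[OF ring_axioms assms(1)]) (use assms in \<open>force intro!: shift_graded Ap_graded\<close>)

lemma ideal_sum_iso:
  assumes "finite I" "finite J" "image_mset f (mset_set I) = image_mset g (mset_set J)"
  shows "graded_isomorphic A (ideal_sum J g) (ideal_sum I f)"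
proof -
  obtain b where b: "bij_betw b I J" "\<forall>i\<in>I. f i = g (b i)" using image_mset_bijection[OF assms] by blast
  have e: "ideal_sum I f = graded_sum I (\<lambda>i. shift (snd (g (b i))) (Ap (fst (g (b i)))))"
    unfolding ideal_sum_def by (rule graded_sum_cong) (use b in auto)
  show ?thesis
    unfolding e ideal_sum_def[of J]
    by (rule graded_sum_reindex[OF b(1), where P = "\<lambda>j. shift (snd (g j)) (Ap (fst (g j)))"])
qed

text \<open>The positions of an arbitrarily chosen list serve as indices, so that elements have the
  type \<open>nat \<Rightarrow> 'a\<close> required in \<open>Vgr\<close>. By
  \<open>mset_sum_iso\<close> the choice is irrelevant up to isomorphism.\<close>

definition mset_sum :: "('v \<times> int) multiset \<Rightarrow> ('a, nat \<Rightarrow> 'a) gmodule" where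
  "mset_sum a = (let l = (SOME l. mset l = a) in ideal_sum {..<length l} ((!) l))"

lemma mset_sum_list:
  obtains l where "mset l = a" "mset_sum a = ideal_sum {..<length l} ((!) l)"
proof
  show "mset (SOME l. mset l = a) = a" by (rule someI_ex) (rule ex_mset)
qed (simp add: mset_sum_def Let_def)

lemma mset_sum_fg_projective:
  assumes "set_mset a \<subseteq> verts E \<times> UNIV"
  shows "graded_fg_projective A (mset_sum a)"
proof -
  obtain l where l: "mset l = a" "mset_sum a = ideal_sum {..<length l} ((!) l)" by (rule mset_sum_list)
  have "fst (l ! j) \<in> verts E" if "j < length l" for j
  proof -
    have "l ! j \<in> set_mset a" using nth_mem_mset[OF that] l(1) by simp
    then show ?thesis using assms by auto
  qed
  then show ?thesis
    unfolding l ideal_sum_def by (intro sum_of_ideals_fg_projective p_idem)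
qed

lemmas mset_sum_graded = fg_projective_graded[OF mset_sum_fg_projective]

lemma mset_sum_iso:
  assumes "finite I" "image_mset f (mset_set I) = a" "set_mset a \<subseteq> verts E \<times> UNIV"
  shows "graded_isomorphic A (mset_sum a) (ideal_sum I f)" "graded_isomorphic A (ideal_sum I f) (mset_sum a)"
proof -
  obtain l where l: "mset l = a" "mset_sum a = ideal_sum {..<length l} ((!) l)" by (rule mset_sum_list)
  have "image_mset f (mset_set I) = image_mset ((!) l) (mset_set {..<length l})"
    using assms l by (simp add: mset_index)
  then show "graded_isomorphic A (mset_sum a) (ideal_sum I f)" "graded_isomorphic A (ideal_sum I f) (mset_sum a)"
    using ideal_sum_iso[of I "{..<length l}" f "(!) l"] ideal_sum_iso[of "{..<length l}" I "(!) l" f] assms(1) l by auto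
qed

lemma mset_sum_add:
  assumes "set_mset a \<subseteq> verts E \<times> UNIV" "set_mset b \<subseteq> verts E \<times> UNIV"
  shows "graded_isomorphic A (mset_sum (a + b)) (direct_sum (mset_sum a) (mset_sum b))"
proof -
  obtain l where l: "mset l = a" using ex_mset by blast
  obtain m where m: "mset m = b" using ex_mset by blast
  \<comment> \<open>The positions of the two lists are made disjoint so that
    \<open>graded_sum_union\<close> applies.\<close>
  let ?I = "Inl ` {..<length l} :: (nat + nat) set" and ?J = "Inr ` {..<length m} :: (nat + nat) set"
  let ?f = "case_sum ((!) l) ((!) m)"
  have I: "image_mset ?f (mset_set ?I) = a"
    using l mset_index[of l] by (simp add: image_mset_mset_set[symmetric] image_mset.compositionality o_def)
  have J: "image_mset ?f (mset_set ?J) = b"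
    using m mset_index[of m] by (simp add: image_mset_mset_set[symmetric] image_mset.compositionality o_def)
  have "mset_set (?I \<union> ?J) = mset_set ?I + mset_set ?J"
    by (rule mset_set_Union) auto
  then have IJ: "image_mset ?f (mset_set (?I \<union> ?J)) = a + b" using I J by simp
  have "graded_isomorphic A (mset_sum (a + b)) (ideal_sum (?I \<union> ?J) ?f)"
    by (rule mset_sum_iso(1)) (use IJ assms in auto)
  also have "graded_isomorphic A (ideal_sum (?I \<union> ?J) ?f) (direct_sum (ideal_sum ?I ?f) (ideal_sum ?J ?f))"
    unfolding ideal_sum_def by (rule graded_sum_union) auto
  also have "graded_isomorphic A (direct_sum (ideal_sum ?I ?f) (ideal_sum ?J ?f)) (direct_sum (mset_sum a) (mset_sum b))"
    using mset_sum_iso(2)[of ?I ?f a] mset_sum_iso(2)[of ?J ?f b] I J assms by (intro direct_sum_iso) auto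
  finally show ?thesis .
qed

lemma mset_sum_singleton:
  assumes "v \<in> verts E"
  shows "graded_isomorphic A (mset_sum {#(v, i)#}) (shift i (Ap v))"
proof -
  have "graded_isomorphic A (mset_sum {#(v, i)#}) (ideal_sum {()} (\<lambda>_. (v, i)))"
    by (rule mset_sum_iso(1)) (use assms in auto)
  then show ?thesis
    using graded_sum_singleton[of A "()" "\<lambda>_. shift i (Ap v)"] graded_iso_trans by (fastforce simp: ideal_sum_def)
qed

text \<open>Induction on the congruence, whose defining relation is \<open>Ap_decomposition\<close>.
  That both multisets consist of vertices is carried along because \<open>mset_sum_graded\<close>,
  and with it the symmetry of isomorphism, depends on it.\<close>

lemma mset_sum_cong:
  "talented_cong E a b \<Longrightarrow> set_mset a \<subseteq> verts E \<times> UNIV \<and> set_mset b \<subseteq> verts E \<times> UNIV \<and>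
     graded_isomorphic A (mset_sum a) (mset_sum b)"
proof (induction rule: talented_cong.induct)
  case (relation v i)
  let ?b = "{#(head E e, i + 1). e \<in># mset_set (out_arcs E v)#}"
  have sb: "set_mset ?b \<subseteq> verts E \<times> UNIV" by (auto simp: finite_out_arcs)
  have "graded_isomorphic A (mset_sum {#(v, i)#}) (shift i (Ap v))" using relation by (intro mset_sum_singleton)
  also have "graded_isomorphic A (shift i (Ap v)) (shift i (graded_sum (out_arcs E v) (\<lambda>e. shift 1 (Ap (head E e)))))"
    by (rule shift_iso) (rule Ap_decomposition[OF relation])
  also have "shift i (graded_sum (out_arcs E v) (\<lambda>e. shift 1 (Ap (head E e)))) = ideal_sum (out_arcs E v) (\<lambda>e. (head E e, i + 1))"
    by (simp add: ideal_sum_def shift_graded_sum shift_shift)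
  also have "graded_isomorphic A ... (mset_sum ?b)"
    by (rule mset_sum_iso(2)) (use sb finite_out_arcs in auto)
  finally show ?case using relation sb by auto
next
  case (refl a)
  then show ?case using graded_iso_refl by blast
next
  case (sym a b)
  then show ?case using graded_iso_sym mset_sum_graded by blast
next
  case (trans a b c)
  then show ?case using graded_iso_trans by blast
next
  case (add a b c d)
  then have "graded_isomorphic A (mset_sum (a + c)) (direct_sum (mset_sum a) (mset_sum c))"
    by (intro mset_sum_add) auto
  also have "graded_isomorphic A ... (direct_sum (mset_sum b) (mset_sum d))"
    using add by (intro direct_sum_iso) auto
  also have "graded_isomorphic A ... (mset_sum (b + d))"
    using add by (intro graded_iso_sym[OF mset_sum_graded direct_sum_graded_module mset_sum_add] mset_sum_graded) auto
  finally show ?case using add by auto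
qed

text \<open>The value is read off from a chosen representative; \<open>mset_sum_cong\<close> makes
  the choice harmless. The restriction to the carrier makes the map extensional, as the description
  of \<open>talented_to_Vgr\<close> demands.\<close>

definition theta :: "('v \<times> int) multiset set \<Rightarrow> ('a, nat \<Rightarrow> 'a) gmodule set" where
  "theta = (\<lambda>t\<in>carrier (talented_monoid E). Vgr_class A (mset_sum (SOME a. a \<in> t)))"

lemma theta_class:
  assumes "set_mset a \<subseteq> verts E \<times> UNIV"
  shows "theta (talented_class E a) = Vgr_class A (mset_sum a)"
proof -
  let ?b = "SOME b. b \<in> talented_class E a"
  have "?b \<in> talented_class E a" by (rule someI[of _ a]) (rule talented_class_self[OF assms])
  then have "talented_cong E a ?b" by (simp add: talented_class_def)
  from mset_sum_cong[OF this] have "Vgr_class A (mset_sum a) = Vgr_class A (mset_sum ?b)"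
    using Vgr_class_eq mset_sum_graded by blast
  then show ?thesis using talented_class_carrier[OF assms] by (simp add: theta_def)
qed

lemma theta_gen:
  assumes "v \<in> verts E"
  shows "theta (talented_gen E v i) = Vgr_class A (shift i (Ap v))"
  using theta_class[of "{#(v, i)#}"] assms mset_sum_singleton[OF assms, of i]
    Vgr_class_eq[OF mset_sum_graded shift_graded[OF Ap_graded]]
  by (simp add: talented_gen_def)

lemma theta_sum:
  assumes "finite I" "f ` I \<subseteq> verts E \<times> UNIV"
  shows "theta (talented_class E (image_mset f (mset_set I))) = Vgr_class A (ideal_sum I f)"
proof -
  have s: "set_mset (image_mset f (mset_set I)) \<subseteq> verts E \<times> UNIV" using assms by simp
  show ?thesis
    unfolding theta_class[OF s]
    using Vgr_class_eq[OF mset_sum_graded[OF s] ideal_sum_graded[OF assms]] mset_sum_iso(1)[OF assms(1) HOL.refl s] by blast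
qed

lemma theta_hom: "theta \<in> zmonoid_hom (talented_monoid E) (Vgr A)"
proof -
  have c: "theta t \<in> carrier (Vgr A)" if "t \<in> carrier (talented_monoid E)" for t
    using that by (elim talented_carrierE) (simp add: theta_class Vgr_classI mset_sum_fg_projective)
  have m: "theta (s \<otimes>\<^bsub>talented_monoid E\<^esub> t) = theta s \<otimes>\<^bsub>Vgr A\<^esub> theta t"
    if st: "s \<in> carrier (talented_monoid E)" "t \<in> carrier (talented_monoid E)" for s t
  proof -
    obtain a where a: "set_mset a \<subseteq> verts E \<times> UNIV" "s = talented_class E a" using st(1) by (rule talented_carrierE)
    obtain b where b: "set_mset b \<subseteq> verts E \<times> UNIV" "t = talented_class E b" using st(2) by (rule talented_carrierE)
    have ab: "set_mset (a + b) \<subseteq> verts E \<times> UNIV" using a b by auto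
    have "theta s \<otimes>\<^bsub>Vgr A\<^esub> theta t = Vgr_class A (direct_sum (mset_sum a) (mset_sum b))"
      unfolding a b theta_class[OF a(1)] theta_class[OF b(1)]
      by (rule Vgr_mult[OF Vgr_class_self Vgr_class_self]) (simp_all add: a b mset_sum_graded mset_sum_fg_projective)
    also have "... = Vgr_class A (mset_sum (a + b))"
      using Vgr_class_eq[OF mset_sum_graded[OF ab] direct_sum_graded_module mset_sum_add] a b mset_sum_graded by auto
    finally show ?thesis using a b ab by (simp add: talented_mult theta_class)
  qed
  have "theta (talented_class E {#}) = Vgr_class A (ideal_sum {} (\<lambda>_::nat. undefined))"
    using theta_sum[of "{}" "\<lambda>_::nat. undefined"] by simp
  also have "... = \<one>\<^bsub>Vgr A\<^esub>"
    by (rule Vgr_one[OF ideal_sum_graded]) (auto simp: ideal_sum_def)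
  finally have o: "theta \<one>\<^bsub>talented_monoid E\<^esub> = \<one>\<^bsub>Vgr A\<^esub>" by (simp add: talented_monoid_def)
  have z: "theta (zact (talented_monoid E) n t) = zact (Vgr A) n (theta t)"
    if t: "t \<in> carrier (talented_monoid E)" for n t
  proof -
    obtain a where a: "set_mset a \<subseteq> verts E \<times> UNIV" "t = talented_class E a" using t by (rule talented_carrierE)
    obtain l where l: "mset l = a" using ex_mset by blast
    have la: "image_mset ((!) l) (mset_set {..<length l}) = a" using l by (simp add: mset_index)
    have fl: "(!) l ` {..<length l} \<subseteq> verts E \<times> UNIV" by (rule image_subsetI) (metis a(1) l lessThan_iff nth_mem_mset subsetD)
    have t1: "theta t = Vgr_class A (ideal_sum {..<length l} ((!) l))"
      using theta_sum[OF _ fl] by (simp add: la a)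
    have "theta (zact (talented_monoid E) n t) = theta (talented_class E (image_mset (\<lambda>(v, i). (v, i + n)) a))"
      using talented_zact[OF a(1)] a by simp
    also have "... = theta (talented_class E (image_mset (\<lambda>j. (\<lambda>(v, i). (v, i + n)) (l ! j)) (mset_set {..<length l})))"
      by (simp add: la[symmetric] image_mset.compositionality o_def)
    also have "... = Vgr_class A (ideal_sum {..<length l} (\<lambda>j. (\<lambda>(v, i). (v, i + n)) (l ! j)))"
      by (rule theta_sum) (use fl in auto)
    also have "ideal_sum {..<length l} (\<lambda>j. (\<lambda>(v, i). (v, i + n)) (l ! j)) = shift n (ideal_sum {..<length l} ((!) l))"
      by (simp add: ideal_sum_def shift_graded_sum shift_shift case_prod_beta ac_simps)
    also have "Vgr_class A ... = zact (Vgr A) n (theta t)"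
    proof -
      obtain N where "N \<in> theta t" using c[OF t] Vgr_carrier_nonempty by blast
      then show ?thesis unfolding t1 by (intro Vgr_zact[symmetric] ideal_sum_graded) (use fl in auto)
    qed
    finally show ?thesis .
  qed
  show ?thesis using c m o z by (simp add: zmonoid_hom_def hom_def Pi_def)
qed

text \<open>Both sides are the class of the same sum over the positions of a list. Besides giving
  the uniqueness of \<open>theta\<close>, this later identifies \<phi> with the \<open>theta\<close>
  of the family in \<open>A\<close>.\<close>

lemma zmonoid_hom_eq_theta:
  assumes h: "h \<in> zmonoid_hom (talented_monoid E) (Vgr A)"
    and gen: "\<And>v. v \<in> verts E \<Longrightarrow> h (talented_gen E v 0) = Vgr_class A (Ap v)"
    and t: "t \<in> carrier (talented_monoid E)"
  shows "h t = theta t"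
proof -
  obtain a where a: "set_mset a \<subseteq> verts E \<times> UNIV" "t = talented_class E a" using t by (rule talented_carrierE)
  obtain l where l: "mset l = a" using ex_mset by blast
  have la: "image_mset ((!) l) (mset_set {..<length l}) = a" using l by (simp add: mset_index)
  have fl: "(!) l ` {..<length l} \<subseteq> verts E \<times> UNIV" by (rule image_subsetI) (metis a(1) l lessThan_iff nth_mem_mset subsetD)
  have "h (talented_class E {#(fst (l ! j), snd (l ! j)). j \<in># mset_set {..<length l}#}) =
      Vgr_class A (graded_sum {..<length l} (\<lambda>j. shift (snd (l ! j)) (Ap (fst (l ! j)))))"
    by (rule zmonoid_hom_talented_sum[OF h ring_axioms gen Ap_graded]) (use fl in auto)
  then show ?thesis using theta_sum[OF _ fl] by (simp add: la a ideal_sum_def)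
qed

text \<open>For the family of generators of the Leavitt path algebra the left side is the definite
  description that defines \<open>talented_to_Vgr\<close>.\<close>

lemma theta_unique:
  "(THE \<theta>. \<theta> \<in> zmonoid_hom (talented_monoid E) (Vgr A) \<and> \<theta> \<in> extensional (carrier (talented_monoid E)) \<and>
     (\<forall>v\<in>verts E. \<forall>i. \<theta> (talented_gen E v i) = Vgr_class A (shift i (Ap v)))) = theta"
proof (rule the_equality)
  show "theta \<in> zmonoid_hom (talented_monoid E) (Vgr A) \<and> theta \<in> extensional (carrier (talented_monoid E)) \<and>
     (\<forall>v\<in>verts E. \<forall>i. theta (talented_gen E v i) = Vgr_class A (shift i (Ap v)))"
    using theta_hom theta_gen by (simp add: theta_def)
next
  fix h assume h: "h \<in> zmonoid_hom (talented_monoid E) (Vgr A) \<and> h \<in> extensional (carrier (talented_monoid E)) \<and>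
     (\<forall>v\<in>verts E. \<forall>i. h (talented_gen E v i) = Vgr_class A (shift i (Ap v)))"
  show "h = theta"
  proof (rule extensionalityI[of _ "carrier (talented_monoid E)"])
    show "h t = theta t" if "t \<in> carrier (talented_monoid E)" for t
      by (rule zmonoid_hom_eq_theta) (use h that in \<open>auto simp: shift_0\<close>)
  qed (use h in \<open>auto simp: theta_def\<close>)
qed

end

section \<open>From a monoid homomorphism to a Leavitt family\<close>

text \<open>The canonical inclusion of the summand \<open>i\<close> into the direct sum.\<close>

definition single :: "'i set \<Rightarrow> ('i \<Rightarrow> ('a, 'm) gmodule) \<Rightarrow> 'i \<Rightarrow> 'm \<Rightarrow> 'i \<Rightarrow> 'm" where
  "single I P i q = (\<lambda>j\<in>I. if j = i then q else \<zero>\<^bsub>P j\<^esub>)"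

lemma single_closed:
  assumes P: "\<And>j. j \<in> I \<Longrightarrow> graded_module A (P j)" and q: "q \<in> carrier (P i)"
  shows "single I P i q \<in> carrier (graded_sum I P)"
  using abelian_groupE(2)[OF graded_moduleD(4)[OF P]] q by (auto simp: single_def)

lemma single_grade:
  assumes P: "\<And>j. j \<in> I \<Longrightarrow> graded_module A (P j)" and q: "q \<in> grade (P i) n"
  shows "single I P i q \<in> grade (graded_sum I P) n"
  using graded_group.grade_zero[OF graded_moduleD(1)[OF P]] q by (auto simp: single_def)

lemma left_module_smult_zero:
  assumes "left_module A M" "a \<in> carrier A"
  shows "a \<odot>\<^bsub>M\<^esub> \<zero>\<^bsub>M\<^esub> = \<zero>\<^bsub>M\<^esub>"
proof -
  interpret left_module A M by fact
  have "a \<odot>\<^bsub>M\<^esub> \<zero>\<^bsub>M\<^esub> \<oplus>\<^bsub>M\<^esub> a \<odot>\<^bsub>M\<^esub> \<zero>\<^bsub>M\<^esub> = a \<odot>\<^bsub>M\<^esub> \<zero>\<^bsub>M\<^esub>"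
    using smult_r_distr[of a "\<zero>\<^bsub>M\<^esub>" "\<zero>\<^bsub>M\<^esub>"] assms(2) by simp
  moreover have "a \<odot>\<^bsub>M\<^esub> \<zero>\<^bsub>M\<^esub> \<in> carrier M" using assms(2) smult_closed by simp
  ultimately show ?thesis by (metis M.add.l_cancel_one')
qed

lemma single_smult:
  assumes P: "\<And>j. j \<in> I \<Longrightarrow> graded_module A (P j)" and a: "a \<in> carrier A"
  shows "a \<odot>\<^bsub>graded_sum I P\<^esub> single I P i q = single I P i (a \<odot>\<^bsub>P i\<^esub> q)"
  using left_module_smult_zero[OF graded_moduleD(2)[OF P] a] by (auto simp: single_def intro!: restrict_ext)

lemma single_zero: "single I P i \<zero>\<^bsub>P i\<^esub> = \<zero>\<^bsub>graded_sum I P\<^esub>"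
  by (auto simp: single_def intro!: restrict_ext)

lemma graded_sum_finsum:
  assumes P: "\<And>j. j \<in> I \<Longrightarrow> abelian_group (P j)" and "finite S" "F \<in> S \<rightarrow> carrier (graded_sum I P)" "j \<in> I"
  shows "finsum (graded_sum I P) F S j = finsum (P j) (\<lambda>s. F s j) S"
  by (rule finsum_additive[where h = "\<lambda>f. f j"])
    (use assms abelian_group_graded_sum[of I P] in \<open>auto dest: abelian_group.axioms(1)\<close>)

lemma single_sum:
  assumes P: "\<And>j. j \<in> I \<Longrightarrow> graded_module A (P j)" and "finite I" and f: "f \<in> carrier (graded_sum I P)"
  shows "(\<Oplus>\<^bsub>graded_sum I P\<^esub> i\<in>I. single I P i (f i)) = f"
proof
  fix j
  have ag: "abelian_group (P j)" if "j \<in> I" for j using graded_moduleD(4)[OF P[OF that]] .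
  interpret S: abelian_group "graded_sum I P" by (rule abelian_group_graded_sum) (rule ag)
  have c: "(\<lambda>i. single I P i (f i)) \<in> I \<rightarrow> carrier (graded_sum I P)"
    by (intro Pi_I single_closed[of I A P, OF P]) (use f in auto)
  show "(\<Oplus>\<^bsub>graded_sum I P\<^esub> i\<in>I. single I P i (f i)) j = f j"
  proof (cases "j \<in> I")
    case True
    interpret Pj: abelian_group "P j" using ag[OF True] .
    have "(\<Oplus>\<^bsub>graded_sum I P\<^esub> i\<in>I. single I P i (f i)) j = (\<Oplus>\<^bsub>P j\<^esub> i\<in>I. single I P i (f i) j)"
      by (rule graded_sum_finsum) (use ag c True assms(2) in auto)
    also have "... = (\<Oplus>\<^bsub>P j\<^esub> i\<in>I. if j = i then f i else \<zero>\<^bsub>P j\<^esub>)"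
    proof (rule Pj.finsum_cong')
      show "(\<lambda>i. if j = i then f i else \<zero>\<^bsub>P j\<^esub>) \<in> I \<rightarrow> carrier (P j)" using f by auto
    qed (auto simp: single_def True)
    also have "... = f j"
      by (rule HOL.trans[OF Pj.add.finprod_cong' Pj.add.finprod_singleton[OF True assms(2), of "\<lambda>_. f j"]]) (use f True in auto)
    finally show ?thesis .
  next
    case False
    have "(\<Oplus>\<^bsub>graded_sum I P\<^esub> i\<in>I. single I P i (f i)) \<in> carrier (graded_sum I P)"
      by (rule S.finsum_closed[OF c])
    then show ?thesis using False f by (auto simp: PiE_def extensional_def)
  qed
qed

context graded_ring
begin

text \<open>\<open>p v\<close> is the unit, projected onto the summand \<open>v\<close> and carried
  back to \<open>A\<close>. Left module endomorphisms of \<open>A\<close> are right multiplications,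
  so the projections become right multiplications by the \<open>p v\<close>, which inherit
  orthogonality, idempotency and the sum from them.\<close>

lemma idempotents_of_decomposition:
  fixes P :: "'v \<Rightarrow> ('a, 'm) gmodule"
  assumes V: "finite V" and P: "\<And>v. v \<in> V \<Longrightarrow> graded_module A (P v)"
    and iso: "graded_isomorphic A (regular_module A) (graded_sum V P)"
  obtains p where "\<And>v. v \<in> V \<Longrightarrow> grade0_idempotent A (p v)"
    "\<And>u v. u \<in> V \<Longrightarrow> v \<in> V \<Longrightarrow> u \<noteq> v \<Longrightarrow> p u \<otimes> p v = \<zero>" "(\<Oplus>v\<in>V. p v) = \<one>"
    "\<And>v. v \<in> V \<Longrightarrow> graded_isomorphic A (principal_left_ideal A (p v)) (P v)"
proof -
  have S: "graded_module A (graded_sum V P)" by (rule graded_sum_graded_module[OF ring_axioms V P])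
  obtain g k where g: "g \<in> graded_module_hom A (regular_module A) (graded_sum V P)"
    and k: "k \<in> graded_module_hom A (graded_sum V P) (regular_module A)"
    and kg: "\<And>a. a \<in> carrier A \<Longrightarrow> k (g a) = a"
    and gk: "\<And>f. f \<in> carrier (graded_sum V P) \<Longrightarrow> g (k f) = f"
    using graded_isoE[OF regular_module_graded S iso] by (metis regular_module_simps(1))
  note gc = graded_hom_closed[OF g, unfolded regular_module_simps]
    and kc = graded_hom_closed[OF k, unfolded regular_module_simps]
  define p where "p = (\<lambda>v. k (single V P v (g \<one> v)))"
  have gv: "g a v \<in> carrier (P v)" if "a \<in> carrier A" "v \<in> V" for a v using gc[OF that(1)] that(2) by auto
  have sc: "single V P v q \<in> carrier (graded_sum V P)" if "q \<in> carrier (P v)" for v q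
    using single_closed[of V A P, OF P that] .
  have ga: "g a v = a \<odot>\<^bsub>P v\<^esub> g \<one> v" if "a \<in> carrier A" "v \<in> V" for a v
    using graded_hom_smult[OF g that(1), of \<one>] that by simp
  have kp: "k (single V P v (g a v)) = a \<otimes> p v" if a: "a \<in> carrier A" and v: "v \<in> V" for a v
    using graded_hom_smult[OF k a sc[OF gv[OF one_closed v]]] single_smult[of V A P, OF P a, of v "g \<one> v"] ga[OF a v]
    by (simp only: p_def regular_module_simps)
  have pc: "p v \<in> carrier A" if "v \<in> V" for v unfolding p_def using kc sc gv that by simp
  have gp: "g (p u) = single V P u (g \<one> u)" if "u \<in> V" for u
    unfolding p_def using gk sc gv that by simp
  have k0: "k \<zero>\<^bsub>graded_sum V P\<^esub> = \<zero>"
    using graded_hom_zero[OF k graded_moduleD(4)[OF S] graded_moduleD(4)[OF regular_module_graded]]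
    by (simp only: regular_module_simps)
  \<comment> \<open>By \<open>kp\<close>, right multiplication by \<open>p v\<close> is the
    projection onto the summand \<open>v\<close>. The element \<open>p u\<close> corresponds to a
    tuple concentrated in the summand \<open>u\<close>.\<close>
  have pp: "p u \<otimes> p v = (if u = v then p v else \<zero>)" if "u \<in> V" "v \<in> V" for u v
  proof -
    have "p u \<otimes> p v = k (single V P v (single V P u (g \<one> u) v))"
      using kp[OF pc[OF that(1)] that(2)] gp[OF that(1)] by simp
    also have "single V P u (g \<one> u) v = (if u = v then g \<one> v else \<zero>\<^bsub>P v\<^esub>)"
      using that by (simp add: single_def)
    finally have e: "p u \<otimes> p v = k (single V P v (if u = v then g \<one> v else \<zero>\<^bsub>P v\<^esub>))" .
    have "k (single V P v \<zero>\<^bsub>P v\<^esub>) = \<zero>" using single_zero[of V P v] k0 by (simp only:)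
    then show ?thesis using e by (simp add: p_def)
  qed
  have pidem: "grade0_idempotent A (p v)" if v: "v \<in> V" for v
  proof -
    have "g \<one> \<in> grade (graded_sum V P) 0"
      using graded_hom_grade[OF g, of \<one> 0] one_grade by simp
    then have "single V P v (g \<one> v) \<in> grade (graded_sum V P) 0"
      using single_grade[of V A P "g \<one> v" v 0, OF P] v by auto
    then have "p v \<in> grade A 0"
      using graded_hom_grade[OF k] unfolding p_def by fastforce
    then show ?thesis using pp[OF v v] by (simp add: grade0_idempotent_def)
  qed
  show thesis
  proof
    show "grade0_idempotent A (p v)" if "v \<in> V" for v using pidem[OF that] .
    show "p u \<otimes> p v = \<zero>" if "u \<in> V" "v \<in> V" "u \<noteq> v" for u v using pp that by simp
    have "(\<Oplus>v\<in>V. p v) = k (\<Oplus>\<^bsub>graded_sum V P\<^esub> v\<in>V. single V P v (g \<one> v))"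
      unfolding p_def
    proof (rule finsum_additive[symmetric, where h = k])
      show "abelian_monoid (graded_sum V P)" using graded_moduleD(4)[OF S] by (rule abelian_group.axioms(1))
      show "(\<lambda>v. single V P v (g \<one> v)) \<in> V \<rightarrow> carrier (graded_sum V P)" using sc gv by blast
      show "k (x \<oplus>\<^bsub>graded_sum V P\<^esub> y) = k x \<oplus> k y"
        if "x \<in> carrier (graded_sum V P)" "y \<in> carrier (graded_sum V P)" for x y
        using graded_hom_add[OF k that] by (simp only: regular_module_simps)
    qed (use abelian_monoid_axioms V kc k0 in auto)
    also have "(\<Oplus>\<^bsub>graded_sum V P\<^esub> v\<in>V. single V P v (g \<one> v)) = g \<one>"
      by (rule single_sum[of V A P, OF P V gc[OF one_closed]])
    finally show "(\<Oplus>v\<in>V. p v) = \<one>" using kg by simp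
    show "graded_isomorphic A (principal_left_ideal A (p v)) (P v)" if v: "v \<in> V" for v
    proof (rule graded_isoI[where h = "\<lambda>a. g a v" and g = "\<lambda>q. k (single V P v q)"])
      have pv: "grade0_idempotent A (p v)" using pidem[OF v] .
      note s = left_ideal_simps(1-3) left_ideal_simps(4,5)[OF pv]
      show "(\<lambda>a. g a v) \<in> graded_module_hom A (principal_left_ideal A (p v)) (P v)"
      proof (rule graded_module_homI)
        fix a b assume "a \<in> carrier (principal_left_ideal A (p v))" "b \<in> carrier (principal_left_ideal A (p v))"
        then have ab: "a \<in> carrier A" "b \<in> carrier A" by (auto simp: s)
        then show "g a v \<in> carrier (P v)" using gv v by simp
        show "g (a \<oplus>\<^bsub>principal_left_ideal A (p v)\<^esub> b) v = g a v \<oplus>\<^bsub>P v\<^esub> g b v"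
          using graded_hom_add[OF g, of a b] ab v by (simp add: s)
        fix c assume c: "c \<in> carrier A"
        then show "g (c \<odot>\<^bsub>principal_left_ideal A (p v)\<^esub> a) v = c \<odot>\<^bsub>P v\<^esub> g a v"
          using graded_hom_smult[OF g c, of a] ab v by (simp add: s)
      next
        fix n a assume "a \<in> grade (principal_left_ideal A (p v)) n"
        then have "a \<in> grade (regular_module A) n" by (simp add: s)
        from graded_hom_grade[OF g this] show "g a v \<in> grade (P v) n" using v by auto
      qed
      have c: "k (single V P v q) \<in> carrier A" "g (k (single V P v q)) v = q" if "q \<in> carrier (P v)" for q
        using kc sc[OF that] gk[OF sc[OF that]] v by (auto simp: single_def)
      have "k (single V P v q) \<otimes> p v = k (single V P v q)" if "q \<in> carrier (P v)" for q
        using kp[OF c(1)[OF that] v] c(2)[OF that] by simp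
      then show "(\<lambda>q. k (single V P v q)) \<in> carrier (P v) \<rightarrow> carrier (principal_left_ideal A (p v))"
        using c by (auto simp: s)
      show "k (single V P v (g a v)) = a" if "a \<in> carrier (principal_left_ideal A (p v))" for a
        using that kp v by (auto simp: s)
      show "g (k (single V P v q)) v = q" if "q \<in> carrier (P v)" for q using c(2) that .
    qed
  qed
qed

text \<open>These are the matrix entries: the isomorphism sends \<open>q\<close> to the row of all
  \<open>x e\<close>, and its inverse sends the generator \<open>r e\<close> of the summand
  \<open>e\<close> to \<open>y e\<close>.\<close>

lemma edges_of_decomposition:
  fixes r :: "'e \<Rightarrow> 'a"
  assumes F: "finite F" and q: "grade0_idempotent A q" and r: "\<And>e. e \<in> F \<Longrightarrow> grade0_idempotent A (r e)"
    and iso: "graded_isomorphic A (principal_left_ideal A q)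
      (graded_sum F (\<lambda>e. shift 1 (principal_left_ideal A (r e))))"
  obtains x y where "\<And>e. e \<in> F \<Longrightarrow> x e \<in> grade A 1" "\<And>e. e \<in> F \<Longrightarrow> y e \<in> grade A (- 1)"
    "\<And>e. e \<in> F \<Longrightarrow> q \<otimes> x e = x e" "\<And>e. e \<in> F \<Longrightarrow> x e \<otimes> r e = x e"
    "\<And>e. e \<in> F \<Longrightarrow> r e \<otimes> y e = y e" "\<And>e. e \<in> F \<Longrightarrow> y e \<otimes> q = y e"
    "\<And>e f. e \<in> F \<Longrightarrow> f \<in> F \<Longrightarrow> y e \<otimes> x f = (if e = f then r e else \<zero>)" "(\<Oplus>e\<in>F. x e \<otimes> y e) = q"
proof -
  let ?P = "\<lambda>e. shift 1 (principal_left_ideal A (r e))"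
  have P: "graded_module A (?P e)" if "e \<in> F" for e using r[OF that] by (intro shift_graded principal_left_ideal_graded)
  have S: "graded_module A (graded_sum F ?P)" by (rule graded_sum_graded_module[OF ring_axioms F P])
  obtain g k where g: "g \<in> graded_module_hom A (principal_left_ideal A q) (graded_sum F ?P)"
    and k: "k \<in> graded_module_hom A (graded_sum F ?P) (principal_left_ideal A q)"
    and kg: "\<And>a. a \<in> carrier (principal_left_ideal A q) \<Longrightarrow> k (g a) = a"
    and gk: "\<And>f. f \<in> carrier (graded_sum F ?P) \<Longrightarrow> g (k f) = f"
    using graded_isoE[OF principal_left_ideal_graded[OF q] S iso] by blast
  note s = left_ideal_simps(1-3) left_ideal_simps(4,5)[OF q]
  have rs: "carrier (?P e) = {a \<in> carrier A. a \<otimes> r e = a}" "grade (?P e) n = {a \<in> grade A (1 + n). a \<otimes> r e = a}"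
    "\<zero>\<^bsub>?P e\<^esub> = \<zero>" "a \<odot>\<^bsub>?P e\<^esub> b = a \<otimes> b" if "e \<in> F" for e n a b
    using left_ideal_simps(4,5)[OF r[OF that]] by (simp_all add: left_ideal_simps(1-3))
  have qc: "q \<in> carrier A" "q \<otimes> q = q" "q \<in> grade A 0" using q by (auto simp: grade0_idempotent_def grade_closed)
  have rc: "r e \<in> carrier A" "r e \<otimes> r e = r e" "r e \<in> grade A 0" if "e \<in> F" for e
    using r[OF that] by (auto simp: grade0_idempotent_def grade_closed)
  have qP: "q \<in> carrier (principal_left_ideal A q)" "q \<in> grade (principal_left_ideal A q) 0"
    using qc by (auto simp: s)
  \<comment> \<open>In the module shifted by 1 the idempotent \<open>r e\<close> sits in degree -1,
    and this becomes the degree of \<open>y e\<close>.\<close>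
  have rP: "r e \<in> carrier (?P e)" "r e \<in> grade (?P e) (- 1)" if "e \<in> F" for e
    using rc[OF that] unfolding rs[OF that] by auto
  define x where "x = (\<lambda>e. g q e)"
  define y where "y = (\<lambda>e. k (single F ?P e (r e)))"
  have sc: "single F ?P e a \<in> carrier (graded_sum F ?P)" if "a \<in> carrier (?P e)" for e a
    using single_closed[of F A ?P, OF P that] .
  have kc: "k f \<in> carrier A" "k f \<otimes> q = k f" if "f \<in> carrier (graded_sum F ?P)" for f
    using graded_hom_closed[OF k that] by (auto simp: s)
  have xr: "x e \<in> carrier A" "x e \<otimes> r e = x e" "x e \<in> grade A 1" if "e \<in> F" for e
  proof -
    \<comment> \<open>Degree 0 in a summand shifted by 1 is degree 1 in \<open>A\<close>.\<close>
    have "g q \<in> grade (graded_sum F ?P) 0" using graded_hom_grade[OF g qP(2)] .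
    then have "x e \<in> grade (?P e) 0" unfolding x_def using that by auto
    then have "x e \<in> {a \<in> grade A (1 + 0). a \<otimes> r e = a}" unfolding rs(2)[OF that] .
    then show "x e \<in> carrier A" "x e \<otimes> r e = x e" "x e \<in> grade A 1" using grade_closed by auto
  qed
  have yc: "y e \<in> carrier A" "y e \<otimes> q = y e" "y e \<in> grade A (- 1)" if "e \<in> F" for e
  proof -
    show "y e \<in> carrier A" "y e \<otimes> q = y e" unfolding y_def using kc[OF sc[OF rP(1)[OF that]]] by auto
    have "single F ?P e (r e) \<in> grade (graded_sum F ?P) (- 1)"
      by (rule single_grade[of F A ?P, OF P rP(2)[OF that]])
    from graded_hom_grade[OF k this] show "y e \<in> grade A (- 1)" by (simp add: y_def s)
  qed
  \<comment> \<open>Since \<open>q\<close> generates \<open>A q\<close>, the map \<open>g\<close> is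
    right multiplication by the entries of \<open>g q\<close>; \<open>ky\<close> is the
    corresponding statement for \<open>k\<close>.\<close>
  have gx: "g a e = a \<otimes> x e" if a: "a \<in> carrier A" "a \<otimes> q = a" and e: "e \<in> F" for a e
  proof -
    have "g a = g (a \<odot>\<^bsub>principal_left_ideal A q\<^esub> q)" using a by (simp add: s)
    also have "... = a \<odot>\<^bsub>graded_sum F ?P\<^esub> g q" by (rule graded_hom_smult[OF g a(1) qP(1)])
    finally show ?thesis using e by (simp add: x_def left_ideal_simps(1-3))
  qed
  have ky: "k (single F ?P e a) = a \<otimes> y e" if e: "e \<in> F" and a: "a \<in> carrier A" "a \<otimes> r e = a" for a e
  proof -
    have "single F ?P e a = single F ?P e (a \<odot>\<^bsub>?P e\<^esub> r e)" using a rs(4)[OF e] by simp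
    also have "... = a \<odot>\<^bsub>graded_sum F ?P\<^esub> single F ?P e (r e)" by (rule single_smult[of F A ?P, OF P a(1), symmetric])
    finally have "k (single F ?P e a) = a \<odot>\<^bsub>principal_left_ideal A q\<^esub> y e"
      unfolding y_def using graded_hom_smult[OF k a(1) sc[OF rP(1)[OF e]]] by simp
    then show ?thesis by (simp add: s)
  qed
  have gqc: "g q \<in> carrier (graded_sum F ?P)" by (rule graded_hom_closed[OF g qP(1)])
  show thesis
  proof
    show "x e \<in> grade A 1" "y e \<in> grade A (- 1)" "x e \<otimes> r e = x e" "y e \<otimes> q = y e" if "e \<in> F" for e
      using xr yc that by auto
    show "q \<otimes> x e = x e" if "e \<in> F" for e using gx[OF qc(1,2) that] by (simp add: x_def)
    show "r e \<otimes> y e = y e" if "e \<in> F" for e using ky[OF that rc(1,2)] that by (simp add: y_def)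
    show "y e \<otimes> x f = (if e = f then r e else \<zero>)" if "e \<in> F" "f \<in> F" for e f
    proof -
      have "y e \<otimes> x f = g (y e) f" using gx[OF yc(1,2)[OF that(1)] that(2)] by simp
      also have "g (y e) = single F ?P e (r e)" unfolding y_def by (rule gk[OF sc[OF rP(1)[OF that(1)]]])
      finally show ?thesis using that rs(3)[OF that(2)] by (simp add: single_def left_ideal_simps(1-3))
    qed
    have gqe: "g q e \<in> carrier (?P e)" if "e \<in> F" for e using gqc that by auto
    have "(\<Oplus>e\<in>F. x e \<otimes> y e) = (\<Oplus>e\<in>F. k (single F ?P e (g q e)))"
      by (rule finsum_cong') (use ky xr yc in \<open>auto simp: x_def\<close>)
    also have "... = k (\<Oplus>\<^bsub>graded_sum F ?P\<^esub> e\<in>F. single F ?P e (g q e))"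
    proof (rule finsum_additive[symmetric, where h = k])
      show "abelian_monoid (graded_sum F ?P)" using graded_moduleD(4)[OF S] by (rule abelian_group.axioms(1))
      show "(\<lambda>e. single F ?P e (g q e)) \<in> F \<rightarrow> carrier (graded_sum F ?P)" using sc gqe by blast
      show "k (u \<oplus>\<^bsub>graded_sum F ?P\<^esub> v) = k u \<oplus> k v"
        if "u \<in> carrier (graded_sum F ?P)" "v \<in> carrier (graded_sum F ?P)" for u v
        using graded_hom_add[OF k that] by (simp only: s)
      show "k \<zero>\<^bsub>graded_sum F ?P\<^esub> = \<zero>"
        using graded_hom_zero[OF k graded_moduleD(4)[OF S] graded_moduleD(4)[OF principal_left_ideal_graded[OF q]]]
        by (simp only: s)
    qed (use abelian_monoid_axioms F kc in auto)
    also have "(\<Oplus>\<^bsub>graded_sum F ?P\<^esub> e\<in>F. single F ?P e (g q e)) = g q"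
      by (rule single_sum[of F A ?P, OF P F gqc])
    finally show "(\<Oplus>e\<in>F. x e \<otimes> y e) = q" using kg[OF qP(1)] by simp
  qed
qed

section \<open>The family attached to a homomorphism\<close>

lemma leavitt_family_of_hom:
  fixes E :: "('v, 'e) pre_digraph"
  assumes E: "fin_digraph E" and phi: "\<phi> \<in> zmonoid_hom (talented_monoid E) (Vgr A)"
    and unit: "\<phi> (talented_unit E) = Vgr_class A (regular_module A)"
  obtains p x y where "leavitt_family A E p x y"
    "\<And>v. v \<in> verts E \<Longrightarrow> \<phi> (talented_gen E v 0) = Vgr_class A (principal_left_ideal A (p v))"
proof -
  interpret E: fin_digraph E by fact
  have fo: "finite (out_arcs E v)" for v by (rule finite_subset[OF _ E.finite_arcs]) auto
  have phic: "\<phi> t \<in> carrier (Vgr A)" if "t \<in> carrier (talented_monoid E)" for t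
    using phi that by (auto simp: zmonoid_hom_def hom_def)
  have gen: "talented_gen E v 0 \<in> carrier (talented_monoid E)" if "v \<in> verts E" for v
    unfolding talented_gen_def by (rule talented_class_carrier) (use that in auto)
  have "\<exists>P :: ('a, nat \<Rightarrow> 'a) gmodule. graded_fg_projective A P \<and> \<phi> (talented_gen E v 0) = Vgr_class A P"
    if "v \<in> verts E" for v
    using phic[OF gen[OF that]] by (auto simp: Vgr_def)
  then obtain P :: "'v \<Rightarrow> ('a, nat \<Rightarrow> 'a) gmodule" where P: "\<And>v. v \<in> verts E \<Longrightarrow> graded_fg_projective A (P v)"
    "\<And>v. v \<in> verts E \<Longrightarrow> \<phi> (talented_gen E v 0) = Vgr_class A (P v)" by metis
  have Pg: "graded_module A (P v)" if "v \<in> verts E" for v using P(1)[OF that] by (rule fg_projective_graded)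
  note sum = zmonoid_hom_talented_sum[OF phi ring_axioms P(2) Pg]
  have VS: "graded_module A (graded_sum (verts E) P)"
    by (rule graded_sum_graded_module[OF ring_axioms E.finite_verts Pg])
  have "\<phi> (talented_class E {#(v, 0). v \<in># mset_set (verts E)#}) = Vgr_class A (graded_sum (verts E) (\<lambda>v. shift 0 (P v)))"
    using sum[of "verts E" "\<lambda>v. v" "\<lambda>_. 0"] by simp
  then have u: "\<phi> (talented_unit E) = Vgr_class A (graded_sum (verts E) P)"
    by (simp add: shift_0 talented_unit_def)
  have "talented_unit E \<in> carrier (talented_monoid E)"
    unfolding talented_unit_def by (rule talented_class_carrier) auto
  \<comment> \<open>A common member of the two descriptions of this class, as
    \<open>Vgr_class_eqD\<close> requires.\<close>
  then obtain N where "N \<in> \<phi> (talented_unit E)" using Vgr_carrier_nonempty phic by blast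
  then have iso: "graded_isomorphic A (regular_module A) (graded_sum (verts E) P)"
    using Vgr_class_eqD[OF _ _ regular_module_graded] unit u by metis
  obtain p where p: "\<And>v. v \<in> verts E \<Longrightarrow> grade0_idempotent A (p v)"
    "\<And>u v. u \<in> verts E \<Longrightarrow> v \<in> verts E \<Longrightarrow> u \<noteq> v \<Longrightarrow> p u \<otimes> p v = \<zero>" "(\<Oplus>v\<in>verts E. p v) = \<one>"
    "\<And>v. v \<in> verts E \<Longrightarrow> graded_isomorphic A (principal_left_ideal A (p v)) (P v)"
    using idempotents_of_decomposition[OF E.finite_verts Pg iso] by metis
  have pg: "graded_module A (principal_left_ideal A (p v))" if "v \<in> verts E" for v
    using p(1)[OF that] by (rule principal_left_ideal_graded)
  have phip: "\<phi> (talented_gen E v 0) = Vgr_class A (principal_left_ideal A (p v))" if "v \<in> verts E" for v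
    using P(2)[OF that] Vgr_class_eq[OF pg[OF that] Pg[OF that] p(4)[OF that]] by simp
  \<comment> \<open>All conditions on the edges leaving \<open>v\<close> in one predicate, so that
    both families can be chosen for all vertices at once.\<close>
  define Q where "Q = (\<lambda>v x y. (\<forall>e\<in>out_arcs E v. x e \<in> grade A 1 \<and> y e \<in> grade A (- 1) \<and> p v \<otimes> x e = x e \<and> x e \<otimes> p (head E e) = x e \<and>
      p (head E e) \<otimes> y e = y e \<and> y e \<otimes> p v = y e \<and>
      (\<forall>f\<in>out_arcs E v. y e \<otimes> x f = (if e = f then p (head E e) else \<zero>))) \<and>
      (\<Oplus>e\<in>out_arcs E v. x e \<otimes> y e) = p v)"
  have "\<exists>x y. Q v x y" if v: "v \<in> verts E" and ne: "out_arcs E v \<noteq> {}" for v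
  proof -
    have h: "head E e \<in> verts E" if "e \<in> out_arcs E v" for e using that by auto
    have "talented_cong E {#(v, 0)#} {#(head E e, 0 + 1). e \<in># mset_set (out_arcs E v)#}"
      by (rule talented_cong.relation[OF v ne])
    then have c: "talented_gen E v 0 = talented_class E {#(head E e, 1). e \<in># mset_set (out_arcs E v)#}"
      unfolding talented_gen_def using talented_class_eq by fastforce
    have "\<phi> (talented_gen E v 0) = Vgr_class A (graded_sum (out_arcs E v) (\<lambda>e. shift 1 (principal_left_ideal A (p (head E e)))))"
      unfolding c
      by (rule zmonoid_hom_talented_sum[OF phi ring_axioms phip pg, where d = "\<lambda>_. 1" and g = "head E"])
        (use fo h in auto)
    moreover obtain N where "N \<in> \<phi> (talented_gen E v 0)" using Vgr_carrier_nonempty phic gen[OF v] by blast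
    ultimately have "graded_isomorphic A (principal_left_ideal A (p v))
        (graded_sum (out_arcs E v) (\<lambda>e. shift 1 (principal_left_ideal A (p (head E e)))))"
      using Vgr_class_eqD[OF _ _ pg[OF v]] phip[OF v] by metis
    note iso' = this
    show ?thesis
    proof (rule edges_of_decomposition[OF fo p(1)[OF v] _ iso'])
      show "grade0_idempotent A (p (head E e))" if "e \<in> out_arcs E v" for e using p(1)[OF h[OF that]] .
      fix x y
      assume "\<And>e. e \<in> out_arcs E v \<Longrightarrow> x e \<in> grade A 1" "\<And>e. e \<in> out_arcs E v \<Longrightarrow> y e \<in> grade A (- 1)"
        "\<And>e. e \<in> out_arcs E v \<Longrightarrow> p v \<otimes> x e = x e" "\<And>e. e \<in> out_arcs E v \<Longrightarrow> x e \<otimes> p (head E e) = x e"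
        "\<And>e. e \<in> out_arcs E v \<Longrightarrow> p (head E e) \<otimes> y e = y e" "\<And>e. e \<in> out_arcs E v \<Longrightarrow> y e \<otimes> p v = y e"
        "\<And>e f. e \<in> out_arcs E v \<Longrightarrow> f \<in> out_arcs E v \<Longrightarrow> y e \<otimes> x f = (if e = f then p (head E e) else \<zero>)"
        "(\<Oplus>e\<in>out_arcs E v. x e \<otimes> y e) = p v"
      then have "Q v x y"
        unfolding Q_def by (intro conjI ballI) (assumption | simp del: in_out_arcs_conv)+
      then show ?thesis by blast
    qed
  qed
  then obtain xx yy where "\<And>v. v \<in> verts E \<Longrightarrow> out_arcs E v \<noteq> {} \<Longrightarrow> Q v (xx v) (yy v)" by metis
  then have XY: "xx v e \<in> grade A 1" "yy v e \<in> grade A (- 1)" "p v \<otimes> xx v e = xx v e" "xx v e \<otimes> p (head E e) = xx v e"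
      "p (head E e) \<otimes> yy v e = yy v e" "yy v e \<otimes> p v = yy v e"
      "f \<in> out_arcs E v \<Longrightarrow> yy v e \<otimes> xx v f = (if e = f then p (head E e) else \<zero>)"
    and sXY: "(\<Oplus>e\<in>out_arcs E v. xx v e \<otimes> yy v e) = p v" if "v \<in> verts E" "e \<in> out_arcs E v" for v e f
    using that unfolding Q_def by blast+
  \<comment> \<open>Every edge leaves exactly one vertex, so the families chosen vertex by vertex
    combine into one.\<close>
  define x where "x = (\<lambda>e. xx (tail E e) e)"
  define y where "y = (\<lambda>e. yy (tail E e) e)"
  have o: "tail E e \<in> verts E" "e \<in> out_arcs E (tail E e)" if "e \<in> arcs E" for e using that by auto
  have xy: "x e \<in> grade A 1" "y e \<in> grade A (- 1)" "p (tail E e) \<otimes> x e = x e" "x e \<otimes> p (head E e) = x e"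
      "p (head E e) \<otimes> y e = y e" "y e \<otimes> p (tail E e) = y e" if "e \<in> arcs E" for e
    using XY[OF o[OF that]] by (simp_all add: x_def y_def)
  have pc: "p v \<in> carrier A" if "v \<in> verts E" for v using p(1)[OF that] idempotent_closed by blast
  have yx: "y e \<otimes> x f = (if e = f then p (head E e) else \<zero>)" if "e \<in> arcs E" "f \<in> arcs E" for e f
  proof (cases "tail E e = tail E f")
    case True
    then show ?thesis using XY[OF o[OF that(1)]] that by (auto simp: x_def y_def)
  next
    case False
    \<comment> \<open>The decompositions at single vertices say nothing about edges with different
      sources. Here the idempotents at the two sources are inserted, and their orthogonality kills
      the product.\<close>
    have "y e \<otimes> x f = (y e \<otimes> p (tail E e)) \<otimes> (p (tail E f) \<otimes> x f)" using xy that by simp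
    also have "... = y e \<otimes> (p (tail E e) \<otimes> p (tail E f)) \<otimes> x f"
    proof -
      have "y e \<in> carrier A" "x f \<in> carrier A" using grade_closed[OF xy(1)[OF that(2)]] grade_closed[OF xy(2)[OF that(1)]] by auto
      then show ?thesis using pc[OF o(1)[OF that(1)]] pc[OF o(1)[OF that(2)]] by (simp add: m_assoc)
    qed
    also have "... = \<zero>"
      using p(2)[OF o(1)[OF that(1)] o(1)[OF that(2)] False] grade_closed[OF xy(1)[OF that(2)]]
        grade_closed[OF xy(2)[OF that(1)]] by simp
    finally show ?thesis using False by auto
  qed
  have sxy: "(\<Oplus>e\<in>out_arcs E v. x e \<otimes> y e) = p v" if "v \<in> verts E" "out_arcs E v \<noteq> {}" for v
  proof -
    have "(\<Oplus>e\<in>out_arcs E v. x e \<otimes> y e) = (\<Oplus>e\<in>out_arcs E v. xx v e \<otimes> yy v e)"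
    proof (rule finsum_cong')
      show "(\<lambda>e. xx v e \<otimes> yy v e) \<in> out_arcs E v \<rightarrow> carrier A"
        by (intro Pi_I m_closed) (use XY(1,2)[OF that(1)] grade_closed in blast)+
    qed (auto simp: x_def y_def)
    moreover obtain e where "e \<in> out_arcs E v" using \<open>out_arcs E v \<noteq> {}\<close> by blast
    ultimately show ?thesis using sXY[OF \<open>v \<in> verts E\<close>] by metis
  qed
  have "leavitt_family A E p x y"
    by (rule leavitt_family.intro[OF graded_ring_axioms E leavitt_family_axioms.intro])
      (use p xy yx sxy in blast)+
  then show thesis using that phip by blast
qed

end

section \<open>Extension of scalars of a sum of left ideals\<close>

text \<open>\<open>Vgr_map\<close> runs over all representatives of a class. The tensor product is
  therefore computed for an arbitrary \<open>P\<close> that is isomorphic, through mutually inverse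
  \<open>h\<close> and \<open>k\<close>, to a sum of shifted left ideals, and not just for that
  sum.\<close>

locale scalar_extension = R: graded_ring R + S: graded_ring S
  for R :: "('k, 'r) gmodule" and S :: "('k, 's) gmodule" +
  fixes \<psi> :: "'r \<Rightarrow> 's" and P :: "('r, 'p) gmodule" and I :: "'i set" and p :: "'i \<Rightarrow> 'r" and d :: "'i \<Rightarrow> int"
    and h :: "'p \<Rightarrow> 'i \<Rightarrow> 'r" and k :: "('i \<Rightarrow> 'r) \<Rightarrow> 'p"
  assumes psi: "\<psi> \<in> ring_hom R S" and psi_grade: "r \<in> grade R n \<Longrightarrow> \<psi> r \<in> grade S n"
    and P: "graded_module R P" and fin: "finite I" and p: "j \<in> I \<Longrightarrow> grade0_idempotent R (p j)"
    and h: "h \<in> graded_module_hom R P (graded_sum I (\<lambda>j. shift (d j) (principal_left_ideal R (p j))))"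
    and k: "k \<in> graded_module_hom R (graded_sum I (\<lambda>j. shift (d j) (principal_left_ideal R (p j)))) P"
    and kh: "m \<in> carrier P \<Longrightarrow> k (h m) = m"
    and hk: "f \<in> carrier (graded_sum I (\<lambda>j. shift (d j) (principal_left_ideal R (p j)))) \<Longrightarrow> h (k f) = f"
begin

abbreviation "RP j \<equiv> shift (d j) (principal_left_ideal R (p j))"
abbreviation "SP j \<equiv> shift (d j) (principal_left_ideal S (\<psi> (p j)))"
abbreviation "DR \<equiv> graded_sum I RP"
abbreviation "DS \<equiv> graded_sum I SP"

lemma psi_closed: "r \<in> carrier R \<Longrightarrow> \<psi> r \<in> carrier S"
  and psi_add: "r \<in> carrier R \<Longrightarrow> r' \<in> carrier R \<Longrightarrow> \<psi> (r \<oplus>\<^bsub>R\<^esub> r') = \<psi> r \<oplus>\<^bsub>S\<^esub> \<psi> r'"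
  and psi_mult: "r \<in> carrier R \<Longrightarrow> r' \<in> carrier R \<Longrightarrow> \<psi> (r \<otimes>\<^bsub>R\<^esub> r') = \<psi> r \<otimes>\<^bsub>S\<^esub> \<psi> r'"
  using psi by (auto simp: ring_hom_def)

lemma psi_zero: "\<psi> \<zero>\<^bsub>R\<^esub> = \<zero>\<^bsub>S\<^esub>"
  by (rule additive_zero[OF R.abelian_group_axioms S.abelian_group_axioms]) (use psi_closed psi_add in auto)

lemma pR: "p j \<in> carrier R" "p j \<in> grade R 0" "p j \<otimes>\<^bsub>R\<^esub> p j = p j" if "j \<in> I"
  using p[OF that] R.grade_closed by (auto simp: grade0_idempotent_def)

lemma psi_p: "j \<in> I \<Longrightarrow> grade0_idempotent S (\<psi> (p j))"
  using pR psi_grade psi_mult by (metis grade0_idempotent_def)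

lemma RP_simps:
  assumes "j \<in> I"
  shows "carrier (RP j) = {x \<in> carrier R. x \<otimes>\<^bsub>R\<^esub> p j = x}" "grade (RP j) n = {x \<in> grade R (d j + n). x \<otimes>\<^bsub>R\<^esub> p j = x}"
  using R.left_ideal_simps(4,5)[OF p[OF assms]] by simp_all

lemma SP_simps:
  assumes "j \<in> I"
  shows "carrier (SP j) = {x \<in> carrier S. x \<otimes>\<^bsub>S\<^esub> \<psi> (p j) = x}" "grade (SP j) n = {x \<in> grade S (d j + n). x \<otimes>\<^bsub>S\<^esub> \<psi> (p j) = x}"
  using S.left_ideal_simps(4,5)[OF psi_p[OF assms]] by simp_all

lemmas [simp] = R.left_ideal_simps(1-3) S.left_ideal_simps(1-3)

lemma RP_ops: "\<zero>\<^bsub>RP j\<^esub> = \<zero>\<^bsub>R\<^esub>" "x \<oplus>\<^bsub>RP j\<^esub> y = x \<oplus>\<^bsub>R\<^esub> y" "x \<odot>\<^bsub>RP j\<^esub> y = x \<otimes>\<^bsub>R\<^esub> y"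
  and SP_ops: "\<zero>\<^bsub>SP j\<^esub> = \<zero>\<^bsub>S\<^esub>" "u \<oplus>\<^bsub>SP j\<^esub> v = u \<oplus>\<^bsub>S\<^esub> v" "u \<odot>\<^bsub>SP j\<^esub> v = u \<otimes>\<^bsub>S\<^esub> v"
  by (simp_all add: R.left_ideal_simps(1-3) S.left_ideal_simps(1-3))

lemma RP_graded: "j \<in> I \<Longrightarrow> graded_module R (RP j)" and SP_graded: "j \<in> I \<Longrightarrow> graded_module S (SP j)"
  using p psi_p by (auto intro!: shift_graded R.principal_left_ideal_graded S.principal_left_ideal_graded)

lemma DS_graded: "graded_module S DS"
  by (rule graded_sum_graded_module[OF S.ring_axioms fin SP_graded])

sublocale DS: graded_group DS using graded_moduleD(1)[OF DS_graded] .
sublocale PG: graded_group P using graded_moduleD(1)[OF P] .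

section \<open>The subgroup generated by the tensor relations\<close>

abbreviation "F \<equiv> free_Abelian_group (carrier S \<times> carrier P)"
definition "N = generate F (tensor_relations R S \<psi> P)"
abbreviation "T \<equiv> F Mod N"

lemma psmult: "r \<in> carrier R \<Longrightarrow> m \<in> carrier P \<Longrightarrow> r \<odot>\<^bsub>P\<^esub> m \<in> carrier P"
  using left_module.smult_closed[OF graded_moduleD(2)[OF P]] .

lemma F_minus: "a \<in> carrier F \<Longrightarrow> - a \<in> carrier F" and F_add: "a \<in> carrier F \<Longrightarrow> b \<in> carrier F \<Longrightarrow> a + b \<in> carrier F"
  using group.inv_closed[OF group_free_Abelian_group[of "carrier S \<times> carrier P"], of a] 
    monoid.m_closed[OF group.is_monoid[OF group_free_Abelian_group[of "carrier S \<times> carrier P"]], of a b] by auto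

lemma F_diff: "a \<in> carrier F \<Longrightarrow> b \<in> carrier F \<Longrightarrow> a - b \<in> carrier F"
  using F_add[OF _ F_minus] by fastforce

lemma frag_closed: "s \<in> carrier S \<Longrightarrow> m \<in> carrier P \<Longrightarrow> frag_of (s, m) \<in> carrier F"
  by simp

lemma relation_cases:
  assumes "x \<in> tensor_relations R S \<psi> P"
  obtains (a) s s' m where "s \<in> carrier S" "s' \<in> carrier S" "m \<in> carrier P"
      "x = frag_of (s \<oplus>\<^bsub>S\<^esub> s', m) - frag_of (s, m) - frag_of (s', m)"
    | (b) s m m' where "s \<in> carrier S" "m \<in> carrier P" "m' \<in> carrier P"
      "x = frag_of (s, m \<oplus>\<^bsub>P\<^esub> m') - frag_of (s, m) - frag_of (s, m')"
    | (c) s r m where "s \<in> carrier S" "r \<in> carrier R" "m \<in> carrier P"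
      "x = frag_of (s \<otimes>\<^bsub>S\<^esub> \<psi> r, m) - frag_of (s, r \<odot>\<^bsub>P\<^esub> m)"
  using assms unfolding tensor_relations_def
  by (elim UnE CollectE exE conjE)
    (rule a[rotated 3] b[rotated 3] c[rotated 3], assumption, assumption, assumption, assumption)+

lemma relations_closed: "tensor_relations R S \<psi> P \<subseteq> carrier F"
proof
  fix x assume "x \<in> tensor_relations R S \<psi> P"
  then show "x \<in> carrier F"
  proof (cases rule: relation_cases)
    case a
    then show ?thesis by (simp only: F_diff frag_closed S.add.m_closed)
  next
    case b
    then show ?thesis by (simp only: F_diff frag_closed PG.add.m_closed)
  next
    case c
    then show ?thesis by (simp only: F_diff frag_closed S.m_closed psi_closed psmult)
  qed
qed

lemma N_subgroup: "subgroup N F"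
  unfolding N_def by (rule group.generate_is_subgroup[OF group_free_Abelian_group relations_closed])

lemma N_normal: "N \<lhd> F"
  by (rule comm_group.subgroup_imp_normal[OF abelian_free_Abelian_group N_subgroup])

sublocale T: group T
  by (rule normal.factorgroup_is_group[OF N_normal])

lemma N_zero: "0 \<in> N"
  using subgroup.one_closed[OF N_subgroup] by simp

lemma N_add: "a \<in> N \<Longrightarrow> b \<in> N \<Longrightarrow> a + b \<in> N"
  using subgroup.m_closed[OF N_subgroup] by simp

lemma N_keys: "a \<in> N \<Longrightarrow> Poly_Mapping.keys a \<subseteq> carrier S \<times> carrier P"
  by (drule subsetD[OF subgroup.subset[OF N_subgroup]]) (simp only: carrier_free_Abelian_group_iff)

lemma N_minus: "a \<in> N \<Longrightarrow> - a \<in> N"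
  using subgroup.m_inv_closed[OF N_subgroup] inv_free_Abelian_group[OF N_keys] by metis

lemma N_diff: "a \<in> N \<Longrightarrow> b \<in> N \<Longrightarrow> a - b \<in> N"
  using N_add[OF _ N_minus] by fastforce

lemma N_rel: "x \<in> tensor_relations R S \<psi> P \<Longrightarrow> x \<in> N"
  unfolding N_def by (rule generate.incl)

lemma N_add_left: "s \<in> carrier S \<Longrightarrow> s' \<in> carrier S \<Longrightarrow> m \<in> carrier P \<Longrightarrow>
    frag_of (s \<oplus>\<^bsub>S\<^esub> s', m) - frag_of (s, m) - frag_of (s', m) \<in> N"
  and N_add_right: "s \<in> carrier S \<Longrightarrow> m \<in> carrier P \<Longrightarrow> m' \<in> carrier P \<Longrightarrow>
    frag_of (s, m \<oplus>\<^bsub>P\<^esub> m') - frag_of (s, m) - frag_of (s, m') \<in> N"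
  and N_smult: "s \<in> carrier S \<Longrightarrow> r \<in> carrier R \<Longrightarrow> m \<in> carrier P \<Longrightarrow>
    frag_of (s \<otimes>\<^bsub>S\<^esub> \<psi> r, m) - frag_of (s, r \<odot>\<^bsub>P\<^esub> m) \<in> N"
  by (rule N_rel, unfold tensor_relations_def, blast)+

lemma coset_eqI:
  assumes "a \<in> carrier F" "b \<in> carrier F" "a - b \<in> N"
  shows "N #>\<^bsub>F\<^esub> a = N #>\<^bsub>F\<^esub> b"
proof -
  have "b \<otimes>\<^bsub>F\<^esub> inv\<^bsub>F\<^esub> a \<in> N" using assms N_minus[OF assms(3)] by simp
  then have "b \<in> N #>\<^bsub>F\<^esub> a"
    by (rule subgroup.rcos_module_rev[OF N_subgroup group_free_Abelian_group assms(1,2)])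
  then show ?thesis by (rule group.repr_independence[OF group_free_Abelian_group _ assms(1) N_subgroup])
qed

lemma coset_add:
  assumes "a \<in> carrier F" "b \<in> carrier F"
  shows "(N #>\<^bsub>F\<^esub> a) \<otimes>\<^bsub>T\<^esub> (N #>\<^bsub>F\<^esub> b) = N #>\<^bsub>F\<^esub> (a + b)"
  using normal.rcos_sum[OF N_normal assms] by (simp add: FactGroup_def)

lemma T_carrierE:
  assumes "U \<in> carrier T"
  obtains a where "a \<in> carrier F" "U = N #>\<^bsub>F\<^esub> a"
  using assms unfolding FactGroup_def RCOSETS_def by auto

lemma coset_closed: "a \<in> carrier F \<Longrightarrow> N #>\<^bsub>F\<^esub> a \<in> carrier T"
  unfolding FactGroup_def RCOSETS_def by auto

section \<open>The additive map induced by a balanced map on pairs\<close>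

definition "u0 = (\<lambda>(s, m). \<lambda>j\<in>I. s \<otimes>\<^bsub>S\<^esub> \<psi> (h m j))"

lemma hR:
  assumes "m \<in> carrier P" "j \<in> I"
  shows "h m j \<in> carrier R" "h m j \<otimes>\<^bsub>R\<^esub> p j = h m j"
proof -
  have "h m j \<in> carrier (RP j)" using graded_hom_closed[OF h assms(1)] assms(2) by auto
  then show "h m j \<in> carrier R" "h m j \<otimes>\<^bsub>R\<^esub> p j = h m j" unfolding RP_simps[OF assms(2)] by auto
qed

lemma u0_closed:
  assumes "s \<in> carrier S" "m \<in> carrier P"
  shows "u0 (s, m) \<in> carrier DS"
proof -
  have "s \<otimes>\<^bsub>S\<^esub> \<psi> (h m j) \<in> carrier (SP j)" if j: "j \<in> I" for j
  proof -
    have "\<psi> (h m j) \<otimes>\<^bsub>S\<^esub> \<psi> (p j) = \<psi> (h m j)" using psi_mult hR[OF assms(2) j] pR[OF j] by metis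
    then show ?thesis unfolding SP_simps[OF j] using assms(1) psi_closed hR[OF assms(2) j] pR[OF j] by (simp add: S.m_assoc)
  qed
  then show ?thesis by (simp add: u0_def)
qed

lemma DS_add: "f \<oplus>\<^bsub>DS\<^esub> g = (\<lambda>j\<in>I. f j \<oplus>\<^bsub>S\<^esub> g j)" and DS_smult: "a \<odot>\<^bsub>DS\<^esub> f = (\<lambda>j\<in>I. a \<otimes>\<^bsub>S\<^esub> f j)"
  by (simp_all add: SP_ops)

lemma h_add: "m \<in> carrier P \<Longrightarrow> m' \<in> carrier P \<Longrightarrow> j \<in> I \<Longrightarrow> h (m \<oplus>\<^bsub>P\<^esub> m') j = h m j \<oplus>\<^bsub>R\<^esub> h m' j"
  using graded_hom_add[OF h] by (simp add: RP_ops)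

lemma h_smult: "r \<in> carrier R \<Longrightarrow> m \<in> carrier P \<Longrightarrow> j \<in> I \<Longrightarrow> h (r \<odot>\<^bsub>P\<^esub> m) j = r \<otimes>\<^bsub>R\<^esub> h m j"
  using graded_hom_smult[OF h] by (simp add: RP_ops)

text \<open>The universal property of the free abelian group is an existence statement, hence the
  \<open>SOME\<close>. Only the values on \<open>F\<close> matter.\<close>

definition u where "u = (SOME u. u \<in> hom F (add_monoid DS) \<and> (\<forall>x\<in>carrier S \<times> carrier P. u (frag_of x) = u0 x))"

lemma u_spec: "u \<in> hom F (add_monoid DS)" "x \<in> carrier S \<times> carrier P \<Longrightarrow> u (frag_of x) = u0 x"
proof -
  have "u0 ` (carrier S \<times> carrier P) \<subseteq> carrier (add_monoid DS)" using u0_closed by force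
  then have "\<exists>v. v \<in> hom F (add_monoid DS) \<and> (\<forall>x\<in>carrier S \<times> carrier P. v (frag_of x) = u0 x)"
    by (rule comm_group.free_Abelian_group_universal[OF DS.a_comm_group]) blast
  then have "u \<in> hom F (add_monoid DS) \<and> (\<forall>x\<in>carrier S \<times> carrier P. u (frag_of x) = u0 x)"
    unfolding u_def by (rule someI_ex)
  then show "u \<in> hom F (add_monoid DS)" "x \<in> carrier S \<times> carrier P \<Longrightarrow> u (frag_of x) = u0 x" by auto
qed

lemma u_of: "s \<in> carrier S \<Longrightarrow> m \<in> carrier P \<Longrightarrow> u (frag_of (s, m)) = u0 (s, m)"
  using u_spec(2) by auto

lemma u_closed: "a \<in> carrier F \<Longrightarrow> u a \<in> carrier DS"
  using u_spec(1) unfolding hom_def by auto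

lemma u_add: "a \<in> carrier F \<Longrightarrow> b \<in> carrier F \<Longrightarrow> u (a + b) = u a \<oplus>\<^bsub>DS\<^esub> u b"
  using u_spec(1) unfolding hom_def by auto

lemma u_group_hom: "group_hom F (add_monoid DS) u"
  using u_spec(1) DS.a_group by (simp add: group_hom_def group_hom_axioms_def)

lemma u_zero: "u 0 = \<zero>\<^bsub>DS\<^esub>"
  using group_hom.hom_one[OF u_group_hom] by (simp del: graded_sum_simps)

lemma u_minus: "a \<in> carrier F \<Longrightarrow> u (- a) = \<ominus>\<^bsub>DS\<^esub> u a"
  using group_hom.hom_inv[OF u_group_hom, of a] by (simp del: graded_sum_simps add: a_inv_def)

lemma u_diff: "a \<in> carrier F \<Longrightarrow> b \<in> carrier F \<Longrightarrow> u (a - b) = u a \<ominus>\<^bsub>DS\<^esub> u b"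
  using u_add[OF _ F_minus, of a b] u_minus[of b] by (simp del: graded_sum_simps carrier_free_Abelian_group_iff add: a_minus_def)

lemma u_relations: "x \<in> tensor_relations R S \<psi> P \<Longrightarrow> u x = \<zero>\<^bsub>DS\<^esub>"
proof -
  assume "x \<in> tensor_relations R S \<psi> P"
  then show ?thesis
  proof (cases rule: relation_cases)
    case (a s s' m)
    have e: "u0 (s \<oplus>\<^bsub>S\<^esub> s', m) = u0 (s, m) \<oplus>\<^bsub>DS\<^esub> u0 (s', m)"
      unfolding DS_add using a psi_closed hR[OF a(3)] by (auto simp: u0_def S.l_distr intro!: restrict_ext)
    have "u x = (u0 (s, m) \<oplus>\<^bsub>DS\<^esub> u0 (s', m)) \<ominus>\<^bsub>DS\<^esub> u0 (s, m) \<ominus>\<^bsub>DS\<^esub> u0 (s', m)"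
      unfolding a(4) using a(1-3)
      by (simp only: u_diff F_diff frag_closed S.add.m_closed u_of e)
    then show ?thesis using u0_closed[OF a(1,3)] u0_closed[OF a(2,3)]
      by (simp del: graded_sum_simps add: a_minus_def DS.a_ac DS.r_neg1 DS.r_neg)
  next
    case (b s m m')
    have e: "u0 (s, m \<oplus>\<^bsub>P\<^esub> m') = u0 (s, m) \<oplus>\<^bsub>DS\<^esub> u0 (s, m')"
      unfolding DS_add using b psi_closed hR[OF b(2)] hR[OF b(3)]
      by (auto simp: u0_def h_add psi_add S.r_distr intro!: restrict_ext)
    have "u x = (u0 (s, m) \<oplus>\<^bsub>DS\<^esub> u0 (s, m')) \<ominus>\<^bsub>DS\<^esub> u0 (s, m) \<ominus>\<^bsub>DS\<^esub> u0 (s, m')"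
      unfolding b(4) using b(1-3)
      by (simp only: u_diff F_diff frag_closed PG.add.m_closed u_of e)
    then show ?thesis using u0_closed[OF b(1,2)] u0_closed[OF b(1,3)]
      by (simp del: graded_sum_simps add: a_minus_def DS.a_ac DS.r_neg1 DS.r_neg)
  next
    case (c s r m)
    have e: "u0 (s \<otimes>\<^bsub>S\<^esub> \<psi> r, m) = u0 (s, r \<odot>\<^bsub>P\<^esub> m)"
      using c psi_closed hR[OF c(3)] by (auto simp: u0_def h_smult psi_mult S.m_assoc intro!: restrict_ext)
    have "u x = u0 (s, r \<odot>\<^bsub>P\<^esub> m) \<ominus>\<^bsub>DS\<^esub> u0 (s, r \<odot>\<^bsub>P\<^esub> m)"
      unfolding c(4) using c(1-3) by (simp only: u_diff frag_closed S.m_closed psi_closed psmult u_of e)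
    then show ?thesis using u0_closed[OF c(1) psmult[OF c(2,3)]]
      by (simp del: graded_sum_simps add: a_minus_def DS.r_neg)
  qed
qed

lemma u_N: "x \<in> N \<Longrightarrow> u x = \<zero>\<^bsub>DS\<^esub>"
proof -
  assume x: "x \<in> N"
  have "tensor_relations R S \<psi> P \<subseteq> kernel F (add_monoid DS) u"
    using u_relations relations_closed by (auto simp: kernel_def simp del: graded_sum_simps carrier_free_Abelian_group_iff)
  then have "N \<subseteq> kernel F (add_monoid DS) u"
    unfolding N_def by (rule group.generate_subgroup_incl[OF group_free_Abelian_group _ group_hom.subgroup_kernel[OF u_group_hom]])
  then show ?thesis using x by (auto simp: kernel_def simp del: graded_sum_simps)
qed

text \<open>The generator of the summand \<open>j\<close>, transported to \<open>P\<close>. As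
  \<open>p j\<close> has degree 0 before the shift, \<open>b j\<close> has degree
  \<open>- d j\<close>.\<close>

definition "b j = k (single I RP j (p j))"

lemma p_RP: "j \<in> I \<Longrightarrow> p j \<in> carrier (RP j)" "j \<in> I \<Longrightarrow> p j \<in> grade (RP j) (- d j)"
  by (simp_all only: RP_simps pR mem_Collect_eq add.right_inverse)

lemma single_p: "j \<in> I \<Longrightarrow> single I RP j (p j) \<in> carrier DR"
  by (rule single_closed[of I R RP, OF RP_graded p_RP(1)])

lemma b_closed: "j \<in> I \<Longrightarrow> b j \<in> carrier P"
  unfolding b_def by (rule graded_hom_closed[OF k single_p])

lemma b_grade: "j \<in> I \<Longrightarrow> b j \<in> grade P (- d j)"
  unfolding b_def
  by (rule graded_hom_grade[OF k single_grade[of I R RP, OF RP_graded p_RP(2)]])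

lemma h_b: "j \<in> I \<Longrightarrow> h (b j) = single I RP j (p j)"
  unfolding b_def by (rule hk[OF single_p])

text \<open>\<open>h m\<close> is the sum of its parts in the summands, and \<open>k\<close> sends
  the part in the summand \<open>j\<close> to the multiple of \<open>b j\<close> by
  \<open>h m j\<close>.\<close>

lemma P_expansion:
  assumes m: "m \<in> carrier P"
  shows "m = (\<Oplus>\<^bsub>P\<^esub> j\<in>I. h m j \<odot>\<^bsub>P\<^esub> b j)"
proof -
  have hm: "h m \<in> carrier DR" by (rule graded_hom_closed[OF h m])
  have DR: "graded_module R DR" by (rule graded_sum_graded_module[OF R.ring_axioms fin RP_graded])
  have hj: "h m j \<in> carrier (RP j)" if "j \<in> I" for j using hm that by auto
  have sc: "single I RP j (h m j) \<in> carrier DR" if "j \<in> I" for j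
    by (rule single_closed[of I R RP, OF RP_graded hj[OF that]])
  have e: "k (single I RP j (h m j)) = h m j \<odot>\<^bsub>P\<^esub> b j" if j: "j \<in> I" for j
  proof -
    have "single I RP j (h m j) = single I RP j (h m j \<odot>\<^bsub>RP j\<^esub> p j)" using hR[OF m j] by (simp add: RP_ops)
    also have "... = h m j \<odot>\<^bsub>DR\<^esub> single I RP j (p j)"
      by (rule single_smult[of I R RP, OF RP_graded hR(1)[OF m j], symmetric])
    finally show ?thesis unfolding b_def using graded_hom_smult[OF k hR(1)[OF m j] single_p[OF j]] by simp
  qed
  have "m = k (\<Oplus>\<^bsub>DR\<^esub> j\<in>I. single I RP j (h m j))"
    using single_sum[of I R RP, OF RP_graded fin hm] kh[OF m] by simp
  also have "... = (\<Oplus>\<^bsub>P\<^esub> j\<in>I. k (single I RP j (h m j)))"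
  proof (rule finsum_additive[where h = k])
    show "abelian_monoid DR" using graded_moduleD(4)[OF DR] by (rule abelian_group.axioms(1))
    show "k \<zero>\<^bsub>DR\<^esub> = \<zero>\<^bsub>P\<^esub>" by (rule graded_hom_zero[OF k graded_moduleD(4)[OF DR] PG.abelian_group_axioms])
    show "k \<in> carrier DR \<rightarrow> carrier P" using graded_hom_closed[OF k] by blast
  qed (use sc fin PG.abelian_monoid_axioms graded_hom_add[OF k] in blast)+
  also have "... = (\<Oplus>\<^bsub>P\<^esub> j\<in>I. h m j \<odot>\<^bsub>P\<^esub> b j)"
    by (rule PG.finsum_cong') (use e hR[OF m] b_closed psmult in auto)
  finally show ?thesis .
qed

text \<open>Modulo \<open>N\<close>, if \<open>m = \<Sum> r\<^sub>j b\<^sub>j\<close> then \<open>s \<otimes> m = \<Sum> s \<psi>(r\<^sub>j) \<otimes> b\<^sub>j\<close>. So \<open>w\<close> is an inverse of \<open>u\<close>.\<close>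

definition "w f = (\<Sum>j\<in>I. frag_of (f j, b j))" for f :: "'i \<Rightarrow> 's"

lemma DS_mem: "f \<in> carrier DS \<Longrightarrow> j \<in> I \<Longrightarrow> f j \<in> carrier S" "f \<in> carrier DS \<Longrightarrow> j \<in> I \<Longrightarrow> f j \<otimes>\<^bsub>S\<^esub> \<psi> (p j) = f j"
proof -
  assume "f \<in> carrier DS" "j \<in> I"
  then have "f j \<in> carrier (SP j)" by auto
  then show "f j \<in> carrier S" "f j \<otimes>\<^bsub>S\<^esub> \<psi> (p j) = f j" unfolding SP_simps[OF \<open>j \<in> I\<close>] by auto
qed

lemma w_closed: "f \<in> carrier DS \<Longrightarrow> w f \<in> carrier F"
  unfolding w_def by (rule sum_closed_free_Abelian_group) (blast intro: frag_closed DS_mem(1) b_closed)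

lemma N_sum: "finite J \<Longrightarrow> (\<And>j. j \<in> J \<Longrightarrow> f j \<in> N) \<Longrightarrow> sum f J \<in> N"
  by (induction J rule: finite_induct) (auto simp: N_zero N_add)

lemma w_add:
  assumes "f \<in> carrier DS" "g \<in> carrier DS"
  shows "w (f \<oplus>\<^bsub>DS\<^esub> g) - w f - w g \<in> N"
proof -
  have "w (f \<oplus>\<^bsub>DS\<^esub> g) - w f - w g = (\<Sum>j\<in>I. frag_of (f j \<oplus>\<^bsub>S\<^esub> g j, b j) - frag_of (f j, b j) - frag_of (g j, b j))"
    unfolding w_def DS_add by (simp add: sum_subtractf)
  also have "... \<in> N"
    by (rule N_sum[OF fin]) (use N_add_left DS_mem(1) assms b_closed in blast)
  finally show ?thesis .
qed

lemma frag_zero_N: "s \<in> carrier S \<Longrightarrow> frag_of (s, \<zero>\<^bsub>P\<^esub>) \<in> N"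
  using N_minus[OF N_add_right[of s "\<zero>\<^bsub>P\<^esub>" "\<zero>\<^bsub>P\<^esub>"]] by simp

lemma frag_expansion:
  assumes s: "s \<in> carrier S" and r: "\<And>j. j \<in> J \<Longrightarrow> r j \<in> carrier R" and J: "finite J" "J \<subseteq> I"
  shows "frag_of (s, \<Oplus>\<^bsub>P\<^esub> j\<in>J. r j \<odot>\<^bsub>P\<^esub> b j) - (\<Sum>j\<in>J. frag_of (s \<otimes>\<^bsub>S\<^esub> \<psi> (r j), b j)) \<in> N"
  using J r
proof (induction J rule: finite_induct)
  case empty
  then show ?case using frag_zero_N[OF s] by simp
next
  case (insert i J)
  let ?M = "\<Oplus>\<^bsub>P\<^esub> j\<in>J. r j \<odot>\<^bsub>P\<^esub> b j" and ?Q = "\<Sum>j\<in>J. frag_of (s \<otimes>\<^bsub>S\<^esub> \<psi> (r j), b j)"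
  have i: "r i \<in> carrier R" "b i \<in> carrier P" "r i \<odot>\<^bsub>P\<^esub> b i \<in> carrier P"
    using insert b_closed psmult by auto
  have J: "(\<lambda>j. r j \<odot>\<^bsub>P\<^esub> b j) \<in> J \<rightarrow> carrier P" using insert b_closed psmult by auto
  then have M: "?M \<in> carrier P" by (rule PG.finsum_closed)
  \<comment> \<open>Split into a relation of additivity in \<open>P\<close>, a balancing relation
    and the difference covered by the induction hypothesis. All three lie in
    \<open>N\<close>.\<close>
  have "frag_of (s, r i \<odot>\<^bsub>P\<^esub> b i \<oplus>\<^bsub>P\<^esub> ?M) - (frag_of (s \<otimes>\<^bsub>S\<^esub> \<psi> (r i), b i) + ?Q)
      = (frag_of (s, r i \<odot>\<^bsub>P\<^esub> b i \<oplus>\<^bsub>P\<^esub> ?M) - frag_of (s, r i \<odot>\<^bsub>P\<^esub> b i) - frag_of (s, ?M))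
        - (frag_of (s \<otimes>\<^bsub>S\<^esub> \<psi> (r i), b i) - frag_of (s, r i \<odot>\<^bsub>P\<^esub> b i)) + (frag_of (s, ?M) - ?Q)"
    by simp
  also have "... \<in> N"
    by (rule N_add[OF N_diff[OF N_add_right[OF s i(3) M] N_smult[OF s i(1,2)]] insert.IH])
      (use insert.prems in auto)
  finally show ?case using insert J i by simp
qed

lemma w_u:
  assumes "a \<in> carrier F"
  shows "a - w (u a) \<in> N"
proof -
  \<comment> \<open>\<open>w\<close> of zero is a sum of symbols with first entry zero, which
    vanishes only modulo \<open>N\<close>; \<open>w_add\<close> for zero plus zero shows
    this.\<close>
  have zz: "w \<zero>\<^bsub>DS\<^esub> \<in> N"
    using N_minus[OF w_add[of "\<zero>\<^bsub>DS\<^esub>" "\<zero>\<^bsub>DS\<^esub>"]] DS.zero_closed DS.l_zero[OF DS.zero_closed] by (simp del: graded_sum_simps)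
  show ?thesis
  proof (rule free_Abelian_group_induct[where P = "\<lambda>a. a - w (u a) \<in> N" and S = "carrier S \<times> carrier P"])
    show "Poly_Mapping.keys a \<subseteq> carrier S \<times> carrier P" using assms by simp
    show "0 - w (u 0) \<in> N" unfolding u_zero using N_minus[OF zz] by simp
  next
    fix a c assume *: "Poly_Mapping.keys a \<subseteq> carrier S \<times> carrier P" "Poly_Mapping.keys c \<subseteq> carrier S \<times> carrier P"
      "a - w (u a) \<in> N" "c - w (u c) \<in> N"
    have ac: "a \<in> carrier F" "c \<in> carrier F" using * by auto
    have uac: "u (a - c) \<in> carrier DS" by (rule u_closed[OF F_diff[OF ac]])
    \<comment> \<open>The induction rule works with differences but \<open>w_add\<close> with sums,
      so \<open>a\<close> is regarded as the sum of \<open>a - c\<close> and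
      \<open>c\<close>.\<close>
    have "u (a - c) \<oplus>\<^bsub>DS\<^esub> u c = u a" using u_add[OF F_diff[OF ac] ac(2)] by simp
    then have "w (u a) - w (u (a - c)) - w (u c) \<in> N" using w_add[OF uac u_closed[OF ac(2)]] by simp
    then have "(a - w (u a)) - (c - w (u c)) + (w (u a) - w (u (a - c)) - w (u c)) \<in> N"
      by (rule N_add[OF N_diff[OF *(3,4)]])
    then show "a - c - w (u (a - c)) \<in> N" by (simp add: algebra_simps)
  next
    fix x assume "x \<in> carrier S \<times> carrier P"
    then obtain s m where x: "x = (s, m)" and s: "s \<in> carrier S" and m: "m \<in> carrier P" by auto
    have "w (u (frag_of x)) = (\<Sum>j\<in>I. frag_of (s \<otimes>\<^bsub>S\<^esub> \<psi> (h m j), b j))"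
      unfolding x u_of[OF s m] w_def u0_def by simp
    moreover have "frag_of (s, \<Oplus>\<^bsub>P\<^esub> j\<in>I. h m j \<odot>\<^bsub>P\<^esub> b j) - (\<Sum>j\<in>I. frag_of (s \<otimes>\<^bsub>S\<^esub> \<psi> (h m j), b j)) \<in> N"
      by (rule frag_expansion[OF s hR(1)[OF m] fin subset_refl])
    ultimately show "frag_of x - w (u (frag_of x)) \<in> N"
      unfolding P_expansion[OF m, symmetric] x by simp
  qed
qed

lemma u_w:
  assumes f: "f \<in> carrier DS"
  shows "u (w f) = f"
proof -
  have fr: "frag_of (f j, b j) \<in> carrier F" if "j \<in> I" for j
    using frag_closed[OF DS_mem(1)[OF f that] b_closed[OF that]] .
  have fj: "f j \<in> carrier (SP j)" if "j \<in> I" for j using f that by auto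
  have "finite J \<Longrightarrow> J \<subseteq> I \<Longrightarrow> u (\<Sum>j\<in>J. frag_of (f j, b j)) = (\<Oplus>\<^bsub>DS\<^esub> j\<in>J. single I SP j (f j))" for J
  proof (induction J rule: finite_induct)
    case empty
    then show ?case using u_zero by (simp del: graded_sum_simps)
  next
    case (insert i J)
    have i: "i \<in> I" using insert by auto
    have sc: "single I SP j (f j) \<in> carrier DS" if "j \<in> I" for j
      by (rule single_closed[of I S SP, OF SP_graded fj[OF that]])
    have "u (frag_of (f i, b i)) = single I SP i (f i)"
    proof -
      \<comment> \<open>\<open>h\<close> sends \<open>b i\<close> to the tuple with the single entry
        \<open>p i\<close>, and \<open>f i\<close> is fixed by right multiplication with
        \<open>\<psi> (p i)\<close>.\<close>
      have "f i \<otimes>\<^bsub>S\<^esub> \<psi> (single I RP i (p i) j) = (if j = i then f i else \<zero>\<^bsub>SP j\<^esub>)" if "j \<in> I" for j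
        using that DS_mem[OF f] psi_zero i by (simp add: single_def RP_ops SP_ops)
      then show ?thesis
        unfolding u_of[OF DS_mem(1)[OF f i] b_closed[OF i]] u0_def by (auto simp: h_b[OF i] single_def intro!: restrict_ext)
    qed
    moreover have "(\<Sum>j\<in>J. frag_of (f j, b j)) \<in> carrier F"
      by (rule sum_closed_free_Abelian_group) (use fr insert in blast)
    ultimately have "u (frag_of (f i, b i) + (\<Sum>j\<in>J. frag_of (f j, b j))) =
        single I SP i (f i) \<oplus>\<^bsub>DS\<^esub> (\<Oplus>\<^bsub>DS\<^esub> j\<in>J. single I SP j (f j))"
      using u_add[OF fr[OF i]] insert by simp
    also have "... = (\<Oplus>\<^bsub>DS\<^esub> j\<in>insert i J. single I SP j (f j))"
      by (rule DS.finsum_insert[symmetric]) (use insert sc i in auto)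
    finally show ?case using insert by simp
  qed
  from this[OF fin subset_refl] show ?thesis
    unfolding w_def using single_sum[of I S SP, OF SP_graded fin f] by simp
qed

section \<open>Scalars and degrees on the tensor product\<close>

abbreviation "ET \<equiv> extension_of_scalars R S \<psi> P"
abbreviation "act a \<equiv> frag_extend (\<lambda>(s, m). frag_of (a \<otimes>\<^bsub>S\<^esub> s, m))"

lemma ET_simps:
  "carrier ET = carrier T" "U \<oplus>\<^bsub>ET\<^esub> V = U \<otimes>\<^bsub>T\<^esub> V"
  "a \<odot>\<^bsub>ET\<^esub> U = (\<Union>x\<in>U. N #>\<^bsub>F\<^esub> act a x)"
  "grade ET n = generate T {N #>\<^bsub>F\<^esub> frag_of (s, m) | s m i j. s \<in> grade S i \<and> m \<in> grade P j \<and> i + j = n}"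
  by (simp_all add: extension_of_scalars_def Let_def N_def)

lemma act_closed: "a \<in> carrier S \<Longrightarrow> x \<in> carrier F \<Longrightarrow> act a x \<in> carrier F"
proof (rule free_Abelian_group_induct[where P = "\<lambda>x. act a x \<in> carrier F" and S = "carrier S \<times> carrier P"])
  fix x y assume "act a x \<in> carrier F" "act a y \<in> carrier F"
  then show "act a (x - y) \<in> carrier F" unfolding frag_extend_diff by (rule F_diff)
qed auto

lemma DS_smult_closed: "a \<in> carrier S \<Longrightarrow> f \<in> carrier DS \<Longrightarrow> a \<odot>\<^bsub>DS\<^esub> f \<in> carrier DS"
  using left_module.smult_closed[OF graded_moduleD(2)[OF DS_graded]] .

lemma DS_smult_diff:
  assumes "a \<in> carrier S" "f \<in> carrier DS" "g \<in> carrier DS"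
  shows "a \<odot>\<^bsub>DS\<^esub> (f \<ominus>\<^bsub>DS\<^esub> g) = a \<odot>\<^bsub>DS\<^esub> f \<ominus>\<^bsub>DS\<^esub> a \<odot>\<^bsub>DS\<^esub> g"
proof -
  have fg: "f \<ominus>\<^bsub>DS\<^esub> g \<in> carrier DS" by (rule DS.minus_closed[OF assms(2,3)])
  have "a \<odot>\<^bsub>DS\<^esub> (f \<ominus>\<^bsub>DS\<^esub> g) \<oplus>\<^bsub>DS\<^esub> a \<odot>\<^bsub>DS\<^esub> g = a \<odot>\<^bsub>DS\<^esub> ((f \<ominus>\<^bsub>DS\<^esub> g) \<oplus>\<^bsub>DS\<^esub> g)"
    by (rule left_module.smult_r_distr[OF graded_moduleD(2)[OF DS_graded] assms(1) fg assms(3), symmetric])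
  also have "(f \<ominus>\<^bsub>DS\<^esub> g) \<oplus>\<^bsub>DS\<^esub> g = f"
    using assms(2,3) by (simp del: graded_sum_simps add: a_minus_def DS.a_assoc DS.l_neg)
  finally have e: "a \<odot>\<^bsub>DS\<^esub> f = a \<odot>\<^bsub>DS\<^esub> (f \<ominus>\<^bsub>DS\<^esub> g) \<oplus>\<^bsub>DS\<^esub> a \<odot>\<^bsub>DS\<^esub> g" by (rule HOL.sym)
  show ?thesis unfolding e
    using DS_smult_closed[OF assms(1) fg] DS_smult_closed[OF assms(1,3)]
    by (simp del: graded_sum_simps add: a_minus_def DS.a_assoc DS.r_neg)
qed

lemma u_act:
  assumes a: "a \<in> carrier S" and "x \<in> carrier F"
  shows "u (act a x) = a \<odot>\<^bsub>DS\<^esub> u x"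
proof (rule free_Abelian_group_induct[where P = "\<lambda>x. u (act a x) = a \<odot>\<^bsub>DS\<^esub> u x" and S = "carrier S \<times> carrier P"])
  show "Poly_Mapping.keys x \<subseteq> carrier S \<times> carrier P" using assms(2) by simp
  show "u (act a 0) = a \<odot>\<^bsub>DS\<^esub> u 0"
    unfolding frag_extend_0 u_zero by (rule left_module_smult_zero[OF graded_moduleD(2)[OF DS_graded] a, symmetric])
next
  fix x y assume *: "Poly_Mapping.keys x \<subseteq> carrier S \<times> carrier P" "Poly_Mapping.keys y \<subseteq> carrier S \<times> carrier P"
    "u (act a x) = a \<odot>\<^bsub>DS\<^esub> u x" "u (act a y) = a \<odot>\<^bsub>DS\<^esub> u y"
  have xy: "x \<in> carrier F" "y \<in> carrier F" using * by auto
  show "u (act a (x - y)) = a \<odot>\<^bsub>DS\<^esub> u (x - y)"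
    unfolding frag_extend_diff u_diff[OF xy] u_diff[OF act_closed[OF a xy(1)] act_closed[OF a xy(2)]] *(3,4)
    by (rule DS_smult_diff[OF a u_closed[OF xy(1)] u_closed[OF xy(2)], symmetric])
next
  fix x assume "x \<in> carrier S \<times> carrier P"
  then obtain s m where x: "x = (s, m)" and s: "s \<in> carrier S" and m: "m \<in> carrier P" by auto
  have "u0 (a \<otimes>\<^bsub>S\<^esub> s, m) = a \<odot>\<^bsub>DS\<^esub> u0 (s, m)"
    unfolding DS_smult using a s psi_closed hR[OF m] by (auto simp: u0_def S.m_assoc intro!: restrict_ext)
  then show "u (act a (frag_of x)) = a \<odot>\<^bsub>DS\<^esub> u (frag_of x)"
    using u_of[OF S.m_closed[OF a s] m] u_of[OF s m] by (simp only: x frag_extend_of prod.case)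
qed

lemma coset_u: "x \<in> carrier F \<Longrightarrow> N #>\<^bsub>F\<^esub> x = N #>\<^bsub>F\<^esub> w (u x)"
  by (rule coset_eqI[OF _ w_closed[OF u_closed] w_u])

lemma u_coset:
  assumes x: "x \<in> carrier F" and y: "y \<in> N #>\<^bsub>F\<^esub> x"
  shows "y \<in> carrier F" "u y = u x"
proof -
  obtain z where z: "z \<in> N" "y = z + x" using y unfolding r_coset_def by auto
  have zF: "z \<in> carrier F" using subsetD[OF subgroup.subset[OF N_subgroup] z(1)] .
  show "y \<in> carrier F" unfolding z(2) by (rule F_add[OF zF x])
  show "u y = u x" unfolding z(2) u_add[OF zF x] u_N[OF z(1)] by (rule DS.l_zero[OF u_closed[OF x]])
qed

text \<open>The scalar action is a union over representatives. They all act into one coset: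
  \<open>u\<close> determines the coset of an element, is constant on cosets and commutes with the
  action. Stability of \<open>N\<close> under scalars thus needs no separate argument.\<close>

lemma ET_smult:
  assumes a: "a \<in> carrier S" and x: "x \<in> carrier F"
  shows "a \<odot>\<^bsub>ET\<^esub> (N #>\<^bsub>F\<^esub> x) = N #>\<^bsub>F\<^esub> w (a \<odot>\<^bsub>DS\<^esub> u x)"
proof -
  have "N #>\<^bsub>F\<^esub> act a y = N #>\<^bsub>F\<^esub> w (a \<odot>\<^bsub>DS\<^esub> u x)" if "y \<in> N #>\<^bsub>F\<^esub> x" for y
    using coset_u[OF act_closed[OF a u_coset(1)[OF x that]]] u_act[OF a u_coset(1)[OF x that]] u_coset(2)[OF x that]
    by simp
  moreover have "x \<in> N #>\<^bsub>F\<^esub> x" by (rule group.rcos_self[OF group_free_Abelian_group x N_subgroup])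
  ultimately show ?thesis unfolding ET_simps(3) by blast
qed

definition "ubar U = u (SOME x. x \<in> U)"

lemma ubar_coset:
  assumes x: "x \<in> carrier F"
  shows "ubar (N #>\<^bsub>F\<^esub> x) = u x"
proof -
  have "(SOME y. y \<in> N #>\<^bsub>F\<^esub> x) \<in> N #>\<^bsub>F\<^esub> x"
    by (rule someI[of _ x]) (rule group.rcos_self[OF group_free_Abelian_group x N_subgroup])
  then show ?thesis unfolding ubar_def using u_coset(2)[OF x] by blast
qed

lemma ubar_add:
  assumes "U \<in> carrier T" "V \<in> carrier T"
  shows "ubar (U \<otimes>\<^bsub>T\<^esub> V) = ubar U \<oplus>\<^bsub>DS\<^esub> ubar V"
proof -
  obtain x where x: "x \<in> carrier F" "U = N #>\<^bsub>F\<^esub> x" using assms(1) by (rule T_carrierE)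
  obtain y where y: "y \<in> carrier F" "V = N #>\<^bsub>F\<^esub> y" using assms(2) by (rule T_carrierE)
  show ?thesis
    unfolding x(2) y(2) coset_add[OF x(1) y(1)] ubar_coset[OF x(1)] ubar_coset[OF y(1)] ubar_coset[OF F_add[OF x(1) y(1)]]
    by (rule u_add[OF x(1) y(1)])
qed

lemma ubar_closed: "U \<in> carrier T \<Longrightarrow> ubar U \<in> carrier DS"
  by (elim T_carrierE) (simp only: ubar_coset u_closed)

lemma ubar_w: "f \<in> carrier DS \<Longrightarrow> ubar (N #>\<^bsub>F\<^esub> w f) = f"
  using ubar_coset[OF w_closed] u_w by simp

lemma w_ubar: "U \<in> carrier T \<Longrightarrow> N #>\<^bsub>F\<^esub> w (ubar U) = U"
  by (elim T_carrierE) (simp only: ubar_coset coset_u[symmetric])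

lemma T_one: "\<one>\<^bsub>T\<^esub> = N #>\<^bsub>F\<^esub> 0"
  using group.coset_join2[OF group_free_Abelian_group _ N_subgroup N_zero] by (simp add: FactGroup_def)

lemma w_hom: "(\<lambda>f. N #>\<^bsub>F\<^esub> w f) \<in> graded_module_hom S DS ET"
proof (rule graded_module_homI)
  fix f g assume f: "f \<in> carrier DS" and g: "g \<in> carrier DS"
  show "N #>\<^bsub>F\<^esub> w f \<in> carrier ET" unfolding ET_simps by (rule coset_closed[OF w_closed[OF f]])
  have "N #>\<^bsub>F\<^esub> w (f \<oplus>\<^bsub>DS\<^esub> g) = N #>\<^bsub>F\<^esub> (w f + w g)"
    by (rule coset_eqI) (use w_closed f g DS.a_closed F_add w_add[OF f g] in \<open>simp_all only: diff_diff_eq\<close>)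
  then show "N #>\<^bsub>F\<^esub> w (f \<oplus>\<^bsub>DS\<^esub> g) = (N #>\<^bsub>F\<^esub> w f) \<oplus>\<^bsub>ET\<^esub> (N #>\<^bsub>F\<^esub> w g)"
    unfolding ET_simps coset_add[OF w_closed[OF f] w_closed[OF g]] .
  fix a assume "a \<in> carrier S"
  then show "N #>\<^bsub>F\<^esub> w (a \<odot>\<^bsub>DS\<^esub> f) = a \<odot>\<^bsub>ET\<^esub> (N #>\<^bsub>F\<^esub> w f)"
    using ET_smult[OF _ w_closed[OF f]] u_w[OF f] by simp
next
  fix n f assume f: "f \<in> grade DS n"
  let ?G = "{N #>\<^bsub>F\<^esub> frag_of (s, m) | s m i j. s \<in> grade S i \<and> m \<in> grade P j \<and> i + j = n}"
  have fj: "f j \<in> grade S (d j + n)" if "j \<in> I" for j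
  proof -
    have "f j \<in> grade (SP j) n" using f that by auto
    then show ?thesis unfolding SP_simps[OF that] by auto
  qed
  have fr: "frag_of (f j, b j) \<in> carrier F" if "j \<in> I" for j
    using frag_closed[OF S.grade_closed[OF fj[OF that]] b_closed[OF that]] .
  \<comment> \<open>\<open>f j\<close> has degree \<open>d j + n\<close> and \<open>b j\<close> has
    degree \<open>- d j\<close>, which add up to \<open>n\<close>.\<close>
  have gen: "N #>\<^bsub>F\<^esub> frag_of (f j, b j) \<in> ?G" if "j \<in> I" for j
    using fj[OF that] b_grade[OF that] by fastforce
  have "finite J \<Longrightarrow> J \<subseteq> I \<Longrightarrow> N #>\<^bsub>F\<^esub> (\<Sum>j\<in>J. frag_of (f j, b j)) \<in> generate T ?G" for J
  proof (induction J rule: finite_induct)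
    case empty
    show ?case using generate.one[of T ?G] unfolding T_one by simp
  next
    case (insert i J)
    have s: "(\<Sum>j\<in>J. frag_of (f j, b j)) \<in> carrier F"
      by (rule sum_closed_free_Abelian_group) (use fr insert in blast)
    have "(N #>\<^bsub>F\<^esub> frag_of (f i, b i)) \<otimes>\<^bsub>T\<^esub> (N #>\<^bsub>F\<^esub> (\<Sum>j\<in>J. frag_of (f j, b j))) \<in> generate T ?G"
      by (rule generate.eng[OF generate.incl[OF gen]]) (use insert in auto)
    then show ?case using coset_add[OF fr s] insert by simp
  qed
  from this[OF fin subset_refl] show "N #>\<^bsub>F\<^esub> w f \<in> grade ET n" unfolding ET_simps w_def .
qed

lemma ubar_hom: "ubar \<in> graded_module_hom S ET DS"
proof (rule graded_module_homI)
  fix U V assume U: "U \<in> carrier ET" and V: "V \<in> carrier ET"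
  have U': "U \<in> carrier T" and V': "V \<in> carrier T" using U V unfolding ET_simps by auto
  show "ubar U \<in> carrier DS" by (rule ubar_closed[OF U'])
  show "ubar (U \<oplus>\<^bsub>ET\<^esub> V) = ubar U \<oplus>\<^bsub>DS\<^esub> ubar V" unfolding ET_simps by (rule ubar_add[OF U' V'])
  fix a assume a: "a \<in> carrier S"
  obtain x where x: "x \<in> carrier F" "U = N #>\<^bsub>F\<^esub> x" using U' by (rule T_carrierE)
  show "ubar (a \<odot>\<^bsub>ET\<^esub> U) = a \<odot>\<^bsub>DS\<^esub> ubar U"
    unfolding x(2) ET_smult[OF a x(1)] ubar_coset[OF x(1)]
    by (rule ubar_w[OF DS_smult_closed[OF a u_closed[OF x(1)]]])
next
  fix n U assume U: "U \<in> grade ET n"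
  let ?G = "{N #>\<^bsub>F\<^esub> frag_of (s, m) | s m i j. s \<in> grade S i \<and> m \<in> grade P j \<and> i + j = n}"
  have Gc: "?G \<subseteq> carrier T"
    by (auto intro!: coset_closed frag_closed dest: S.grade_closed PG.grade_closed simp del: carrier_free_Abelian_group_iff)
  have G: "ubar V \<in> grade DS n" if VG: "V \<in> ?G" for V
  proof -
    obtain s m i l where V: "V = N #>\<^bsub>F\<^esub> frag_of (s, m)" and s: "s \<in> grade S i" and m: "m \<in> grade P l" and n: "i + l = n"
      using VG by blast
    note sc = S.grade_closed[OF s] and mc = PG.grade_closed[OF m]
    have uV: "ubar V = u0 (s, m)" unfolding V ubar_coset[OF frag_closed[OF sc mc]] by (rule u_of[OF sc mc])
    have "u0 (s, m) j \<in> grade (SP j) n" if j: "j \<in> I" for j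
    proof -
      have "h m j \<in> grade (RP j) l" using graded_hom_grade[OF h m] j by auto
      then have "h m j \<in> grade R (d j + l)" unfolding RP_simps[OF j] by simp
      then have "s \<otimes>\<^bsub>S\<^esub> \<psi> (h m j) \<in> grade S (i + (d j + l))" by (intro S.grade_mult[OF s] psi_grade)
      moreover have "u0 (s, m) j \<in> carrier (SP j)" using u0_closed[OF sc mc] j by auto
      ultimately show ?thesis using j unfolding SP_simps[OF j] n[symmetric] by (simp add: u0_def ac_simps)
    qed
    moreover have "u0 (s, m) \<in> extensional I" by (simp add: u0_def)
    ultimately show ?thesis unfolding uV by (simp add: PiE_def Pi_def)
  qed
  \<comment> \<open>The component of degree \<open>n\<close> is a generated subgroup, hence the
    induction. Membership in the carrier is carried along because \<open>ubar\<close> is known to be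
    additive only there.\<close>
  have "V \<in> generate T ?G \<Longrightarrow> V \<in> carrier T \<and> ubar V \<in> grade DS n" for V
  proof (induction V rule: generate.induct)
    case one
    have "ubar \<one>\<^bsub>T\<^esub> = \<zero>\<^bsub>DS\<^esub>" unfolding T_one using ubar_coset[of 0] u_zero by (simp del: graded_sum_simps)
    then show ?case using DS.grade_zero[of n] T.one_closed by (simp del: graded_sum_simps)
  next
    case (incl V)
    then show ?case using G Gc by blast
  next
    case (inv V)
    have V: "V \<in> carrier T" using inv Gc by blast
    have "ubar (inv\<^bsub>T\<^esub> V) \<oplus>\<^bsub>DS\<^esub> ubar V = ubar \<one>\<^bsub>T\<^esub>"
      using ubar_add[OF T.inv_closed[OF V] V] T.l_inv[OF V] by simp
    also have "... = \<zero>\<^bsub>DS\<^esub>" unfolding T_one using ubar_coset[of 0] u_zero by (simp del: graded_sum_simps)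
    finally have "ubar (inv\<^bsub>T\<^esub> V) = \<ominus>\<^bsub>DS\<^esub> ubar V"
      using DS.minus_equality[OF _ ubar_closed[OF V] ubar_closed[OF T.inv_closed[OF V]]] by simp
    then show ?case using DS.grade_neg[OF G[OF inv]] T.inv_closed[OF V] by (simp del: graded_sum_simps)
  next
    case (eng V W)
    then show ?case using ubar_add[of V W] DS.grade_add[of "ubar V" n "ubar W"] T.m_closed by (simp del: graded_sum_simps)
  qed
  then show "ubar U \<in> grade DS n" using U unfolding ET_simps by blast
qed

text \<open>\<open>w\<close> and \<open>ubar\<close> are mutually inverse graded homomorphisms. Both
  directions are recorded because \<open>Vgr_class_eqI\<close> asks for both.\<close>

theorem extension_of_scalars_sum:
  "graded_isomorphic S DS ET" "graded_isomorphic S ET DS"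
  by (rule graded_isoI[OF w_hom, where g = ubar] graded_isoI[OF ubar_hom, where g = "\<lambda>f. N #>\<^bsub>F\<^esub> w f"];
      use ubar_closed ubar_w w_ubar coset_closed w_closed in \<open>simp del: graded_sum_simps add: ET_simps Pi_def\<close>)+

end

section \<open>Homogeneous ideals\<close>

lemma (in graded_group) component_neg:
  assumes x: "x \<in> carrier M"
  shows "component M n (\<ominus> x) = \<ominus> component M n x"
proof -
  have "component M n (\<ominus> x) \<oplus> component M n x = component M n \<zero>"
    using component_add[OF a_inv_closed[OF x] x, of n] x by (simp add: l_neg)
  also have "... = \<zero>" using component_grade[OF grade_zero[of 0]] by simp
  finally show ?thesis
    using minus_equality component_closed[OF x] component_closed[OF a_inv_closed[OF x]] by metis
qed

context graded_ring
begin

lemma component_homogeneous_mult: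
  assumes a: "a \<in> grade A m" and x: "x \<in> carrier A"
  shows "component A (m + n) (a \<otimes> x) = a \<otimes> component A n x"
    and "component A (n + m) (x \<otimes> a) = component A n x \<otimes> a"
  using x
proof (induction x rule: graded_induct)
  case (homogeneous k z)
  note ac = grade_closed[OF a]
  { case 1 then show ?case
      using component_grade[OF grade_mult[OF a homogeneous]] component_grade[OF homogeneous] ac by simp }
  { case 2 then show ?case
      using component_grade[OF grade_mult[OF homogeneous a]] component_grade[OF homogeneous] ac by simp }
next
  case (add u z)
  note ac = grade_closed[OF a]
  { case 1 then show ?case using add ac by (simp add: r_distr component_add component_closed) }
  { case 2 then show ?case using add ac by (simp add: l_distr component_add component_closed) }
qed

text \<open>Multiplication by a homogeneous element shifts components, so the elements all of whose
  components lie in the ideal form an ideal themselves. It contains \<open>S\<close>, hence the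
  whole of \<open>Idl S\<close>. Applied to the Leavitt relations, this gives the grading of the
  quotient.\<close>

lemma component_genideal:
  assumes S: "\<And>s. s \<in> S \<Longrightarrow> \<exists>n. s \<in> grade A n" and x: "x \<in> Idl S"
  shows "component A n x \<in> Idl S"
proof -
  let ?I = "Idl S"
  have Sc: "S \<subseteq> carrier A" using S grade_closed by blast
  interpret I: ideal ?I A by (rule genideal_ideal[OF Sc])
  let ?J = "{x \<in> carrier A. \<forall>n. component A n x \<in> ?I}"
  have l: "a \<otimes> x \<in> ?J" if x: "x \<in> ?J" and a: "a \<in> carrier A" for a x
    using a
  proof (induction a rule: graded_induct)
    case (homogeneous m a)
    have "component A n (a \<otimes> x) \<in> ?I" for n
      using component_homogeneous_mult(1)[OF homogeneous, of x "n - m"] x grade_closed[OF homogeneous]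
      by (simp add: I.I_l_closed)
    then show ?case using x grade_closed[OF homogeneous] by auto
  next
    case (add a b)
    then show ?case using x by (auto simp: l_distr component_add)
  qed
  have r: "x \<otimes> a \<in> ?J" if x: "x \<in> ?J" and a: "a \<in> carrier A" for a x
    using a
  proof (induction a rule: graded_induct)
    case (homogeneous m a)
    have "component A n (x \<otimes> a) \<in> ?I" for n
      using component_homogeneous_mult(2)[OF homogeneous, of x "n - m"] x grade_closed[OF homogeneous]
      by (simp add: I.I_r_closed)
    then show ?case using x grade_closed[OF homogeneous] by auto
  next
    case (add a b)
    then show ?case using x by (auto simp: r_distr component_add)
  qed
  have "ideal ?J A"
  proof (rule idealI[OF ring_axioms])
    show "subgroup ?J (add_monoid A)"
    proof (rule add.subgroupI)
      have "\<zero> \<in> ?J" using component_grade[OF grade_zero[of 0]] by simp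
      then show "?J \<noteq> {}" by blast
    qed (auto simp: component_neg component_add)
  qed (use l r in auto)
  moreover have "S \<subseteq> ?J"
  proof
    fix s assume s: "s \<in> S"
    then obtain k where "s \<in> grade A k" using S by blast
    then show "s \<in> ?J" using component_grade genideal_self[OF Sc] s grade_closed by auto
  qed
  ultimately have "?I \<subseteq> ?J" by (rule genideal_minimal)
  then show ?thesis using x by blast
qed

end

section \<open>Free algebras\<close>

locale free_alg = K: cring K for K :: "('k, 'z) ring_scheme" (structure) +
  fixes G :: "'x set" and wt :: "'x \<Rightarrow> int"
begin

abbreviation "Fr \<equiv> free_algebra K G wt"

definition "conv f g w = (\<Oplus>i\<in>{..length w}. f (take i w) \<otimes> g (drop i w))" for f g :: "'x list \<Rightarrow> 'k"

definition mono :: "'k \<Rightarrow> 'x list \<Rightarrow> 'x list \<Rightarrow> 'k" where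
  "mono c w = (\<lambda>u. if u = w then c else \<zero>)"

abbreviation deg :: "'x list \<Rightarrow> int" where "deg w \<equiv> (\<Sum>x\<leftarrow>w. wt x)"

lemma Fr_carrier: "f \<in> carrier Fr \<longleftrightarrow> (\<forall>w. f w \<in> carrier K) \<and> finite {w. f w \<noteq> \<zero>} \<and> (\<forall>w. f w \<noteq> \<zero> \<longrightarrow> set w \<subseteq> G)"
  by (auto simp: free_algebra_def Let_def)

lemma Fr_simps:
  "f \<otimes>\<^bsub>Fr\<^esub> g = conv f g" "\<one>\<^bsub>Fr\<^esub> = mono \<one> []" "\<zero>\<^bsub>Fr\<^esub> = (\<lambda>w. \<zero>)" "f \<oplus>\<^bsub>Fr\<^esub> g = (\<lambda>w. f w \<oplus> g w)"
  "c \<odot>\<^bsub>Fr\<^esub> f = (\<lambda>w. c \<otimes> f w)"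
  "grade Fr n = {f \<in> carrier Fr. \<forall>w. f w \<noteq> \<zero> \<longrightarrow> deg w = n}"
  by (auto simp: free_algebra_def Let_def conv_def mono_def fun_eq_iff)

lemma conv_closed:
  assumes "\<And>w. f w \<in> carrier K" "\<And>w. g w \<in> carrier K"
  shows "conv f g w \<in> carrier K"
  unfolding conv_def by (rule K.finsum_closed) (use assms in auto)

lemma conv_Nil: "f [] \<in> carrier K \<Longrightarrow> g [] \<in> carrier K \<Longrightarrow> conv f g [] = f [] \<otimes> g []"
  by (simp add: conv_def)

text \<open>This recursion on the first letter reduces associativity to an induction on the word, without any
  exchange of double sums.\<close>

lemma conv_Cons:
  assumes f: "\<And>w. f w \<in> carrier K" and g: "\<And>w. g w \<in> carrier K"
  shows "conv f g (x # w) = f [] \<otimes> g (x # w) \<oplus> conv (\<lambda>u. f (x # u)) g w"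
proof -
  have "conv f g (x # w) = (\<Oplus>i\<in>{..Suc (length w)}. f (take i (x # w)) \<otimes> g (drop i (x # w)))"
    by (simp add: conv_def)
  also have "... = (\<Oplus>i\<in>{..length w}. f (x # take i w) \<otimes> g (drop i w)) \<oplus> f [] \<otimes> g (x # w)"
    by (subst K.finsum_Suc2) (use f g in auto)
  also have "... = f [] \<otimes> g (x # w) \<oplus> (\<Oplus>i\<in>{..length w}. f (x # take i w) \<otimes> g (drop i w))"
    by (rule K.a_comm) (use f g in \<open>auto intro!: K.finsum_closed\<close>)
  finally show ?thesis by (simp add: conv_def)
qed

text \<open>Here and below the factors are arbitrary functions with values in \<open>K\<close>. The
  inductions on the word replace \<open>f\<close> by \<open>\<lambda>u. f (x # u)\<close>, and
  asking for values alone avoids any bookkeeping of supports.\<close>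

lemma conv_add_left:
  assumes "\<And>w. f w \<in> carrier K" "\<And>w. f' w \<in> carrier K" "\<And>w. g w \<in> carrier K"
  shows "conv (\<lambda>u. f u \<oplus> f' u) g w = conv f g w \<oplus> conv f' g w"
  using assms
proof (induction w arbitrary: f f')
  case (Cons x w)
  have "conv (\<lambda>u. f (x # u) \<oplus> f' (x # u)) g w = conv (\<lambda>u. f (x # u)) g w \<oplus> conv (\<lambda>u. f' (x # u)) g w"
    by (rule Cons.IH) (use Cons.prems in auto)
  then show ?case using Cons.prems conv_closed[of "\<lambda>u. f (x # u)" g w] conv_closed[of "\<lambda>u. f' (x # u)" g w]
    by (simp add: conv_Cons K.l_distr K.a_ac)
qed (simp add: conv_Nil K.l_distr)

lemma conv_add_right:
  assumes "\<And>w. f w \<in> carrier K" "\<And>w. g w \<in> carrier K" "\<And>w. g' w \<in> carrier K"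
  shows "conv f (\<lambda>u. g u \<oplus> g' u) w = conv f g w \<oplus> conv f g' w"
  using assms
proof (induction w arbitrary: f)
  case (Cons x w)
  have "conv (\<lambda>u. f (x # u)) (\<lambda>u. g u \<oplus> g' u) w = conv (\<lambda>u. f (x # u)) g w \<oplus> conv (\<lambda>u. f (x # u)) g' w"
    by (rule Cons.IH) (use Cons.prems in auto)
  then show ?case using Cons.prems conv_closed[of "\<lambda>u. f (x # u)" g w] conv_closed[of "\<lambda>u. f (x # u)" g' w]
    by (simp add: conv_Cons K.r_distr K.a_ac)
qed (simp add: conv_Nil K.r_distr)

lemma conv_smult_left:
  assumes "\<And>w. f w \<in> carrier K" "\<And>w. g w \<in> carrier K" "c \<in> carrier K"
  shows "conv (\<lambda>u. c \<otimes> f u) g w = c \<otimes> conv f g w"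
  using assms
proof (induction w arbitrary: f)
  case (Cons x w)
  have "conv (\<lambda>u. c \<otimes> f (x # u)) g w = c \<otimes> conv (\<lambda>u. f (x # u)) g w"
    by (rule Cons.IH) (use Cons.prems in auto)
  then show ?case using Cons.prems conv_closed[of "\<lambda>u. f (x # u)" g w]
    by (simp add: conv_Cons K.r_distr K.m_assoc)
qed (simp add: conv_Nil K.m_assoc)

lemma conv_smult_right:
  assumes "\<And>w. f w \<in> carrier K" "\<And>w. g w \<in> carrier K" "c \<in> carrier K"
  shows "conv f (\<lambda>u. c \<otimes> g u) w = c \<otimes> conv f g w"
  using assms
proof (induction w arbitrary: f)
  case (Cons x w)
  have "conv (\<lambda>u. f (x # u)) (\<lambda>u. c \<otimes> g u) w = c \<otimes> conv (\<lambda>u. f (x # u)) g w"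
    by (rule Cons.IH) (use Cons.prems in auto)
  then show ?case using Cons.prems conv_closed[of "\<lambda>u. f (x # u)" g w]
    by (simp add: conv_Cons K.r_distr K.m_lcomm)
qed (simp add: conv_Nil K.m_lcomm)

lemma conv_assoc:
  assumes "\<And>w. f w \<in> carrier K" "\<And>w. g w \<in> carrier K" "\<And>w. h w \<in> carrier K"
  shows "conv (conv f g) h w = conv f (conv g h) w"
  using assms
proof (induction w arbitrary: f)
  case Nil
  then show ?case by (simp add: conv_Nil conv_closed K.m_assoc)
next
  case (Cons x w)
  let ?f = "\<lambda>u. f (x # u)" and ?g = "\<lambda>u. g (x # u)"
  have c: "conv a b u \<in> carrier K" if "\<And>w. a w \<in> carrier K" "\<And>w. b w \<in> carrier K" for a b u
    using conv_closed that .
  have "(\<lambda>u. conv f g (x # u)) = (\<lambda>u. f [] \<otimes> g (x # u) \<oplus> conv ?f g u)"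
    using Cons.prems by (simp add: conv_Cons)
  \<comment> \<open>Peeling off the first letter leaves associativity for the shorter word with
    \<open>f\<close> replaced by \<open>?f\<close>, which is why \<open>f\<close> is arbitrary in
    the induction.\<close>
  then have "conv (conv f g) h (x # w) = f [] \<otimes> g [] \<otimes> h (x # w) \<oplus> (f [] \<otimes> conv ?g h w \<oplus> conv (conv ?f g) h w)"
    using Cons.prems c[of ?f g]
    by (simp add: conv_Cons[OF c] conv_Nil conv_add_left conv_smult_left)
  also have "conv (conv ?f g) h w = conv ?f (conv g h) w" by (rule Cons.IH) (use Cons.prems in auto)
  also have "f [] \<otimes> g [] \<otimes> h (x # w) \<oplus> (f [] \<otimes> conv ?g h w \<oplus> conv ?f (conv g h) w) = conv f (conv g h) (x # w)"
    using Cons.prems c[of g h] c[of ?g h] c[of ?f "conv g h"]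
    by (simp add: conv_Cons[of f "conv g h"] conv_Cons[of g h] K.r_distr K.m_assoc K.a_assoc)
  finally show ?case .
qed

lemma conv_zero_left: "(\<And>w. g w \<in> carrier K) \<Longrightarrow> conv (\<lambda>u. \<zero>) g w = \<zero>"
  by (induction w) (simp_all add: conv_Nil conv_Cons)

lemma mono_closed: "c \<in> carrier K \<Longrightarrow> mono c w u \<in> carrier K"
  by (simp add: mono_def)

lemma conv_mono_Nil:
  assumes "\<And>w. g w \<in> carrier K" "c \<in> carrier K"
  shows "conv (mono c []) g = (\<lambda>w. c \<otimes> g w)"
proof
  fix w show "conv (mono c []) g w = c \<otimes> g w"
  proof (cases w)
    case (Cons x v)
    have "(\<lambda>u. mono c [] (x # u)) = (\<lambda>u. \<zero>)" by (simp add: mono_def)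
    then show ?thesis using assms Cons by (simp add: conv_Cons mono_closed conv_zero_left) (simp add: mono_def)
  qed (use assms in \<open>simp add: conv_Nil mono_def\<close>)
qed

lemma conv_mono_Cons:
  assumes "\<And>w. g w \<in> carrier K" "c \<in> carrier K"
  shows "conv (mono c (x # w)) g v = (case v of [] \<Rightarrow> \<zero> | y # v' \<Rightarrow> if y = x then conv (mono c w) g v' else \<zero>)"
proof (cases v)
  case (Cons y v')
  have "(\<lambda>u. mono c (x # w) (y # u)) = (if y = x then mono c w else (\<lambda>u. \<zero>))" by (auto simp: mono_def)
  then show ?thesis
    using assms Cons conv_closed[of "mono c w" g v'] mono_closed[of c w]
    by (simp add: conv_Cons mono_closed conv_zero_left) (simp add: mono_def)
qed (use assms in \<open>simp add: conv_Nil mono_def\<close>)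

lemma conv_mono_mono:
  assumes "c \<in> carrier K" "d \<in> carrier K"
  shows "conv (mono c w) (mono d u) = mono (c \<otimes> d) (w @ u)"
proof
  fix v show "conv (mono c w) (mono d u) v = mono (c \<otimes> d) (w @ u) v"
  proof (induction w arbitrary: v)
    case Nil
    then show ?case using assms by (simp add: conv_mono_Nil mono_closed) (simp add: mono_def)
  next
    case (Cons x w)
    then show ?case using assms by (auto simp: conv_mono_Cons mono_closed split: list.split) (auto simp: mono_def)
  qed
qed

lemma conv_mono_Nil_right:
  assumes "\<And>w. f w \<in> carrier K"
  shows "conv f (mono \<one> []) w = f w"
  using assms
proof (induction w arbitrary: f)
  case (Cons x w)
  then show ?case using Cons.IH[of "\<lambda>u. f (x # u)"] by (simp add: conv_Cons mono_closed) (simp add: mono_def)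
qed (simp add: conv_Nil mono_def)

text \<open>Some splitting of the word must contribute a nonzero term. Finiteness of the support,
  the letters occurring and the degree of a product are all read off from this.\<close>

lemma conv_support:
  assumes "\<And>w. f w \<in> carrier K" "\<And>w. g w \<in> carrier K" "conv f g w \<noteq> \<zero>"
  obtains u v where "w = u @ v" "f u \<noteq> \<zero>" "g v \<noteq> \<zero>"
proof -
  have "\<exists>i. f (take i w) \<noteq> \<zero> \<and> g (drop i w) \<noteq> \<zero>"
  proof (rule ccontr)
    assume "\<nexists>i. f (take i w) \<noteq> \<zero> \<and> g (drop i w) \<noteq> \<zero>"
    then have "f (take i w) \<otimes> g (drop i w) = \<zero>" for i using assms(1,2) by (metis K.l_null K.r_null)
    then have "conv f g w = \<zero>" unfolding conv_def by simp
    then show False using assms(3) by simp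
  qed
  then show thesis using that by (metis append_take_drop_id)
qed

section \<open>The free algebra as a graded ring\<close>

lemma Fr_closed: "f \<in> carrier Fr \<Longrightarrow> f w \<in> carrier K"
  by (simp add: Fr_carrier)

lemma Fr_conv:
  assumes f: "f \<in> carrier Fr" and g: "g \<in> carrier Fr"
  shows "conv f g \<in> carrier Fr"
proof -
  have "{w. conv f g w \<noteq> \<zero>} \<subseteq> (\<lambda>(u, v). u @ v) ` ({u. f u \<noteq> \<zero>} \<times> {v. g v \<noteq> \<zero>})"
  proof
    fix w assume "w \<in> {w. conv f g w \<noteq> \<zero>}"
    then have "conv f g w \<noteq> \<zero>" by simp
    then obtain u v where "w = u @ v" "f u \<noteq> \<zero>" "g v \<noteq> \<zero>"
      by (rule conv_support[OF Fr_closed[OF f] Fr_closed[OF g]])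
    then show "w \<in> (\<lambda>(u, v). u @ v) ` ({u. f u \<noteq> \<zero>} \<times> {v. g v \<noteq> \<zero>})" by blast
  qed
  moreover have "finite ((\<lambda>(u, v). u @ v) ` ({u. f u \<noteq> \<zero>} \<times> {v. g v \<noteq> \<zero>}))"
    using f g by (auto simp: Fr_carrier)
  ultimately have "finite {w. conv f g w \<noteq> \<zero>}" by (rule finite_subset)
  moreover have "set w \<subseteq> G" if w: "conv f g w \<noteq> \<zero>" for w
    by (rule conv_support[OF Fr_closed[OF f] Fr_closed[OF g] w]) (use f g in \<open>simp add: Fr_carrier\<close>)
  ultimately show ?thesis using conv_closed[OF Fr_closed[OF f] Fr_closed[OF g]] by (simp add: Fr_carrier)
qed

lemma mono_Fr: "c \<in> carrier K \<Longrightarrow> set w \<subseteq> G \<Longrightarrow> mono c w \<in> carrier Fr"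
  by (auto simp: Fr_carrier mono_def)

lemma Fr_add: "f \<in> carrier Fr \<Longrightarrow> g \<in> carrier Fr \<Longrightarrow> (\<lambda>w. f w \<oplus> g w) \<in> carrier Fr"
proof -
  assume fg: "f \<in> carrier Fr" "g \<in> carrier Fr"
  have s: "{w. f w \<oplus> g w \<noteq> \<zero>} \<subseteq> {w. f w \<noteq> \<zero>} \<union> {w. g w \<noteq> \<zero>}" by auto
  then have "finite {w. f w \<oplus> g w \<noteq> \<zero>}" by (rule finite_subset) (use fg in \<open>simp add: Fr_carrier\<close>)
  then show ?thesis using fg s unfolding Fr_carrier by blast
qed

lemma Fr_smult: "c \<in> carrier K \<Longrightarrow> f \<in> carrier Fr \<Longrightarrow> (\<lambda>w. c \<otimes> f w) \<in> carrier Fr"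
proof -
  assume cf: "c \<in> carrier K" "f \<in> carrier Fr"
  have s: "{w. c \<otimes> f w \<noteq> \<zero>} \<subseteq> {w. f w \<noteq> \<zero>}" using cf by auto
  then have "finite {w. c \<otimes> f w \<noteq> \<zero>}" by (rule finite_subset) (use cf in \<open>simp add: Fr_carrier\<close>)
  moreover have "\<forall>w. c \<otimes> f w \<noteq> \<zero> \<longrightarrow> set w \<subseteq> G" using s cf(2) unfolding Fr_carrier by blast
  ultimately show ?thesis using cf unfolding Fr_carrier by simp
qed

lemma Fr_neg:
  assumes f: "f \<in> carrier Fr"
  shows "(\<lambda>w. \<ominus> f w) \<in> carrier Fr"
proof -
  have "\<ominus> f w = (\<ominus> \<one>) \<otimes> f w" for w using Fr_closed[OF f] by (simp add: K.l_minus)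
  then show ?thesis using Fr_smult[OF _ f, of "\<ominus> \<one>"] by simp
qed

lemma Fr_abelian_group: "abelian_group Fr"
proof (rule abelian_groupI)
  fix f assume f: "f \<in> carrier Fr"
  show "\<exists>g\<in>carrier Fr. g \<oplus>\<^bsub>Fr\<^esub> f = \<zero>\<^bsub>Fr\<^esub>"
    by (rule bexI[OF _ Fr_neg[OF f]]) (use Fr_closed[OF f] in \<open>simp add: Fr_simps K.l_neg\<close>)
qed (auto simp: Fr_simps Fr_add Fr_closed K.a_ac fun_eq_iff Fr_carrier[of "\<lambda>w. \<zero>"])

sublocale FrG: abelian_group Fr by (rule Fr_abelian_group)

lemma Fr_ring: "ring Fr"
proof (rule ringI[OF Fr_abelian_group])
  show "monoid Fr"
    by (rule monoidI)
      (auto simp: Fr_simps Fr_conv mono_Fr Fr_closed conv_assoc conv_mono_Nil conv_mono_Nil_right fun_eq_iff)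
qed (auto simp: Fr_simps Fr_closed conv_add_left conv_add_right)

text \<open>The monomials are only those of \<open>f\<close> itself, so facts about the support of
  \<open>f\<close>, such as its degree or the absence of the empty word, remain available at each of
  them.\<close>

lemma free_induct [consumes 1, case_names zero mono add]:
  assumes f: "f \<in> carrier Fr" and zero: "P \<zero>\<^bsub>Fr\<^esub>"
    and mono: "\<And>w. f w \<noteq> \<zero> \<Longrightarrow> set w \<subseteq> G \<Longrightarrow> P (mono (f w) w)"
    and add: "\<And>g h. g \<in> carrier Fr \<Longrightarrow> h \<in> carrier Fr \<Longrightarrow> P g \<Longrightarrow> P h \<Longrightarrow> P (g \<oplus>\<^bsub>Fr\<^esub> h)"
  shows "P f"
proof -
  let ?r = "\<lambda>S w. if w \<in> S then f w else \<zero>"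
  have "?r S \<in> carrier Fr \<and> P (?r S)" if "finite S" "S \<subseteq> {w. f w \<noteq> \<zero>}" for S
    using that
  proof (induction S rule: finite_induct)
    case empty
    then show ?case using zero FrG.zero_closed by (simp add: Fr_simps)
  next
    case (insert u S)
    have u: "f u \<noteq> \<zero>" "set u \<subseteq> G" using insert.prems f by (auto simp: Fr_carrier)
    have e: "?r (insert u S) = mono (f u) u \<oplus>\<^bsub>Fr\<^esub> ?r S"
      using insert.hyps Fr_closed[OF f] by (auto simp: Fr_simps mono_def fun_eq_iff)
    have m: "mono (f u) u \<in> carrier Fr" using mono_Fr Fr_closed[OF f] u by blast
    have S: "?r S \<in> carrier Fr" "P (?r S)" using insert by auto
    show ?case unfolding e using add[OF m S(1) mono[OF u] S(2)] FrG.a_closed[OF m S(1)] by blast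
  qed
  note step = this
  have e: "?r {w. f w \<noteq> \<zero>} = f" by auto
  have fin: "finite {w. f w \<noteq> \<zero>}" using f by (simp add: Fr_carrier)
  from step[OF fin subset_refl] show ?thesis unfolding e by blast
qed

lemma Fr_grade_closed: "f \<in> grade Fr n \<Longrightarrow> f \<in> carrier Fr"
  by (simp add: Fr_simps)

lemma Fr_component:
  assumes f: "f \<in> carrier Fr"
  shows "(\<lambda>w. if deg w = n then f w else \<zero>) \<in> grade Fr n"
proof -
  have "finite {w. (if deg w = n then f w else \<zero>) \<noteq> \<zero>}"
    by (rule finite_subset[of _ "{w. f w \<noteq> \<zero>}"]) (use f in \<open>auto simp: Fr_carrier\<close>)
  then show ?thesis using f by (auto simp: Fr_simps Fr_carrier)
qed

lemma Fr_graded_ring: "graded_ring Fr"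
proof -
  interpret ring Fr by (rule Fr_ring)
  have "is_grading Fr"
  proof (rule is_gradingI[where pr = "\<lambda>n f w. if deg w = n then f w else \<zero>", OF Fr_abelian_group])
    show "additive_subgroup (grade Fr n) Fr" for n
    proof (rule FrG.additive_subgroupI2)
      fix f assume f: "f \<in> grade Fr n"
      have "f w \<noteq> \<zero>" if "\<ominus> f w \<noteq> \<zero>" for w using that by (metis K.minus_zero)
      then have "(\<lambda>w. \<ominus> f w) \<in> grade Fr n" using f Fr_neg[of f] by (auto simp: Fr_simps(6))
      moreover have "(\<lambda>w. \<ominus> f w) \<oplus>\<^bsub>Fr\<^esub> f = \<zero>\<^bsub>Fr\<^esub>" using Fr_closed[OF Fr_grade_closed[OF f]] by (simp add: Fr_simps K.l_neg)
      ultimately show "\<exists>g\<in>grade Fr n. g \<oplus>\<^bsub>Fr\<^esub> f = \<zero>\<^bsub>Fr\<^esub>" by blast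
    next
      fix f g assume fg: "f \<in> grade Fr n" "g \<in> grade Fr n"
      then have "f \<oplus>\<^bsub>Fr\<^esub> g \<in> carrier Fr" by (simp add: Fr_simps(6))
      moreover have "deg w = n" if "f w \<oplus> g w \<noteq> \<zero>" for w
        using that fg by (cases "f w = \<zero>"; cases "g w = \<zero>") (auto simp: Fr_simps(6))
      ultimately show "f \<oplus>\<^bsub>Fr\<^esub> g \<in> grade Fr n" by (simp add: Fr_simps)
    qed (use FrG.zero_closed in \<open>auto simp: Fr_simps\<close>)
    show "finite {n. (\<lambda>w. if deg w = n then f w else \<zero>) \<noteq> \<zero>\<^bsub>Fr\<^esub>}" if f: "f \<in> carrier Fr" for f
      by (rule finite_subset[of _ "deg ` {w. f w \<noteq> \<zero>}"])
        (use f in \<open>auto simp: Fr_carrier Fr_simps fun_eq_iff image_iff split: if_splits\<close>)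
    show "f = \<zero>\<^bsub>Fr\<^esub>" if 0: "\<And>n. (\<lambda>w. if deg w = n then f w else \<zero>) = \<zero>\<^bsub>Fr\<^esub>" for f
    proof
      fix w show "f w = \<zero>\<^bsub>Fr\<^esub> w" using fun_cong[OF 0[of "deg w"], of w] by simp
    qed
    show "(\<lambda>w. if deg w = m then f w else \<zero>) = (if m = n then f else \<zero>\<^bsub>Fr\<^esub>)" if "f \<in> grade Fr n" for m n f
      using that by (auto simp: Fr_simps fun_eq_iff)
  qed (auto simp: Fr_component Fr_simps(4) fun_eq_iff)
  moreover have "f \<otimes>\<^bsub>Fr\<^esub> g \<in> grade Fr (m + n)" if f: "f \<in> grade Fr m" and g: "g \<in> grade Fr n" for f g m n
  proof -
    note fc = Fr_grade_closed[OF f] and gc = Fr_grade_closed[OF g]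
    have "deg w = m + n" if w: "conv f g w \<noteq> \<zero>" for w
      by (rule conv_support[OF Fr_closed[OF fc] Fr_closed[OF gc] w]) (use f g in \<open>auto simp: Fr_simps(6)\<close>)
    then show ?thesis using Fr_conv[OF fc gc] by (simp add: Fr_simps)
  qed
  ultimately show ?thesis by unfold_locales
qed

sublocale Fr: graded_ring Fr by (rule Fr_graded_ring)

text \<open>The explicit formula shows that components of an element without constant term have none
  either.\<close>

lemma component_Fr:
  assumes "f \<in> carrier Fr"
  shows "component Fr n f = (\<lambda>w. if deg w = n then f w else \<zero>)"
  using assms
proof (induction f rule: Fr.graded_induct)
  case (homogeneous k f)
  then show ?case unfolding Fr.component_grade[OF homogeneous] by (auto simp: Fr_simps fun_eq_iff)
next
  case (add f g)
  then show ?case by (simp only: Fr.component_add) (auto simp: Fr_simps fun_eq_iff)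
qed

lemma mono_grade: "c \<in> carrier K \<Longrightarrow> set w \<subseteq> G \<Longrightarrow> mono c w \<in> grade Fr (deg w)"
  using mono_Fr[of c w] by (auto simp: Fr_simps(6)) (simp add: mono_def split: if_splits)

end

section \<open>Evaluation homomorphisms\<close>

locale free_alg_eval = free_alg K G wt + A: graded_ring A + AM: module K A
  for K :: "('k, 'z) ring_scheme" (structure) and G :: "'x set" and wt :: "'x \<Rightarrow> int" and A :: "('k, 'a) gmodule" +
  fixes a :: "'x \<Rightarrow> 'a"
  assumes smult_mult: "c \<in> carrier K \<Longrightarrow> u \<in> carrier A \<Longrightarrow> v \<in> carrier A \<Longrightarrow> (c \<odot>\<^bsub>A\<^esub> u) \<otimes>\<^bsub>A\<^esub> v = c \<odot>\<^bsub>A\<^esub> (u \<otimes>\<^bsub>A\<^esub> v)"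
    and mult_smult: "c \<in> carrier K \<Longrightarrow> u \<in> carrier A \<Longrightarrow> v \<in> carrier A \<Longrightarrow> u \<otimes>\<^bsub>A\<^esub> (c \<odot>\<^bsub>A\<^esub> v) = c \<odot>\<^bsub>A\<^esub> (u \<otimes>\<^bsub>A\<^esub> v)"
    and smult_grade: "c \<in> carrier K \<Longrightarrow> u \<in> grade A n \<Longrightarrow> c \<odot>\<^bsub>A\<^esub> u \<in> grade A n"
    and a_grade: "x \<in> G \<Longrightarrow> a x \<in> grade A (wt x)"
begin

definition "wprod w = foldr (\<otimes>\<^bsub>A\<^esub>) (map a w) \<one>\<^bsub>A\<^esub>"

lemma wprod_grade: "set w \<subseteq> G \<Longrightarrow> wprod w \<in> grade A (deg w)"
proof (induction w)
  case Nil
  then show ?case by (simp add: wprod_def A.one_grade)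
next
  case (Cons x w)
  then show ?case using A.grade_mult[OF a_grade] by (simp add: wprod_def)
qed

lemma wprod_closed: "set w \<subseteq> G \<Longrightarrow> wprod w \<in> carrier A"
  using wprod_grade A.grade_closed by blast

lemma wprod_append: "set u \<subseteq> G \<Longrightarrow> set w \<subseteq> G \<Longrightarrow> wprod (u @ w) = wprod u \<otimes>\<^bsub>A\<^esub> wprod w"
proof (induction u)
  case Nil
  then show ?case using wprod_closed by (simp add: wprod_def)
next
  case (Cons x u)
  have "wprod ((x # u) @ w) = a x \<otimes>\<^bsub>A\<^esub> wprod (u @ w)" by (simp add: wprod_def)
  also have "... = a x \<otimes>\<^bsub>A\<^esub> wprod u \<otimes>\<^bsub>A\<^esub> wprod w"
    using Cons wprod_closed A.grade_closed[OF a_grade, of x] by (simp add: A.m_assoc)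
  finally show ?case by (simp add: wprod_def)
qed

definition "ev f = (\<Oplus>\<^bsub>A\<^esub> w\<in>{w. f w \<noteq> \<zero>}. f w \<odot>\<^bsub>A\<^esub> wprod w)"

text \<open>As with components, sums over the exact supports of different functions have to be
  compared over a common finite set of words.\<close>

lemma ev_superset:
  assumes f: "f \<in> carrier Fr" and S: "finite S" "{w. f w \<noteq> \<zero>} \<subseteq> S" "\<And>w. w \<in> S \<Longrightarrow> set w \<subseteq> G"
  shows "ev f = (\<Oplus>\<^bsub>A\<^esub> w\<in>S. f w \<odot>\<^bsub>A\<^esub> wprod w)"
  unfolding ev_def
  by (rule A.add.finprod_mono_neutral_cong_left) (use assms wprod_closed Fr_closed[OF f] in auto)

lemma ev_closed:
  assumes f: "f \<in> carrier Fr"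
  shows "ev f \<in> carrier A"
  unfolding ev_def by (rule A.finsum_closed) (use f wprod_closed in \<open>auto simp: Fr_carrier\<close>)

lemma ev_add:
  assumes f: "f \<in> carrier Fr" and g: "g \<in> carrier Fr"
  shows "ev (f \<oplus>\<^bsub>Fr\<^esub> g) = ev f \<oplus>\<^bsub>A\<^esub> ev g"
proof -
  let ?S = "{w. f w \<noteq> \<zero>} \<union> {w. g w \<noteq> \<zero>}"
  have fin: "finite ?S" and G: "\<And>w. w \<in> ?S \<Longrightarrow> set w \<subseteq> G" using f g by (auto simp: Fr_carrier)
  have "ev (f \<oplus>\<^bsub>Fr\<^esub> g) = (\<Oplus>\<^bsub>A\<^esub> w\<in>?S. (f \<oplus>\<^bsub>Fr\<^esub> g) w \<odot>\<^bsub>A\<^esub> wprod w)"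
    by (rule ev_superset[OF FrG.a_closed[OF f g] fin _ G]) (auto simp: Fr_simps)
  also have "... = (\<Oplus>\<^bsub>A\<^esub> w\<in>?S. f w \<odot>\<^bsub>A\<^esub> wprod w \<oplus>\<^bsub>A\<^esub> g w \<odot>\<^bsub>A\<^esub> wprod w)"
    by (rule A.finsum_cong') (use G wprod_closed Fr_closed[OF f] Fr_closed[OF g] in \<open>auto simp: Fr_simps AM.smult_l_distr\<close>)
  also have "... = (\<Oplus>\<^bsub>A\<^esub> w\<in>?S. f w \<odot>\<^bsub>A\<^esub> wprod w) \<oplus>\<^bsub>A\<^esub> (\<Oplus>\<^bsub>A\<^esub> w\<in>?S. g w \<odot>\<^bsub>A\<^esub> wprod w)"
    by (rule A.finsum_addf) (use G wprod_closed Fr_closed[OF f] Fr_closed[OF g] in auto)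
  also have "(\<Oplus>\<^bsub>A\<^esub> w\<in>?S. f w \<odot>\<^bsub>A\<^esub> wprod w) = ev f" by (rule ev_superset[OF f fin _ G, symmetric]) auto
  also have "(\<Oplus>\<^bsub>A\<^esub> w\<in>?S. g w \<odot>\<^bsub>A\<^esub> wprod w) = ev g" by (rule ev_superset[OF g fin _ G, symmetric]) auto
  finally show ?thesis .
qed

lemma ev_mono:
  assumes "c \<in> carrier K" "set w \<subseteq> G"
  shows "ev (mono c w) = c \<odot>\<^bsub>A\<^esub> wprod w"
proof -
  have "ev (mono c w) = (\<Oplus>\<^bsub>A\<^esub> u\<in>{w}. mono c w u \<odot>\<^bsub>A\<^esub> wprod u)"
    by (rule ev_superset[OF mono_Fr[OF assms]]) (use assms in \<open>auto simp: mono_def\<close>)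
  then show ?thesis using assms wprod_closed by (simp add: mono_def)
qed

lemma ev_zero: "ev \<zero>\<^bsub>Fr\<^esub> = \<zero>\<^bsub>A\<^esub>"
  by (simp add: ev_def Fr_simps)

lemma ev_smult:
  assumes c: "c \<in> carrier K" and f: "f \<in> carrier Fr"
  shows "ev (c \<odot>\<^bsub>Fr\<^esub> f) = c \<odot>\<^bsub>A\<^esub> ev f"
  using f
proof (induction f rule: free_induct)
  case zero
  then show ?case using c ev_zero by (simp add: Fr_simps)
next
  case (mono w)
  have "c \<odot>\<^bsub>Fr\<^esub> mono (f w) w = mono (c \<otimes> f w) w" using c by (auto simp: Fr_simps mono_def)
  then show ?case using c mono Fr_closed[OF f] wprod_closed by (simp add: ev_mono AM.smult_assoc1)
next
  case (add g h)
  have "c \<odot>\<^bsub>Fr\<^esub> (g \<oplus>\<^bsub>Fr\<^esub> h) = c \<odot>\<^bsub>Fr\<^esub> g \<oplus>\<^bsub>Fr\<^esub> c \<odot>\<^bsub>Fr\<^esub> h"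
    using c add(1,2) Fr_closed by (simp add: Fr_simps K.r_distr)
  moreover have "c \<odot>\<^bsub>Fr\<^esub> g \<in> carrier Fr" "c \<odot>\<^bsub>Fr\<^esub> h \<in> carrier Fr"
    using Fr_smult[OF c] add(1,2) by (simp_all add: Fr_simps)
  ultimately show ?case using add c by (simp add: ev_add ev_closed AM.smult_r_distr)
qed

text \<open>Both sides are additive in each factor, so induction on \<open>f\<close> and then on
  \<open>g\<close> reduces the claim to monomials, where it is concatenation of words.\<close>

lemma ev_mult:
  assumes f: "f \<in> carrier Fr" and g: "g \<in> carrier Fr"
  shows "ev (f \<otimes>\<^bsub>Fr\<^esub> g) = ev f \<otimes>\<^bsub>A\<^esub> ev g"
  using f
proof (induction f rule: free_induct)
  case zero
  then show ?case using ev_zero ev_closed[OF g] Fr.l_null[OF g] by simp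
next
  case (mono w)
  have fw: "f w \<in> carrier K" by (rule Fr_closed[OF f])
  have m: "mono (f w) w \<in> carrier Fr" by (rule mono_Fr[OF fw mono(2)])
  show ?case
    using g
  proof (induction g rule: free_induct)
    case zero
    then show ?case using ev_zero ev_closed[OF m] Fr.r_null[OF m] by simp
  next
    case (mono u)
    have gu: "g u \<in> carrier K" by (rule Fr_closed[OF g])
    have w: "set w \<subseteq> G" by fact
    have "ev (mono (f w) w \<otimes>\<^bsub>Fr\<^esub> mono (g u) u) = (f w \<otimes> g u) \<odot>\<^bsub>A\<^esub> (wprod w \<otimes>\<^bsub>A\<^esub> wprod u)"
      using fw gu w mono(2) by (simp add: Fr_simps conv_mono_mono ev_mono wprod_append)
    also have "... = (f w \<odot>\<^bsub>A\<^esub> wprod w) \<otimes>\<^bsub>A\<^esub> (g u \<odot>\<^bsub>A\<^esub> wprod u)"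
      using fw gu wprod_closed[OF w] wprod_closed[OF mono(2)]
      by (simp add: AM.smult_assoc1[symmetric] smult_mult mult_smult K.m_comm)
    finally show ?case using fw gu w mono(2) by (simp add: ev_mono)
  next
    case (add g h)
    then show ?case using m by (simp add: Fr.r_distr ev_add ev_closed A.r_distr)
  qed
next
  case (add f h)
  then show ?case using g by (simp add: Fr.l_distr ev_add ev_closed A.l_distr)
qed

lemma ev_hom: "ev \<in> ring_hom Fr A"
proof (rule ring_hom_memI)
  have "ev \<one>\<^bsub>Fr\<^esub> = \<one> \<odot>\<^bsub>A\<^esub> wprod []" unfolding Fr_simps by (rule ev_mono) auto
  then show "ev \<one>\<^bsub>Fr\<^esub> = \<one>\<^bsub>A\<^esub>" by (simp add: wprod_def AM.smult_one)
qed (simp_all add: ev_closed ev_add ev_mult)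

lemma ev_grade:
  assumes f: "f \<in> grade Fr n"
  shows "ev f \<in> grade A n"
  using Fr_grade_closed[OF f]
proof (induction f rule: free_induct)
  case zero
  then show ?case by (simp add: ev_zero A.grade_zero)
next
  case (mono w)
  then have "deg w = n" using f by (simp add: Fr_simps)
  then show ?case using mono Fr_closed[OF Fr_grade_closed[OF f]] wprod_grade smult_grade by (auto simp: ev_mono)
next
  case (add g h)
  then show ?case by (simp add: ev_add A.grade_add)
qed

lemma ev_var: "x \<in> G \<Longrightarrow> ev (mono \<one> [x]) = a x"
  using A.grade_closed[OF a_grade] by (simp add: ev_mono wprod_def AM.smult_one)

end

section \<open>Leavitt path algebras\<close>

locale leavitt_path_algebra = K: field K + fin_digraph E
  for K :: "('k, 'z) ring_scheme" (structure) and E :: "('v, 'e) pre_digraph"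

sublocale leavitt_path_algebra \<subseteq> free_alg K "lpa_gens E" gen_degree
  by unfold_locales

context leavitt_path_algebra
begin

abbreviation "Q \<equiv> lpa_ideal K E"
abbreviation "L \<equiv> leavitt K E"
abbreviation "gvar x \<equiv> lpa_var K x"
abbreviation "cl f \<equiv> Q +>\<^bsub>Fr\<^esub> f"

lemma var_mono: "gvar x = mono \<one> [x]"
  by (simp add: lpa_var_def mono_def)

lemma gens [simp]: "Vert v \<in> lpa_gens E \<longleftrightarrow> v \<in> verts E" "Edge e \<in> lpa_gens E \<longleftrightarrow> e \<in> arcs E" "Ghost e \<in> lpa_gens E \<longleftrightarrow> e \<in> arcs E"
  by (auto simp: lpa_gens_def)

lemma var_grade: "x \<in> lpa_gens E \<Longrightarrow> gvar x \<in> grade Fr (gen_degree x)"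
  unfolding var_mono using mono_grade[of \<one> "[x]"] by simp

lemma var_closed: "x \<in> lpa_gens E \<Longrightarrow> gvar x \<in> carrier Fr"
  using var_grade Fr.grade_closed by blast

lemma finite_out_arcs: "finite (out_arcs E v)"
  by (rule finite_subset[OF _ finite_arcs]) auto

section \<open>The ideal of the relations and its quotient\<close>

lemma relations_homogeneous: "(f, g) \<in> lpa_relations K E \<Longrightarrow> \<exists>n. f \<in> grade Fr n \<and> g \<in> grade Fr n"
proof (induction rule: lpa_relations.induct)
  case (vertex_vertex u v)
  then show ?case using Fr.grade_mult[OF var_grade[of "Vert u"] var_grade[of "Vert v"]] var_grade[of "Vert u"] Fr.grade_zero
    by (intro exI[of _ 0]) auto
next
  case (source_edge e)
  then show ?case using Fr.grade_mult[OF var_grade[of "Vert (tail E e)"] var_grade[of "Edge e"]] var_grade[of "Edge e"]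
    by (intro exI[of _ 1]) auto
next
  case (edge_range e)
  then show ?case using Fr.grade_mult[OF var_grade[of "Edge e"] var_grade[of "Vert (head E e)"]] var_grade[of "Edge e"]
    by (intro exI[of _ 1]) auto
next
  case (range_ghost e)
  then show ?case using Fr.grade_mult[OF var_grade[of "Vert (head E e)"] var_grade[of "Ghost e"]] var_grade[of "Ghost e"]
    by (intro exI[of _ "- 1"]) auto
next
  case (ghost_source e)
  then show ?case using Fr.grade_mult[OF var_grade[of "Ghost e"] var_grade[of "Vert (tail E e)"]] var_grade[of "Ghost e"]
    by (intro exI[of _ "- 1"]) auto
next
  case (edge_ghost v)
  have "gvar (Edge e) \<otimes>\<^bsub>Fr\<^esub> gvar (Ghost e) \<in> grade Fr 0" if "e \<in> out_arcs E v" for e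
    using Fr.grade_mult[OF var_grade[of "Edge e"] var_grade[of "Ghost e"]] that by auto
  then have "(\<Oplus>\<^bsub>Fr\<^esub> e\<in>out_arcs E v. gvar (Edge e) \<otimes>\<^bsub>Fr\<^esub> gvar (Ghost e)) \<in> grade Fr 0"
    by (rule Fr.grade_finsum[OF finite_out_arcs])
  then show ?case using edge_ghost var_grade[of "Vert v"] by auto
next
  case (ghost_edge e f)
  then show ?case using Fr.grade_mult[OF var_grade[of "Ghost e"] var_grade[of "Edge f"]] var_grade[of "Vert (head E e)"] Fr.grade_zero
    by (intro exI[of _ 0]) auto
qed

definition "rels = {f \<ominus>\<^bsub>Fr\<^esub> g | f g. (f, g) \<in> lpa_relations K E}"

lemma Q_def: "Q = Idl\<^bsub>Fr\<^esub> rels"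
  by (simp add: lpa_ideal_def rels_def)

lemma rels_homogeneous: "s \<in> rels \<Longrightarrow> \<exists>n. s \<in> grade Fr n"
  using relations_homogeneous Fr.grade_minus unfolding rels_def by blast

lemma rels_closed: "rels \<subseteq> carrier Fr"
  using rels_homogeneous Fr.grade_closed by blast

lemma Q_ideal: "ideal Q Fr"
  unfolding Q_def by (rule Fr.genideal_ideal[OF rels_closed])

lemma Q_component: "f \<in> Q \<Longrightarrow> component Fr n f \<in> Q"
  unfolding Q_def by (rule Fr.component_genideal[OF rels_homogeneous])

sublocale Q: ideal Q Fr by (rule Q_ideal)

abbreviation "FQ \<equiv> Fr Quot Q"

sublocale FQ: ring FQ by (rule Q.quotient_is_ring)

lemma cl_closed: "f \<in> carrier Fr \<Longrightarrow> cl f \<in> carrier FQ"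
  and cl_add: "f \<in> carrier Fr \<Longrightarrow> g \<in> carrier Fr \<Longrightarrow> cl (f \<oplus>\<^bsub>Fr\<^esub> g) = cl f \<oplus>\<^bsub>FQ\<^esub> cl g"
  and cl_mult: "f \<in> carrier Fr \<Longrightarrow> g \<in> carrier Fr \<Longrightarrow> cl (f \<otimes>\<^bsub>Fr\<^esub> g) = cl f \<otimes>\<^bsub>FQ\<^esub> cl g"
  using Q.rcos_ring_hom by (auto simp: ring_hom_def)

lemma cl_eqI:
  assumes "f \<in> carrier Fr" "g \<in> carrier Fr" "f \<ominus>\<^bsub>Fr\<^esub> g \<in> Q"
  shows "cl f = cl g"
proof -
  have "f = (f \<ominus>\<^bsub>Fr\<^esub> g) \<oplus>\<^bsub>Fr\<^esub> g" using assms by (simp add: a_minus_def FrG.a_assoc FrG.l_neg)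
  then have "f \<in> cl g" using assms(3) unfolding a_r_coset_def r_coset_def by auto
  then show ?thesis by (rule Q.a_repr_independence'[OF _ assms(2), symmetric])
qed

lemma cl_mem:
  assumes "f' \<in> cl f" "f \<in> carrier Fr"
  shows "f' \<in> carrier Fr" "cl f' = cl f" "f' \<ominus>\<^bsub>Fr\<^esub> f \<in> Q"
proof -
  obtain i where i: "i \<in> Q" "f' = i \<oplus>\<^bsub>Fr\<^esub> f" using assms(1) unfolding a_r_coset_def r_coset_def by auto
  have ic: "i \<in> carrier Fr" using Q.a_subset i(1) by blast
  show c: "f' \<in> carrier Fr" using i ic assms(2) by simp
  have "f' \<ominus>\<^bsub>Fr\<^esub> f = i" using i ic assms(2) by (simp add: a_minus_def FrG.a_assoc FrG.r_neg)
  then show d: "f' \<ominus>\<^bsub>Fr\<^esub> f \<in> Q" using i by simp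
  show "cl f' = cl f" by (rule cl_eqI[OF c assms(2) d])
qed

lemma cl_self: "f \<in> carrier Fr \<Longrightarrow> f \<in> cl f"
  by (rule Q.a_rcos_self)

lemma cl_zero: "cl \<zero>\<^bsub>Fr\<^esub> = \<zero>\<^bsub>FQ\<^esub>"
  by (rule additive_zero[OF FrG.abelian_group_axioms FQ.abelian_group_axioms]) (use cl_closed cl_add in auto)

lemma cl_finsum:
  assumes "finite S" "f \<in> S \<rightarrow> carrier Fr"
  shows "cl (finsum Fr f S) = (\<Oplus>\<^bsub>FQ\<^esub> i\<in>S. cl (f i))"
  by (rule finsum_additive[where h = "\<lambda>f. cl f"])
    (use assms cl_closed cl_add cl_zero FrG.abelian_monoid_axioms FQ.abelian_monoid_axioms in auto)

lemma cl_relation: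
  assumes "(f, g) \<in> lpa_relations K E"
  shows "cl f = cl g"
proof (rule cl_eqI)
  show "f \<in> carrier Fr" "g \<in> carrier Fr" using relations_homogeneous[OF assms] Fr.grade_closed by auto
  have "f \<ominus>\<^bsub>Fr\<^esub> g \<in> rels" using assms unfolding rels_def by blast
  then show "f \<ominus>\<^bsub>Fr\<^esub> g \<in> Q" unfolding Q_def using Fr.genideal_self[OF rels_closed] by blast
qed

definition "gV v = cl (gvar (Vert v))"
definition "gX e = cl (gvar (Edge e))"
definition "gY e = cl (gvar (Ghost e))"

lemma vertex_eq: "leavitt_vertex K E v = gV v"
  by (simp add: leavitt_vertex_def gV_def)

lemma gVXY_closed:
  "v \<in> verts E \<Longrightarrow> gV v \<in> carrier FQ" "e \<in> arcs E \<Longrightarrow> gX e \<in> carrier FQ" "e \<in> arcs E \<Longrightarrow> gY e \<in> carrier FQ"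
  by (simp_all add: gV_def gX_def gY_def cl_closed var_closed)

text \<open>Recorded first in the quotient of the unital free algebra, which is a ring by general
  theory; \<open>L\<close> is a subset of it with the same operations.\<close>

lemma FQ_relations:
  "u \<in> verts E \<Longrightarrow> v \<in> verts E \<Longrightarrow> gV u \<otimes>\<^bsub>FQ\<^esub> gV v = (if u = v then gV u else \<zero>\<^bsub>FQ\<^esub>)"
  "e \<in> arcs E \<Longrightarrow> gV (tail E e) \<otimes>\<^bsub>FQ\<^esub> gX e = gX e"
  "e \<in> arcs E \<Longrightarrow> gX e \<otimes>\<^bsub>FQ\<^esub> gV (head E e) = gX e"
  "e \<in> arcs E \<Longrightarrow> gV (head E e) \<otimes>\<^bsub>FQ\<^esub> gY e = gY e"
  "e \<in> arcs E \<Longrightarrow> gY e \<otimes>\<^bsub>FQ\<^esub> gV (tail E e) = gY e"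
  "v \<in> verts E \<Longrightarrow> out_arcs E v \<noteq> {} \<Longrightarrow> (\<Oplus>\<^bsub>FQ\<^esub> e\<in>out_arcs E v. gX e \<otimes>\<^bsub>FQ\<^esub> gY e) = gV v"
  "e \<in> arcs E \<Longrightarrow> f \<in> arcs E \<Longrightarrow> gY e \<otimes>\<^bsub>FQ\<^esub> gX f = (if e = f then gV (head E e) else \<zero>\<^bsub>FQ\<^esub>)"
proof -
  show "gV u \<otimes>\<^bsub>FQ\<^esub> gV v = (if u = v then gV u else \<zero>\<^bsub>FQ\<^esub>)" if "u \<in> verts E" "v \<in> verts E"
    using cl_relation[OF lpa_relations.vertex_vertex[of u E v K]] that cl_mult[OF var_closed[of "Vert u"] var_closed[of "Vert v"]]
    by (simp only: gV_def gens if_distrib[of "\<lambda>f. cl f"] cl_zero)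
  show "gV (tail E e) \<otimes>\<^bsub>FQ\<^esub> gX e = gX e" if "e \<in> arcs E"
    using cl_relation[OF lpa_relations.source_edge[OF that, of K]] that cl_mult[OF var_closed[of "Vert (tail E e)"] var_closed[of "Edge e"]]
    by (simp add: gV_def gX_def)
  show "gX e \<otimes>\<^bsub>FQ\<^esub> gV (head E e) = gX e" if "e \<in> arcs E"
    using cl_relation[OF lpa_relations.edge_range[OF that, of K]] that cl_mult[OF var_closed[of "Edge e"] var_closed[of "Vert (head E e)"]]
    by (simp add: gV_def gX_def)
  show "gV (head E e) \<otimes>\<^bsub>FQ\<^esub> gY e = gY e" if "e \<in> arcs E"
    using cl_relation[OF lpa_relations.range_ghost[OF that, of K]] that cl_mult[OF var_closed[of "Vert (head E e)"] var_closed[of "Ghost e"]]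
    by (simp add: gV_def gY_def)
  show "gY e \<otimes>\<^bsub>FQ\<^esub> gV (tail E e) = gY e" if "e \<in> arcs E"
    using cl_relation[OF lpa_relations.ghost_source[OF that, of K]] that cl_mult[OF var_closed[of "Ghost e"] var_closed[of "Vert (tail E e)"]]
    by (simp add: gV_def gY_def)
  show "(\<Oplus>\<^bsub>FQ\<^esub> e\<in>out_arcs E v. gX e \<otimes>\<^bsub>FQ\<^esub> gY e) = gV v" if v: "v \<in> verts E" "out_arcs E v \<noteq> {}"
  proof -
    have xy: "gvar (Edge e) \<in> carrier Fr" "gvar (Ghost e) \<in> carrier Fr" if "e \<in> out_arcs E v" for e
      using that var_closed by auto
    have "gV v = cl (\<Oplus>\<^bsub>Fr\<^esub> e\<in>out_arcs E v. gvar (Edge e) \<otimes>\<^bsub>Fr\<^esub> gvar (Ghost e))"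
      using cl_relation[OF lpa_relations.edge_ghost[OF v, of K]] by (simp add: gV_def)
    also have "... = (\<Oplus>\<^bsub>FQ\<^esub> e\<in>out_arcs E v. cl (gvar (Edge e) \<otimes>\<^bsub>Fr\<^esub> gvar (Ghost e)))"
      by (rule cl_finsum[OF finite_out_arcs]) (use xy in blast)
    also have "... = (\<Oplus>\<^bsub>FQ\<^esub> e\<in>out_arcs E v. gX e \<otimes>\<^bsub>FQ\<^esub> gY e)"
      by (rule FQ.finsum_cong') (use xy cl_closed cl_mult in \<open>auto simp: gX_def gY_def simp del: in_out_arcs_conv\<close>)
    finally show ?thesis by simp
  qed
  show "gY e \<otimes>\<^bsub>FQ\<^esub> gX f = (if e = f then gV (head E e) else \<zero>\<^bsub>FQ\<^esub>)" if "e \<in> arcs E" "f \<in> arcs E"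
    using cl_relation[OF lpa_relations.ghost_edge[OF that, of K]] that cl_mult[OF var_closed[of "Ghost e"] var_closed[of "Edge f"]]
    by (simp only: gV_def gX_def gY_def gens if_distrib[of "\<lambda>f. cl f"] cl_zero)
qed

section \<open>The sum of the vertices as a unit\<close>

abbreviation "U \<equiv> (\<Oplus>\<^bsub>Fr\<^esub> v\<in>verts E. gvar (Vert v))"

lemma U_closed: "U \<in> carrier Fr"
  by (rule FrG.finsum_closed) (use var_closed in auto)

lemma cl_U: "cl U = (\<Oplus>\<^bsub>FQ\<^esub> v\<in>verts E. gV v)"
  unfolding gV_def by (rule cl_finsum) (use var_closed in auto)

lemma U_vertex:
  assumes w: "w \<in> verts E"
  shows "cl U \<otimes>\<^bsub>FQ\<^esub> gV w = gV w" "gV w \<otimes>\<^bsub>FQ\<^esub> cl U = gV w"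
proof -
  have sing: "(\<Oplus>\<^bsub>FQ\<^esub> v\<in>verts E. if w = v then gV w else \<zero>\<^bsub>FQ\<^esub>) = gV w"
    using FQ.add.finprod_singleton[OF w finite_verts, of "\<lambda>_. gV w"] gVXY_closed(1)[OF w] by simp
  have "cl U \<otimes>\<^bsub>FQ\<^esub> gV w = (\<Oplus>\<^bsub>FQ\<^esub> v\<in>verts E. gV v \<otimes>\<^bsub>FQ\<^esub> gV w)"
    unfolding cl_U by (rule FQ.finsum_ldistr) (use gVXY_closed w in auto)
  also have "... = (\<Oplus>\<^bsub>FQ\<^esub> v\<in>verts E. if w = v then gV w else \<zero>\<^bsub>FQ\<^esub>)"
    by (rule FQ.finsum_cong') (use FQ_relations(1) gVXY_closed w in auto)
  finally show "cl U \<otimes>\<^bsub>FQ\<^esub> gV w = gV w" using sing by simp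
  have "gV w \<otimes>\<^bsub>FQ\<^esub> cl U = (\<Oplus>\<^bsub>FQ\<^esub> v\<in>verts E. gV w \<otimes>\<^bsub>FQ\<^esub> gV v)"
    unfolding cl_U by (rule FQ.finsum_rdistr) (use gVXY_closed w in auto)
  also have "... = (\<Oplus>\<^bsub>FQ\<^esub> v\<in>verts E. if w = v then gV w else \<zero>\<^bsub>FQ\<^esub>)"
    by (rule FQ.finsum_cong') (use FQ_relations(1) gVXY_closed w in auto)
  finally show "gV w \<otimes>\<^bsub>FQ\<^esub> cl U = gV w" using sing by simp
qed

lemma U_var:
  assumes "x \<in> lpa_gens E"
  shows "cl U \<otimes>\<^bsub>FQ\<^esub> cl (gvar x) = cl (gvar x)" "cl (gvar x) \<otimes>\<^bsub>FQ\<^esub> cl U = cl (gvar x)"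
proof -
  note c = cl_closed[OF U_closed] gVXY_closed
  have X: "cl U \<otimes>\<^bsub>FQ\<^esub> gX e = gX e" "gX e \<otimes>\<^bsub>FQ\<^esub> cl U = gX e"
    and Y: "cl U \<otimes>\<^bsub>FQ\<^esub> gY e = gY e" "gY e \<otimes>\<^bsub>FQ\<^esub> cl U = gY e" if e: "e \<in> arcs E" for e
  proof -
    have t: "tail E e \<in> verts E" "head E e \<in> verts E" using e by auto
    show "cl U \<otimes>\<^bsub>FQ\<^esub> gX e = gX e"
      using FQ.m_assoc[OF c(1) c(2)[OF t(1)] c(3)[OF e]] FQ_relations(2)[OF e] U_vertex[OF t(1)] by simp
    show "gX e \<otimes>\<^bsub>FQ\<^esub> cl U = gX e"
      using FQ.m_assoc[OF c(3)[OF e] c(2)[OF t(2)] c(1)] FQ_relations(3)[OF e] U_vertex[OF t(2)] by simp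
    show "cl U \<otimes>\<^bsub>FQ\<^esub> gY e = gY e"
      using FQ.m_assoc[OF c(1) c(2)[OF t(2)] c(4)[OF e]] FQ_relations(4)[OF e] U_vertex[OF t(2)] by simp
    show "gY e \<otimes>\<^bsub>FQ\<^esub> cl U = gY e"
      using FQ.m_assoc[OF c(4)[OF e] c(2)[OF t(1)] c(1)] FQ_relations(5)[OF e] U_vertex[OF t(1)] by simp
  qed
  show "cl U \<otimes>\<^bsub>FQ\<^esub> cl (gvar x) = cl (gvar x)" "cl (gvar x) \<otimes>\<^bsub>FQ\<^esub> cl U = cl (gvar x)"
    using assms X Y U_vertex by (cases x; simp add: gV_def gX_def gY_def)+
qed

text \<open>The free algebra without unit. The unit of \<open>L\<close> is \<open>cl U\<close>,
  whereas that of \<open>FQ\<close> is the class of the empty word.\<close>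

definition "F0 = {f \<in> carrier Fr. f [] = \<zero>}"

lemma F0_closed: "f \<in> F0 \<Longrightarrow> f \<in> carrier Fr"
  by (simp add: F0_def)

lemma Fr_minus_apply: "f \<in> carrier Fr \<Longrightarrow> (\<ominus>\<^bsub>Fr\<^esub> f) = (\<lambda>w. \<ominus> f w)"
  by (rule FrG.minus_equality) (use Fr_neg Fr_closed in \<open>simp_all add: Fr_simps K.l_neg\<close>)

lemma F0_ops:
  "f \<in> F0 \<Longrightarrow> g \<in> F0 \<Longrightarrow> f \<oplus>\<^bsub>Fr\<^esub> g \<in> F0" "f \<in> F0 \<Longrightarrow> g \<in> F0 \<Longrightarrow> f \<otimes>\<^bsub>Fr\<^esub> g \<in> F0" "f \<in> F0 \<Longrightarrow> \<ominus>\<^bsub>Fr\<^esub> f \<in> F0"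
  "\<zero>\<^bsub>Fr\<^esub> \<in> F0" "f \<in> F0 \<Longrightarrow> component Fr n f \<in> F0" "c \<in> carrier K \<Longrightarrow> f \<in> F0 \<Longrightarrow> c \<odot>\<^bsub>Fr\<^esub> f \<in> F0"
proof -
  show "f \<oplus>\<^bsub>Fr\<^esub> g \<in> F0" "f \<otimes>\<^bsub>Fr\<^esub> g \<in> F0" if "f \<in> F0" "g \<in> F0"
    using that FrG.a_closed[of f g] Fr.m_closed[of f g] Fr_closed by (auto simp: F0_def Fr_simps(1,4) conv_Nil)
  show "\<ominus>\<^bsub>Fr\<^esub> f \<in> F0" if "f \<in> F0"
    using that FrG.a_inv_closed[of f] by (auto simp: F0_def Fr_minus_apply)
  show "\<zero>\<^bsub>Fr\<^esub> \<in> F0" using FrG.zero_closed by (auto simp: F0_def Fr_simps)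
  show "component Fr n f \<in> F0" if "f \<in> F0"
    using that Fr.component_closed[of f n] by (auto simp: F0_def component_Fr)
  show "c \<odot>\<^bsub>Fr\<^esub> f \<in> F0" if "c \<in> carrier K" "f \<in> F0"
    using that Fr_smult[of c f] by (auto simp: F0_def Fr_simps)
qed

lemma var_F0: "x \<in> lpa_gens E \<Longrightarrow> gvar x \<in> F0"
  using var_closed by (auto simp: F0_def lpa_var_def)

lemma U_F0: "U \<in> F0"
proof -
  have "finite S \<Longrightarrow> S \<subseteq> verts E \<Longrightarrow> (\<Oplus>\<^bsub>Fr\<^esub> v\<in>S. gvar (Vert v)) \<in> F0" for S
  proof (induction S rule: finite_induct)
    case (insert v S)
    then have "(\<lambda>v. gvar (Vert v)) \<in> S \<rightarrow> carrier Fr" "gvar (Vert v) \<in> carrier Fr" using var_closed by auto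
    then show ?case using insert F0_ops(1)[OF var_F0, of "Vert v"] by simp
  qed (simp add: F0_ops)
  then show ?thesis by simp
qed

lemma mono_append:
  assumes "c \<in> carrier K"
  shows "mono c (x # w) = gvar x \<otimes>\<^bsub>Fr\<^esub> mono c w" "mono c (w @ [x]) = mono c w \<otimes>\<^bsub>Fr\<^esub> gvar x"
  using assms by (simp_all add: var_mono Fr_simps conv_mono_mono)

text \<open>A nonempty word begins and ends with a generator, and every generator absorbs
  \<open>U\<close> on either side: the first letter settles the left unit, the last letter the right
  one. \<open>F0\<close> excludes the empty word.\<close>

lemma U_unit:
  assumes f: "f \<in> F0"
  shows "cl U \<otimes>\<^bsub>FQ\<^esub> cl f = cl f" "cl f \<otimes>\<^bsub>FQ\<^esub> cl U = cl f"
proof -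
  have "cl U \<otimes>\<^bsub>FQ\<^esub> cl f = cl f \<and> cl f \<otimes>\<^bsub>FQ\<^esub> cl U = cl f"
    using F0_closed[OF f]
  proof (induction f rule: free_induct)
    case zero
    then show ?case using cl_closed[OF U_closed] cl_zero by simp
  next
    case (mono w)
    have w: "w \<noteq> []" using mono(1) f by (auto simp: F0_def)
    have c: "f w \<in> carrier K" using Fr_closed[OF F0_closed[OF f]] .
    obtain x v where xv: "w = x # v" using w by (cases w) auto
    obtain y u where yu: "w = u @ [y]" using w by (cases w rule: rev_cases) auto
    have x: "x \<in> lpa_gens E" "set v \<subseteq> lpa_gens E" using mono(2) xv by auto
    have y: "y \<in> lpa_gens E" "set u \<subseteq> lpa_gens E" using mono(2) yu by auto
    have "cl U \<otimes>\<^bsub>FQ\<^esub> cl (local.mono (f w) w) = cl (local.mono (f w) w)"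
    proof -
      have e: "cl (local.mono (f w) w) = cl (gvar x) \<otimes>\<^bsub>FQ\<^esub> cl (local.mono (f w) v)"
        using mono_append(1)[OF c, of x v] cl_mult[OF var_closed[OF x(1)] mono_Fr[OF c x(2)]] by (simp add: xv)
      show ?thesis unfolding e
        using FQ.m_assoc[OF cl_closed[OF U_closed] cl_closed[OF var_closed[OF x(1)]] cl_closed[OF mono_Fr[OF c x(2)]]]
          U_var(1)[OF x(1)] by simp
    qed
    moreover have "cl (local.mono (f w) w) \<otimes>\<^bsub>FQ\<^esub> cl U = cl (local.mono (f w) w)"
    proof -
      have e: "cl (local.mono (f w) w) = cl (local.mono (f w) u) \<otimes>\<^bsub>FQ\<^esub> cl (gvar y)"
        using mono_append(2)[OF c, of u y] cl_mult[OF mono_Fr[OF c y(2)] var_closed[OF y(1)]] by (simp add: yu)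
      show ?thesis unfolding e
        using FQ.m_assoc[OF cl_closed[OF mono_Fr[OF c y(2)]] cl_closed[OF var_closed[OF y(1)]] cl_closed[OF U_closed]]
          U_var(2)[OF y(1)] by simp
    qed
    ultimately show ?case ..
  next
    case (add g h)
    then show ?case using cl_closed U_closed by (simp add: cl_add FQ.l_distr FQ.r_distr)
  qed
  then show "cl U \<otimes>\<^bsub>FQ\<^esub> cl f = cl f" "cl f \<otimes>\<^bsub>FQ\<^esub> cl U = cl f" by auto
qed

section \<open>The Leavitt path algebra as a graded ring\<close>

lemma L_simps:
  "carrier L = {cl f | f. f \<in> F0}" "a \<otimes>\<^bsub>L\<^esub> b = a \<otimes>\<^bsub>FQ\<^esub> b" "\<one>\<^bsub>L\<^esub> = cl U" "\<zero>\<^bsub>L\<^esub> = \<zero>\<^bsub>FQ\<^esub>" "a \<oplus>\<^bsub>L\<^esub> b = a \<oplus>\<^bsub>FQ\<^esub> b"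
  "c \<odot>\<^bsub>L\<^esub> a = (\<Union>f\<in>a. cl (c \<odot>\<^bsub>Fr\<^esub> f))" "grade L n = {cl f | f. f \<in> grade Fr n \<and> f \<in> F0}"
  using Fr.grade_closed by (auto simp: leavitt_def Let_def F0_def)

lemma L_subset: "a \<in> carrier L \<Longrightarrow> a \<in> carrier FQ"
  using cl_closed F0_closed by (auto simp: L_simps)

lemma L_cl: "f \<in> F0 \<Longrightarrow> cl f \<in> carrier L"
  by (auto simp: L_simps)

lemma L_E:
  assumes "a \<in> carrier L" obtains f where "f \<in> F0" "a = cl f"
  using assms by (auto simp: L_simps)

lemma L_add: "f \<in> F0 \<Longrightarrow> g \<in> F0 \<Longrightarrow> cl f \<oplus>\<^bsub>L\<^esub> cl g = cl (f \<oplus>\<^bsub>Fr\<^esub> g)"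
  and L_mult: "f \<in> F0 \<Longrightarrow> g \<in> F0 \<Longrightarrow> cl f \<otimes>\<^bsub>L\<^esub> cl g = cl (f \<otimes>\<^bsub>Fr\<^esub> g)"
  by (simp_all add: L_simps cl_add cl_mult F0_closed)

lemma L_a_closed: "a \<in> carrier L \<Longrightarrow> b \<in> carrier L \<Longrightarrow> a \<oplus>\<^bsub>L\<^esub> b \<in> carrier L"
  and L_m_closed: "a \<in> carrier L \<Longrightarrow> b \<in> carrier L \<Longrightarrow> a \<otimes>\<^bsub>L\<^esub> b \<in> carrier L"
  by (elim L_E, simp add: L_add L_mult L_cl F0_ops)+

lemma cl_neg: "f \<in> F0 \<Longrightarrow> cl (\<ominus>\<^bsub>Fr\<^esub> f) \<oplus>\<^bsub>L\<^esub> cl f = \<zero>\<^bsub>L\<^esub>"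
  using L_add[OF F0_ops(3), of f f] F0_closed[of f] by (simp add: FrG.l_neg cl_zero L_simps)

lemma L_abelian_group: "abelian_group L"
proof (rule abelian_groupI)
  fix a assume "a \<in> carrier L"
  then obtain f where f: "f \<in> F0" "a = cl f" by (rule L_E)
  show "\<exists>b\<in>carrier L. b \<oplus>\<^bsub>L\<^esub> a = \<zero>\<^bsub>L\<^esub>"
    by (rule bexI[of _ "cl (\<ominus>\<^bsub>Fr\<^esub> f)"]) (use f cl_neg L_cl F0_ops in auto)
next
  show "\<zero>\<^bsub>L\<^esub> \<in> carrier L" using L_cl[OF F0_ops(4)] cl_zero by (simp add: L_simps(4))
qed (use L_a_closed L_subset FQ.a_ac in \<open>auto simp: L_simps(4,5)\<close>)

lemma L_ring: "ring L"
proof (rule ringI[OF L_abelian_group])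
  show "monoid L"
  proof (rule monoidI)
    show "\<one>\<^bsub>L\<^esub> \<in> carrier L" unfolding L_simps(3) by (rule L_cl[OF U_F0])
    show "\<one>\<^bsub>L\<^esub> \<otimes>\<^bsub>L\<^esub> a = a" "a \<otimes>\<^bsub>L\<^esub> \<one>\<^bsub>L\<^esub> = a" if "a \<in> carrier L" for a
      using that U_unit by (auto elim!: L_E simp: L_simps(2,3))
  qed (use L_m_closed L_subset FQ.m_assoc in \<open>auto simp: L_simps(2)\<close>)
qed (use L_subset FQ.l_distr FQ.r_distr in \<open>auto simp: L_simps(2,5)\<close>)

text \<open>The projections are defined through representatives. This is legitimate because the
  ideal contains the components of its elements.\<close>

lemma L_graded_ring: "graded_ring L"
proof -
  interpret ring L by (rule L_ring)
  define pr where "pr = (\<lambda>n a. cl (component Fr n (SOME f. f \<in> a)))"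
  have pr: "pr n (cl f) = cl (component Fr n f)" if f: "f \<in> carrier Fr" for n f
  proof -
    define f' where "f' = (SOME g. g \<in> cl f)"
    have "f' \<in> cl f" unfolding f'_def by (rule someI[of _ f]) (rule cl_self[OF f])
    note f' = cl_mem[OF this f]
    have "component Fr n (f' \<ominus>\<^bsub>Fr\<^esub> f) = component Fr n f' \<ominus>\<^bsub>Fr\<^esub> component Fr n f"
      unfolding a_minus_def Fr.component_add[OF f'(1) FrG.a_inv_closed[OF f]] Fr.component_neg[OF f] ..
    then have "component Fr n f' \<ominus>\<^bsub>Fr\<^esub> component Fr n f \<in> Q" using Q_component[OF f'(3), of n] by simp
    then have "cl (component Fr n f') = cl (component Fr n f)"
      by (rule cl_eqI[OF Fr.component_closed[OF f'(1)] Fr.component_closed[OF f]])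
    then show ?thesis by (simp add: pr_def f'_def)
  qed
  have "is_grading L"
  proof (rule is_gradingI[where pr = pr, OF L_abelian_group])
    show "additive_subgroup (grade L n) L" for n
    proof (rule additive_subgroupI2)
      show "grade L n \<subseteq> carrier L" by (auto simp: L_simps)
      show "\<zero>\<^bsub>L\<^esub> \<in> grade L n" using F0_ops(4) Fr.grade_zero cl_zero by (fastforce simp: L_simps)
      show "a \<oplus>\<^bsub>L\<^esub> b \<in> grade L n" if ab: "a \<in> grade L n" "b \<in> grade L n" for a b
      proof -
        obtain f g where fg: "f \<in> grade Fr n" "f \<in> F0" "a = cl f" "g \<in> grade Fr n" "g \<in> F0" "b = cl g"
          using ab by (auto simp: L_simps(7))
        then show ?thesis using Fr.grade_add[OF fg(1,4)] F0_ops(1)[OF fg(2,5)] by (auto simp: L_add L_simps(7))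
      qed
      show "\<exists>b\<in>grade L n. b \<oplus>\<^bsub>L\<^esub> a = \<zero>\<^bsub>L\<^esub>" if a: "a \<in> grade L n" for a
      proof -
        obtain f where f: "f \<in> grade Fr n" "f \<in> F0" "a = cl f" using a by (auto simp: L_simps(7))
        then have "cl (\<ominus>\<^bsub>Fr\<^esub> f) \<in> grade L n" using Fr.grade_neg[OF f(1)] F0_ops(3)[OF f(2)] by (auto simp: L_simps(7))
        then show ?thesis using cl_neg[OF f(2)] f(3) by blast
      qed
    qed
    show "pr n a \<in> grade L n" if "a \<in> carrier L" for n a
      using that by (elim L_E) (auto simp: pr F0_closed L_simps(7) F0_ops Fr.component_decomp(1))
    show "pr n (a \<oplus>\<^bsub>L\<^esub> b) = pr n a \<oplus>\<^bsub>L\<^esub> pr n b" if "a \<in> carrier L" "b \<in> carrier L" for n a b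
      using that by (elim L_E) (simp add: L_add pr F0_closed F0_ops Fr.component_add)
    show "pr m a = (if m = n then a else \<zero>\<^bsub>L\<^esub>)" if "a \<in> grade L n" for m n a
      using that by (auto simp: L_simps(4,7) pr Fr.grade_closed Fr.component_grade cl_zero)
    show "finite {n. pr n a \<noteq> \<zero>\<^bsub>L\<^esub>}" if a: "a \<in> carrier L" for a
    proof -
      obtain f where f: "f \<in> F0" "a = cl f" using a by (rule L_E)
      have "pr n a = \<zero>\<^bsub>L\<^esub>" if "component Fr n f = \<zero>\<^bsub>Fr\<^esub>" for n
        unfolding f(2) pr[OF F0_closed[OF f(1)]] that cl_zero L_simps(4) ..
      then have "{n. pr n a \<noteq> \<zero>\<^bsub>L\<^esub>} \<subseteq> {n. component Fr n f \<noteq> \<zero>\<^bsub>Fr\<^esub>}" by blast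
      then show ?thesis by (rule finite_subset) (rule Fr.component_decomp(2)[OF F0_closed[OF f(1)]])
    qed
    show "a = \<zero>\<^bsub>L\<^esub>" if a: "a \<in> carrier L" and 0: "\<And>n. pr n a = \<zero>\<^bsub>L\<^esub>" for a
    proof -
      obtain f where f: "f \<in> F0" "a = cl f" using a by (rule L_E)
      note fc = F0_closed[OF f(1)]
      have z: "cl (component Fr n f) = \<zero>\<^bsub>FQ\<^esub>" for n using 0[of n] pr[OF fc] f(2) by (simp add: L_simps(4))
      have "a = cl (\<Oplus>\<^bsub>Fr\<^esub> n\<in>{n. component Fr n f \<noteq> \<zero>\<^bsub>Fr\<^esub>}. component Fr n f)"
        using Fr.component_decomp(3)[OF fc] f(2) by simp
      also have "... = (\<Oplus>\<^bsub>FQ\<^esub> n\<in>{n. component Fr n f \<noteq> \<zero>\<^bsub>Fr\<^esub>}. cl (component Fr n f))"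
        by (rule cl_finsum[OF Fr.component_decomp(2)[OF fc]]) (use Fr.component_closed[OF fc] in blast)
      also have "... = \<zero>\<^bsub>FQ\<^esub>" by (simp add: z)
      finally show ?thesis by (simp add: L_simps(4))
    qed
  qed
  moreover have "a \<otimes>\<^bsub>L\<^esub> b \<in> grade L (m + n)" if ab: "a \<in> grade L m" "b \<in> grade L n" for a b m n
  proof -
    obtain f g where fg: "f \<in> grade Fr m" "f \<in> F0" "a = cl f" "g \<in> grade Fr n" "g \<in> F0" "b = cl g"
      using ab by (auto simp: L_simps(7))
    then show ?thesis using Fr.grade_mult[OF fg(1,4)] F0_ops(2)[OF fg(2,5)] by (auto simp: L_mult L_simps(7))
  qed
  ultimately show ?thesis by unfold_locales
qed

sublocale L: graded_ring L by (rule L_graded_ring)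

text \<open>Scalars act as multiplication by a multiple of the empty word, so all representatives of
  a coset give the same result.\<close>

lemma L_smult:
  assumes c: "c \<in> carrier K" and f: "f \<in> carrier Fr"
  shows "c \<odot>\<^bsub>L\<^esub> cl f = cl (c \<odot>\<^bsub>Fr\<^esub> f)"
proof -
  have sm: "c \<odot>\<^bsub>Fr\<^esub> g = mono c [] \<otimes>\<^bsub>Fr\<^esub> g" if "g \<in> carrier Fr" for g
    using conv_mono_Nil[of g c] Fr_closed[OF that] c by (simp add: Fr_simps)
  have m: "mono c [] \<in> carrier Fr" by (rule mono_Fr) (use c in auto)
  have "cl (c \<odot>\<^bsub>Fr\<^esub> g) = cl (c \<odot>\<^bsub>Fr\<^esub> f)" if "g \<in> cl f" for g
    using cl_mem[OF that f] by (simp add: sm f cl_mult m)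
  then show ?thesis unfolding L_simps(6) using cl_self[OF f] by blast
qed

text \<open>\<open>L\<close> and \<open>FQ\<close> share their addition, but \<open>finsum\<close>
  depends on the record; the relation at a vertex and the formula for the unit are transferred by
  this.\<close>

lemma L_finsum:
  assumes "finite S" "g \<in> S \<rightarrow> carrier L"
  shows "finsum L g S = finsum FQ g S"
  using finsum_additive[where h = "\<lambda>a. a", of L FQ S g] assms L_subset L.abelian_monoid_axioms FQ.abelian_monoid_axioms
  by (auto simp: L_simps(4,5))

lemma gVXY_grade:
  "v \<in> verts E \<Longrightarrow> gV v \<in> grade L 0" "e \<in> arcs E \<Longrightarrow> gX e \<in> grade L 1" "e \<in> arcs E \<Longrightarrow> gY e \<in> grade L (- 1)"
  using var_grade[of "Vert v"] var_grade[of "Edge e"] var_grade[of "Ghost e"] var_F0[of "Vert v"] var_F0[of "Edge e"] var_F0[of "Ghost e"]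
  by (auto simp: L_simps(7) gV_def gX_def gY_def)

lemma L_family: "leavitt_family L E gV gX gY"
proof -
  note c = gVXY_grade[THEN L.grade_closed]
  have o: "e \<in> arcs E" if "e \<in> out_arcs E v" for e v using that by auto
  have "(\<Oplus>\<^bsub>L\<^esub> v\<in>verts E. gV v) = \<one>\<^bsub>L\<^esub>"
    using L_finsum[of "verts E" gV] c by (auto simp: cl_U L_simps(3))
  moreover have "(\<Oplus>\<^bsub>L\<^esub> e\<in>out_arcs E v. gX e \<otimes>\<^bsub>L\<^esub> gY e) = gV v" if "v \<in> verts E" "out_arcs E v \<noteq> {}" for v
    using L_finsum[of "out_arcs E v" "\<lambda>e. gX e \<otimes>\<^bsub>L\<^esub> gY e"] finite_out_arcs FQ_relations(6)[OF that] c(2,3)[OF o] L.m_closed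
    by (auto simp: L_simps(2) Pi_def simp del: in_out_arcs_conv)
  ultimately show ?thesis
    by unfold_locales (use gVXY_grade FQ_relations in \<open>auto simp: L_simps(2,4) grade0_idempotent_def\<close>)
qed

sublocale LF: leavitt_family L E gV gX gY by (rule L_family)

lemma talented_to_Vgr_theta: "talented_to_Vgr K E = LF.theta"
  unfolding talented_to_Vgr_def vertex_eq by (rule LF.theta_unique)

end

section \<open>The universal property\<close>

locale leavitt_target = leavitt_path_algebra K E + T: leavitt_family A E p x y
  for K :: "('k, 'z) ring_scheme" (structure) and E :: "('v, 'e) pre_digraph" and A :: "('k, 'a) gmodule" and p x y +
  assumes algebra: "graded_algebra K A"
begin

definition img where "img g = (case g of Vert v \<Rightarrow> p v | Edge e \<Rightarrow> x e | Ghost e \<Rightarrow> y e)"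

sublocale ev: free_alg_eval K "lpa_gens E" gen_degree A img
proof -
  interpret AM: module K A using algebra by (simp add: graded_algebra_def)
  have "img g \<in> grade A (gen_degree g)" if "g \<in> lpa_gens E" for g
    using that T.p_idem T.x_grade T.y_grade by (cases g) (auto simp: img_def grade0_idempotent_def)
  then show "free_alg_eval K (lpa_gens E) gen_degree A img"
    using algebra T.graded_ring_axioms K.cring_axioms AM.module_axioms
    by (simp add: free_alg_eval_def free_alg_def free_alg_eval_axioms_def graded_algebra_def)
qed

lemma ev_var: "g \<in> lpa_gens E \<Longrightarrow> ev.ev (gvar g) = img g"
  unfolding var_mono by (rule ev.ev_var)

text \<open>Each relation is mirrored by an assumption of \<open>leavitt_family\<close>; only the
  sum over outgoing edges needs to be moved through the evaluation.\<close>

lemma ev_relation: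
  assumes "(f, g) \<in> lpa_relations K E"
  shows "ev.ev f = ev.ev g"
  using assms
proof cases
  case (edge_ghost v)
  have o: "e \<in> arcs E" if "e \<in> out_arcs E v" for e using that by auto
  have xy: "gvar (Edge e) \<in> carrier Fr" "gvar (Ghost e) \<in> carrier Fr" if "e \<in> out_arcs E v" for e
    using that var_closed by auto
  have "ev.ev f = (\<Oplus>\<^bsub>A\<^esub> e\<in>out_arcs E v. ev.ev (gvar (Edge e) \<otimes>\<^bsub>Fr\<^esub> gvar (Ghost e)))"
    unfolding edge_ghost(1)
    by (rule finsum_additive[where h = ev.ev, OF _ _ finite_out_arcs])
      (use xy ev.ev_closed ev.ev_add ev.ev_zero FrG.abelian_monoid_axioms T.abelian_monoid_axioms in \<open>auto simp del: in_out_arcs_conv\<close>)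
  also have "... = (\<Oplus>\<^bsub>A\<^esub> e\<in>out_arcs E v. x e \<otimes>\<^bsub>A\<^esub> y e)"
    by (rule T.finsum_cong')
      (use xy o T.x_closed T.y_closed in \<open>auto simp: ev.ev_mult ev_var img_def simp del: in_out_arcs_conv\<close>)
  also have "... = p v" by (rule T.x_y[OF edge_ghost(3,4)])
  finally show ?thesis using edge_ghost by (simp add: ev_var img_def)
qed (use T.p_idem T.p_orth T.p_x T.x_p T.p_y T.y_p T.y_x in
    \<open>auto simp: ev.ev_mult var_closed ev_var img_def ev.ev_zero grade0_idempotent_def\<close>)

sublocale evh: ring_hom_ring Fr A ev.ev
  by (rule ring_hom_ringI2[OF Fr.ring_axioms T.ring_axioms ev.ev_hom])

lemma ev_Q: "f \<in> Q \<Longrightarrow> ev.ev f = \<zero>\<^bsub>A\<^esub>"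
proof -
  have "rels \<subseteq> a_kernel Fr A ev.ev"
  proof
    fix r assume r: "r \<in> rels"
    then obtain f g where fg: "(f, g) \<in> lpa_relations K E" "r = f \<ominus>\<^bsub>Fr\<^esub> g" unfolding rels_def by blast
    have c: "f \<in> carrier Fr" "g \<in> carrier Fr" using relations_homogeneous[OF fg(1)] Fr.grade_closed by auto
    have "ev.ev r = ev.ev f \<ominus>\<^bsub>A\<^esub> ev.ev g" using c fg(2) by (simp add: a_minus_def)
    then have "ev.ev r = \<zero>\<^bsub>A\<^esub>" using ev_relation[OF fg(1)] ev.ev_closed[OF c(2)] by (simp add: a_minus_def T.r_neg)
    then show "r \<in> a_kernel Fr A ev.ev" unfolding a_kernel_def' using r rels_closed by blast
  qed
  then have "Q \<subseteq> a_kernel Fr A ev.ev" unfolding Q_def by (rule Fr.genideal_minimal[OF evh.kernel_is_ideal])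
  then show "f \<in> Q \<Longrightarrow> ev.ev f = \<zero>\<^bsub>A\<^esub>" unfolding a_kernel_def' by blast
qed

definition "psi a = ev.ev (SOME f. f \<in> a)"

lemma psi_cl:
  assumes f: "f \<in> carrier Fr"
  shows "psi (cl f) = ev.ev f"
proof -
  define f' where "f' = (SOME g. g \<in> cl f)"
  have "f' \<in> cl f" unfolding f'_def by (rule someI[of _ f]) (rule cl_self[OF f])
  note f' = cl_mem[OF this f]
  have "ev.ev f' \<ominus>\<^bsub>A\<^esub> ev.ev f = \<zero>\<^bsub>A\<^esub>" using ev_Q[OF f'(3)] f'(1) f by (simp add: a_minus_def)
  then have "ev.ev f' = ev.ev f" using ev.ev_closed f f'(1) by simp
  then show ?thesis by (simp add: psi_def f'_def)
qed

lemma psi_gen: "v \<in> verts E \<Longrightarrow> psi (gV v) = p v" "e \<in> arcs E \<Longrightarrow> psi (gX e) = x e" "e \<in> arcs E \<Longrightarrow> psi (gY e) = y e"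
  by (simp_all add: gV_def gX_def gY_def psi_cl var_closed ev_var img_def)

text \<open>The unit of \<open>L\<close> is the sum of the vertices, so unitality amounts to
  \<open>p_one\<close>.\<close>

lemma psi_one: "psi \<one>\<^bsub>L\<^esub> = \<one>\<^bsub>A\<^esub>"
proof -
  have "psi \<one>\<^bsub>L\<^esub> = (\<Oplus>\<^bsub>A\<^esub> v\<in>verts E. ev.ev (gvar (Vert v)))"
    unfolding L_simps(3) psi_cl[OF U_closed]
    by (rule finsum_additive[where h = ev.ev])
      (use var_closed ev.ev_closed ev.ev_add ev.ev_zero FrG.abelian_monoid_axioms T.abelian_monoid_axioms in auto)
  also have "... = (\<Oplus>\<^bsub>A\<^esub> v\<in>verts E. p v)"
    by (rule T.finsum_cong') (use T.p_closed in \<open>auto simp: ev_var img_def\<close>)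
  finally show ?thesis using T.p_one by simp
qed

lemma psi_smult: "c \<in> carrier K \<Longrightarrow> a \<in> carrier L \<Longrightarrow> psi (c \<odot>\<^bsub>L\<^esub> a) = c \<odot>\<^bsub>A\<^esub> psi a"
  by (elim L_E) (simp add: L_smult F0_closed psi_cl F0_ops ev.ev_smult)

lemma psi_ring_hom: "psi \<in> ring_hom L A"
proof (rule ring_hom_memI)
  fix a b assume a: "a \<in> carrier L" and b: "b \<in> carrier L"
  obtain f where f: "f \<in> F0" "a = cl f" using a by (rule L_E)
  obtain g where g: "g \<in> F0" "b = cl g" using b by (rule L_E)
  note fg = F0_closed[OF f(1)] F0_closed[OF g(1)]
  show "psi a \<in> carrier A" using fg f ev.ev_closed by (simp add: psi_cl)
  show "psi (a \<otimes>\<^bsub>L\<^esub> b) = psi a \<otimes>\<^bsub>A\<^esub> psi b" using fg f g by (simp add: L_mult psi_cl ev.ev_mult)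
  show "psi (a \<oplus>\<^bsub>L\<^esub> b) = psi a \<oplus>\<^bsub>A\<^esub> psi b" using fg f g by (simp add: L_add psi_cl ev.ev_add)
qed (rule psi_one)

lemma psi_grade: "a \<in> grade L n \<Longrightarrow> psi a \<in> grade A n"
  by (auto simp: L_simps(7) psi_cl Fr.grade_closed ev.ev_grade)

lemma psi_hom: "psi \<in> graded_algebra_hom K L A"
  using psi_ring_hom psi_smult psi_grade by (auto simp: graded_algebra_hom_def)

end

section \<open>The graded uniqueness theorem\<close>

context leavitt_path_algebra
begin

section \<open>Scalars and products of generators\<close>

lemma L_gens_closed: "v \<in> verts E \<Longrightarrow> gV v \<in> carrier L" "e \<in> arcs E \<Longrightarrow> gX e \<in> carrier L" "e \<in> arcs E \<Longrightarrow> gY e \<in> carrier L"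
  using LF.p_closed LF.x_closed LF.y_closed by auto

lemma L_smult_closed: "c \<in> carrier K \<Longrightarrow> a \<in> carrier L \<Longrightarrow> c \<odot>\<^bsub>L\<^esub> a \<in> carrier L"
  by (elim L_E) (simp add: L_smult F0_closed F0_ops L_cl)

lemma L_smult_mult:
  assumes c: "c \<in> carrier K" and a: "a \<in> carrier L" and b: "b \<in> carrier L"
  shows "(c \<odot>\<^bsub>L\<^esub> a) \<otimes>\<^bsub>L\<^esub> b = c \<odot>\<^bsub>L\<^esub> (a \<otimes>\<^bsub>L\<^esub> b)" "a \<otimes>\<^bsub>L\<^esub> (c \<odot>\<^bsub>L\<^esub> b) = c \<odot>\<^bsub>L\<^esub> (a \<otimes>\<^bsub>L\<^esub> b)"
proof -
  obtain f where f: "f \<in> F0" "a = cl f" using a by (rule L_E)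
  obtain g where g: "g \<in> F0" "b = cl g" using b by (rule L_E)
  note fc = F0_closed[OF f(1)] and gc = F0_closed[OF g(1)]
  have "(c \<odot>\<^bsub>Fr\<^esub> f) \<otimes>\<^bsub>Fr\<^esub> g = c \<odot>\<^bsub>Fr\<^esub> (f \<otimes>\<^bsub>Fr\<^esub> g)" "f \<otimes>\<^bsub>Fr\<^esub> (c \<odot>\<^bsub>Fr\<^esub> g) = c \<odot>\<^bsub>Fr\<^esub> (f \<otimes>\<^bsub>Fr\<^esub> g)"
    using c Fr_closed[OF fc] Fr_closed[OF gc] by (auto simp: Fr_simps conv_smult_left conv_smult_right fun_eq_iff)
  then show "(c \<odot>\<^bsub>L\<^esub> a) \<otimes>\<^bsub>L\<^esub> b = c \<odot>\<^bsub>L\<^esub> (a \<otimes>\<^bsub>L\<^esub> b)" "a \<otimes>\<^bsub>L\<^esub> (c \<odot>\<^bsub>L\<^esub> b) = c \<odot>\<^bsub>L\<^esub> (a \<otimes>\<^bsub>L\<^esub> b)"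
    using c f g fc gc by (simp_all add: L_smult L_mult F0_ops)
qed

lemma L_smult_zero: "c \<in> carrier K \<Longrightarrow> c \<odot>\<^bsub>L\<^esub> \<zero>\<^bsub>L\<^esub> = \<zero>\<^bsub>L\<^esub>" "a \<in> carrier L \<Longrightarrow> \<zero> \<odot>\<^bsub>L\<^esub> a = \<zero>\<^bsub>L\<^esub>"
proof -
  have z: "c \<odot>\<^bsub>Fr\<^esub> \<zero>\<^bsub>Fr\<^esub> = \<zero>\<^bsub>Fr\<^esub>" if "c \<in> carrier K" for c using that by (simp add: Fr_simps)
  show "c \<in> carrier K \<Longrightarrow> c \<odot>\<^bsub>L\<^esub> \<zero>\<^bsub>L\<^esub> = \<zero>\<^bsub>L\<^esub>"
    using L_smult[OF _ FrG.zero_closed, of c] z[of c] cl_zero by (simp add: L_simps(4))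
  have "\<zero> \<odot>\<^bsub>Fr\<^esub> f = \<zero>\<^bsub>Fr\<^esub>" if "f \<in> carrier Fr" for f using Fr_closed[OF that] by (simp add: Fr_simps)
  then show "a \<in> carrier L \<Longrightarrow> \<zero> \<odot>\<^bsub>L\<^esub> a = \<zero>\<^bsub>L\<^esub>"
    by (elim L_E) (simp add: L_smult F0_closed cl_zero L_simps(4))
qed

lemma L_smult_add:
  "c \<in> carrier K \<Longrightarrow> d \<in> carrier K \<Longrightarrow> a \<in> carrier L \<Longrightarrow> (c \<oplus> d) \<odot>\<^bsub>L\<^esub> a = c \<odot>\<^bsub>L\<^esub> a \<oplus>\<^bsub>L\<^esub> d \<odot>\<^bsub>L\<^esub> a"
proof (elim L_E)
  fix f assume cd: "c \<in> carrier K" "d \<in> carrier K" and f: "f \<in> F0" "a = cl f"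
  have "(c \<oplus> d) \<odot>\<^bsub>Fr\<^esub> f = c \<odot>\<^bsub>Fr\<^esub> f \<oplus>\<^bsub>Fr\<^esub> d \<odot>\<^bsub>Fr\<^esub> f"
    using cd Fr_closed[OF F0_closed[OF f(1)]] by (simp add: Fr_simps K.l_distr)
  then show ?thesis using cd f by (simp add: L_smult F0_closed L_add F0_ops)
qed

lemma gen_products:
  assumes "v \<in> verts E" "e \<in> arcs E"
  shows "gV v \<otimes>\<^bsub>L\<^esub> gX e = (if v = tail E e then gX e else \<zero>\<^bsub>L\<^esub>)"
    "gX e \<otimes>\<^bsub>L\<^esub> gV v = (if v = head E e then gX e else \<zero>\<^bsub>L\<^esub>)"
    "gV v \<otimes>\<^bsub>L\<^esub> gY e = (if v = head E e then gY e else \<zero>\<^bsub>L\<^esub>)"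
    "gY e \<otimes>\<^bsub>L\<^esub> gV v = (if v = tail E e then gY e else \<zero>\<^bsub>L\<^esub>)"
proof -
  note c = L_gens_closed
  have t: "tail E e \<in> verts E" "head E e \<in> verts E" using assms(2) by auto
  note o = LF.p_orth
  show "gV v \<otimes>\<^bsub>L\<^esub> gX e = (if v = tail E e then gX e else \<zero>\<^bsub>L\<^esub>)"
    using L.m_assoc[OF c(1)[OF assms(1)] c(1)[OF t(1)] c(2)[OF assms(2)]] LF.p_x[OF assms(2)] o[OF assms(1) t(1)] c(2)[OF assms(2)] by auto
  show "gX e \<otimes>\<^bsub>L\<^esub> gV v = (if v = head E e then gX e else \<zero>\<^bsub>L\<^esub>)"
    using L.m_assoc[OF c(2)[OF assms(2)] c(1)[OF t(2)] c(1)[OF assms(1)]] LF.x_p[OF assms(2)] o[OF t(2) assms(1)] c(2)[OF assms(2)] by auto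
  show "gV v \<otimes>\<^bsub>L\<^esub> gY e = (if v = head E e then gY e else \<zero>\<^bsub>L\<^esub>)"
    using L.m_assoc[OF c(1)[OF assms(1)] c(1)[OF t(2)] c(3)[OF assms(2)]] LF.p_y[OF assms(2)] o[OF assms(1) t(2)] c(3)[OF assms(2)] by auto
  show "gY e \<otimes>\<^bsub>L\<^esub> gV v = (if v = tail E e then gY e else \<zero>\<^bsub>L\<^esub>)"
    using L.m_assoc[OF c(3)[OF assms(2)] c(1)[OF t(1)] c(1)[OF assms(1)]] LF.y_p[OF assms(2)] o[OF t(1) assms(1)] c(3)[OF assms(2)] by auto
qed

text \<open>The span of products of a path of length \<open>a\<close> and the adjoint of a path of
  length \<open>b\<close>, grown outwards from multiples of a vertex. Composability is not demanded,
  since products of edges that do not compose vanish.\<close>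

inductive path_span :: "nat \<Rightarrow> nat \<Rightarrow> (('v, 'e) lpa_gen list \<Rightarrow> 'k) set \<Rightarrow> bool" where
  zero: "path_span a b \<zero>\<^bsub>L\<^esub>"
| add: "path_span a b u \<Longrightarrow> path_span a b u' \<Longrightarrow> path_span a b (u \<oplus>\<^bsub>L\<^esub> u')"
| vertex: "c \<in> carrier K \<Longrightarrow> v \<in> verts E \<Longrightarrow> path_span 0 0 (c \<odot>\<^bsub>L\<^esub> gV v)"
| edge: "e \<in> arcs E \<Longrightarrow> path_span a b u \<Longrightarrow> path_span (Suc a) b (gX e \<otimes>\<^bsub>L\<^esub> u)"
| ghost: "e \<in> arcs E \<Longrightarrow> path_span a b u \<Longrightarrow> path_span a (Suc b) (u \<otimes>\<^bsub>L\<^esub> gY e)"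

lemma path_span_closed: "path_span a b u \<Longrightarrow> u \<in> carrier L"
  by (induction rule: path_span.induct) (simp_all add: L_gens_closed L_smult_closed)

lemma path_span_gV_left: "path_span a b u \<Longrightarrow> v \<in> verts E \<Longrightarrow> path_span a b (gV v \<otimes>\<^bsub>L\<^esub> u)"
proof (induction rule: path_span.induct)
  case (zero a b)
  then show ?case using path_span.zero by (simp add: L_gens_closed)
next
  case (add a b u u')
  then show ?case using path_span.add by (simp add: L.r_distr L_gens_closed path_span_closed)
next
  case (vertex c w)
  then have "gV v \<otimes>\<^bsub>L\<^esub> (c \<odot>\<^bsub>L\<^esub> gV w) = c \<odot>\<^bsub>L\<^esub> (gV v \<otimes>\<^bsub>L\<^esub> gV w)" by (simp add: L_smult_mult L_gens_closed)
  also have "... = (if v = w then c \<odot>\<^bsub>L\<^esub> gV w else \<zero>\<^bsub>L\<^esub>)"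
    using vertex FQ_relations(1)[of v w] L_smult_zero by (simp add: L_simps(2,4))
  finally show ?case using vertex path_span.vertex path_span.zero by simp
next
  case (edge e a b u)
  have "gV v \<otimes>\<^bsub>L\<^esub> (gX e \<otimes>\<^bsub>L\<^esub> u) = (if v = tail E e then gX e \<otimes>\<^bsub>L\<^esub> u else \<zero>\<^bsub>L\<^esub>)"
    using edge gen_products(1)[OF edge.prems edge(1)] L.m_assoc[of "gV v" "gX e" u] path_span_closed[OF edge(2)]
    by (auto simp: L_gens_closed split: if_splits)
  then show ?case using path_span.edge[OF edge(1,2)] path_span.zero by simp
next
  case (ghost e a b u)
  then show ?case using path_span.ghost[OF ghost(1) ghost.IH] path_span_closed[OF ghost(2)]
    by (simp add: L.m_assoc L_gens_closed)
qed

lemma path_span_gV_right: "path_span a b u \<Longrightarrow> v \<in> verts E \<Longrightarrow> path_span a b (u \<otimes>\<^bsub>L\<^esub> gV v)"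
proof (induction rule: path_span.induct)
  case (zero a b)
  then show ?case using path_span.zero by (simp add: L_gens_closed)
next
  case (add a b u u')
  then show ?case using path_span.add by (simp add: L.l_distr L_gens_closed path_span_closed)
next
  case (vertex c w)
  then have "(c \<odot>\<^bsub>L\<^esub> gV w) \<otimes>\<^bsub>L\<^esub> gV v = c \<odot>\<^bsub>L\<^esub> (gV w \<otimes>\<^bsub>L\<^esub> gV v)" by (simp add: L_smult_mult L_gens_closed)
  also have "... = (if v = w then c \<odot>\<^bsub>L\<^esub> gV w else \<zero>\<^bsub>L\<^esub>)"
    using vertex FQ_relations(1)[of w v] L_smult_zero by (simp add: L_simps(2,4))
  finally show ?case using vertex path_span.vertex path_span.zero by simp
next
  case (edge e a b u)
  then show ?case using path_span.edge[OF edge(1) edge.IH] path_span_closed[OF edge(2)]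
    by (simp add: L.m_assoc L_gens_closed)
next
  case (ghost e a b u)
  have "u \<otimes>\<^bsub>L\<^esub> gY e \<otimes>\<^bsub>L\<^esub> gV v = (if v = tail E e then u \<otimes>\<^bsub>L\<^esub> gY e else \<zero>\<^bsub>L\<^esub>)"
    using ghost gen_products(4)[OF ghost.prems ghost(1)] path_span_closed[OF ghost(2)]
    by (simp add: L_gens_closed L.m_assoc)
  then show ?case using path_span.ghost[OF ghost(1,2)] path_span.zero by simp
qed

text \<open>An adjoint edge on the left cancels the first edge of a path; if the path is trivial, it
  lengthens the adjoint path instead. Hence words in all generators can be brought into this
  form.\<close>

lemma path_span_gY_left:
  "path_span a b u \<Longrightarrow> e \<in> arcs E \<Longrightarrow>
     (a = 0 \<longrightarrow> path_span 0 (Suc b) (gY e \<otimes>\<^bsub>L\<^esub> u)) \<and> (\<forall>a'. a = Suc a' \<longrightarrow> path_span a' b (gY e \<otimes>\<^bsub>L\<^esub> u))"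
proof (induction rule: path_span.induct)
  case (zero a b)
  then show ?case using path_span.zero by (simp add: L_gens_closed)
next
  case (add a b u u')
  then show ?case using path_span.add by (simp add: L.r_distr L_gens_closed path_span_closed)
next
  case (vertex c v)
  have h: "head E e \<in> verts E" using vertex by auto
  have "gY e \<otimes>\<^bsub>L\<^esub> (c \<odot>\<^bsub>L\<^esub> gV v) = c \<odot>\<^bsub>L\<^esub> (gY e \<otimes>\<^bsub>L\<^esub> gV v)" using vertex by (simp add: L_smult_mult L_gens_closed)
  also have "... = (if v = tail E e then c \<odot>\<^bsub>L\<^esub> gY e else \<zero>\<^bsub>L\<^esub>)"
    using vertex gen_products(4)[of v e] L_smult_zero by simp
  also have "c \<odot>\<^bsub>L\<^esub> gY e = (c \<odot>\<^bsub>L\<^esub> gV (head E e)) \<otimes>\<^bsub>L\<^esub> gY e"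
    using vertex h gen_products(3)[OF h, of e] by (simp add: L_smult_mult L_gens_closed)
  finally show ?case using path_span.ghost[OF vertex.prems path_span.vertex[OF vertex(1) h]] path_span.zero by simp
next
  case (edge f a b u)
  have h: "head E e \<in> verts E" using edge by auto
  have "gY e \<otimes>\<^bsub>L\<^esub> (gX f \<otimes>\<^bsub>L\<^esub> u) = (if e = f then gV (head E e) \<otimes>\<^bsub>L\<^esub> u else \<zero>\<^bsub>L\<^esub>)"
    using edge LF.y_x[OF edge.prems edge(1)] L.m_assoc[of "gY e" "gX f" u] path_span_closed[OF edge(2)]
    by (auto simp: L_gens_closed split: if_splits)
  then show ?case using path_span_gV_left[OF edge(2) h] path_span.zero by (cases "e = f") simp_all
next
  case (ghost f a b u)
  then show ?case using path_span.ghost[OF ghost(1), of _ _ "gY e \<otimes>\<^bsub>L\<^esub> u"] path_span_closed[OF ghost(2)]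
    by (simp add: L.m_assoc[symmetric] L_gens_closed)
qed

lemma path_span_gX_right:
  "path_span a b u \<Longrightarrow> e \<in> arcs E \<Longrightarrow>
     (b = 0 \<longrightarrow> path_span (Suc a) 0 (u \<otimes>\<^bsub>L\<^esub> gX e)) \<and> (\<forall>b'. b = Suc b' \<longrightarrow> path_span a b' (u \<otimes>\<^bsub>L\<^esub> gX e))"
proof (induction rule: path_span.induct)
  case (zero a b)
  then show ?case using path_span.zero by (simp add: L_gens_closed)
next
  case (add a b u u')
  then show ?case using path_span.add by (simp add: L.l_distr L_gens_closed path_span_closed)
next
  case (vertex c v)
  have h: "head E e \<in> verts E" using vertex by auto
  have "(c \<odot>\<^bsub>L\<^esub> gV v) \<otimes>\<^bsub>L\<^esub> gX e = c \<odot>\<^bsub>L\<^esub> (gV v \<otimes>\<^bsub>L\<^esub> gX e)" using vertex by (simp add: L_smult_mult L_gens_closed)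
  also have "... = (if v = tail E e then c \<odot>\<^bsub>L\<^esub> gX e else \<zero>\<^bsub>L\<^esub>)"
    using vertex gen_products(1)[of v e] L_smult_zero by simp
  also have "c \<odot>\<^bsub>L\<^esub> gX e = gX e \<otimes>\<^bsub>L\<^esub> (c \<odot>\<^bsub>L\<^esub> gV (head E e))"
    using vertex h gen_products(2)[OF h, of e] by (simp add: L_smult_mult L_gens_closed)
  finally show ?case using path_span.edge[OF vertex.prems path_span.vertex[OF vertex(1) h]] path_span.zero by simp
next
  case (edge f a b u)
  then show ?case using path_span.edge[OF edge(1), of _ _ "u \<otimes>\<^bsub>L\<^esub> gX e"] path_span_closed[OF edge(2)]
    by (simp add: L.m_assoc L_gens_closed)
next
  case (ghost f a b u)
  have h: "head E e \<in> verts E" using ghost by auto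
  have "u \<otimes>\<^bsub>L\<^esub> gY f \<otimes>\<^bsub>L\<^esub> gX e = (if f = e then u \<otimes>\<^bsub>L\<^esub> gV (head E e) else \<zero>\<^bsub>L\<^esub>)"
    using ghost LF.y_x[OF ghost(1) ghost.prems] path_span_closed[OF ghost(2)]
    by (simp add: L_gens_closed L.m_assoc)
  then show ?case using path_span_gV_right[OF ghost(2) h] path_span.zero by simp
qed

text \<open>An adjoint path of positive length ends at the source of an edge, and no edge starts at
  a sink.\<close>

lemma path_span_sink:
  "path_span a b u \<Longrightarrow> w \<in> verts E \<Longrightarrow> out_arcs E w = {} \<Longrightarrow> b = Suc b' \<Longrightarrow> u \<otimes>\<^bsub>L\<^esub> gV w = \<zero>\<^bsub>L\<^esub>"
proof (induction arbitrary: b' rule: path_span.induct)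
  case (add a b u u')
  then show ?case by (simp add: L.l_distr L_gens_closed path_span_closed)
next
  case (edge e a b u)
  then show ?case by (simp add: L.m_assoc L_gens_closed path_span_closed)
next
  case (ghost e a b u)
  then have "w \<noteq> tail E e" by auto
  then show ?case using ghost gen_products(4)[of w e] path_span_closed[OF ghost(2)] by (simp add: L.m_assoc L_gens_closed)
qed (simp_all add: L_gens_closed)

text \<open>The products of the edges with their adjoints add up to the sum of the vertices that are
  not sinks. This fixes \<open>u\<close> because every term of \<open>u\<close> begins with an edge,
  and it recovers \<open>u\<close> from its products with adjoint edges.\<close>

lemma path_span_expand:
  "path_span a b u \<Longrightarrow> a = Suc a' \<Longrightarrow> (\<Oplus>\<^bsub>L\<^esub> e\<in>arcs E. gX e \<otimes>\<^bsub>L\<^esub> (gY e \<otimes>\<^bsub>L\<^esub> u)) = u"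
proof (induction arbitrary: a' rule: path_span.induct)
  case (zero a b)
  have "(\<Oplus>\<^bsub>L\<^esub> e\<in>arcs E. gX e \<otimes>\<^bsub>L\<^esub> (gY e \<otimes>\<^bsub>L\<^esub> \<zero>\<^bsub>L\<^esub>)) = (\<Oplus>\<^bsub>L\<^esub> e\<in>arcs E. \<zero>\<^bsub>L\<^esub>)"
    by (rule L.finsum_cong') (auto simp: L_gens_closed)
  then show ?case by simp
next
  case (add a b u u')
  note c = path_span_closed[OF add(1)] path_span_closed[OF add(2)]
  have "(\<Oplus>\<^bsub>L\<^esub> e\<in>arcs E. gX e \<otimes>\<^bsub>L\<^esub> (gY e \<otimes>\<^bsub>L\<^esub> (u \<oplus>\<^bsub>L\<^esub> u'))) =
      (\<Oplus>\<^bsub>L\<^esub> e\<in>arcs E. gX e \<otimes>\<^bsub>L\<^esub> (gY e \<otimes>\<^bsub>L\<^esub> u) \<oplus>\<^bsub>L\<^esub> gX e \<otimes>\<^bsub>L\<^esub> (gY e \<otimes>\<^bsub>L\<^esub> u'))"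
    by (rule L.finsum_cong') (use c in \<open>auto simp: L_gens_closed L.r_distr\<close>)
  also have "... = (\<Oplus>\<^bsub>L\<^esub> e\<in>arcs E. gX e \<otimes>\<^bsub>L\<^esub> (gY e \<otimes>\<^bsub>L\<^esub> u)) \<oplus>\<^bsub>L\<^esub> (\<Oplus>\<^bsub>L\<^esub> e\<in>arcs E. gX e \<otimes>\<^bsub>L\<^esub> (gY e \<otimes>\<^bsub>L\<^esub> u'))"
    by (rule L.finsum_addf) (use c in \<open>auto simp: L_gens_closed\<close>)
  finally show ?case using add by simp
next
  case (edge f a b u)
  note c = path_span_closed[OF edge(2)]
  have h: "head E f \<in> verts E" using edge by auto
  have e: "gX e \<otimes>\<^bsub>L\<^esub> (gY e \<otimes>\<^bsub>L\<^esub> (gX f \<otimes>\<^bsub>L\<^esub> u)) = (if f = e then gX f \<otimes>\<^bsub>L\<^esub> u else \<zero>\<^bsub>L\<^esub>)" if "e \<in> arcs E" for e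
  proof -
    have "gX e \<otimes>\<^bsub>L\<^esub> (gY e \<otimes>\<^bsub>L\<^esub> (gX f \<otimes>\<^bsub>L\<^esub> u)) = gX e \<otimes>\<^bsub>L\<^esub> (gY e \<otimes>\<^bsub>L\<^esub> gX f) \<otimes>\<^bsub>L\<^esub> u"
      using that edge(1) c by (simp add: L.m_assoc L_gens_closed)
    also have "... = (if f = e then gX f \<otimes>\<^bsub>L\<^esub> u else \<zero>\<^bsub>L\<^esub>)"
      using LF.y_x[OF that edge(1)] gen_products(2)[OF h edge(1)] that c by (auto simp: L_gens_closed)
    finally show ?thesis .
  qed
  have "(\<Oplus>\<^bsub>L\<^esub> e\<in>arcs E. gX e \<otimes>\<^bsub>L\<^esub> (gY e \<otimes>\<^bsub>L\<^esub> (gX f \<otimes>\<^bsub>L\<^esub> u))) = (\<Oplus>\<^bsub>L\<^esub> e\<in>arcs E. if f = e then gX f \<otimes>\<^bsub>L\<^esub> u else \<zero>\<^bsub>L\<^esub>)"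
    by (rule L.finsum_cong') (use e edge(1) c in \<open>auto simp: L_gens_closed\<close>)
  also have "... = gX f \<otimes>\<^bsub>L\<^esub> u"
    using L.add.finprod_singleton[OF edge(1) finite_arcs, of "\<lambda>_. gX f \<otimes>\<^bsub>L\<^esub> u"] edge(1) c by (simp add: L_gens_closed)
  finally show ?case .
next
  case (ghost f a b u)
  note c = path_span_closed[OF ghost(2)]
  have "(\<Oplus>\<^bsub>L\<^esub> e\<in>arcs E. gX e \<otimes>\<^bsub>L\<^esub> (gY e \<otimes>\<^bsub>L\<^esub> (u \<otimes>\<^bsub>L\<^esub> gY f))) = (\<Oplus>\<^bsub>L\<^esub> e\<in>arcs E. gX e \<otimes>\<^bsub>L\<^esub> (gY e \<otimes>\<^bsub>L\<^esub> u) \<otimes>\<^bsub>L\<^esub> gY f)"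
    by (rule L.finsum_cong') (use c ghost(1) in \<open>auto simp: L_gens_closed L.m_assoc\<close>)
  also have "... = (\<Oplus>\<^bsub>L\<^esub> e\<in>arcs E. gX e \<otimes>\<^bsub>L\<^esub> (gY e \<otimes>\<^bsub>L\<^esub> u)) \<otimes>\<^bsub>L\<^esub> gY f"
    by (rule L.finsum_ldistr[symmetric]) (use c ghost(1) in \<open>auto simp: L_gens_closed\<close>)
  finally show ?case using ghost by simp
qed simp

text \<open>Distinct vertices are orthogonal, so multiplication by \<open>v\<close> isolates a
  single coefficient of a combination of vertices.\<close>

lemma path_span_00: "path_span a b u \<Longrightarrow> a = 0 \<Longrightarrow> b = 0 \<Longrightarrow> v \<in> verts E \<Longrightarrow> \<exists>c\<in>carrier K. gV v \<otimes>\<^bsub>L\<^esub> u = c \<odot>\<^bsub>L\<^esub> gV v"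
proof (induction rule: path_span.induct)
  case (zero a b)
  then show ?case using L_smult_zero(2)[of "gV v"] by (intro bexI[of _ "\<zero>"]) (simp_all add: L_gens_closed)
next
  case (add a b u u')
  then obtain c c' where "c \<in> carrier K" "gV v \<otimes>\<^bsub>L\<^esub> u = c \<odot>\<^bsub>L\<^esub> gV v" "c' \<in> carrier K" "gV v \<otimes>\<^bsub>L\<^esub> u' = c' \<odot>\<^bsub>L\<^esub> gV v" by blast
  then show ?case using add path_span_closed[OF add(1)] path_span_closed[OF add(2)]
    by (intro bexI[of _ "c \<oplus> c'"]) (simp_all add: L.r_distr L_gens_closed L_smult_add)
next
  case (vertex c w)
  have "gV v \<otimes>\<^bsub>L\<^esub> (c \<odot>\<^bsub>L\<^esub> gV w) = c \<odot>\<^bsub>L\<^esub> (gV v \<otimes>\<^bsub>L\<^esub> gV w)" using vertex by (simp add: L_smult_mult L_gens_closed)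
  also have "... = (if v = w then c \<odot>\<^bsub>L\<^esub> gV v else \<zero> \<odot>\<^bsub>L\<^esub> gV v)"
    using vertex FQ_relations(1)[of v w] L_smult_zero by (simp add: L_simps(2,4) L_gens_closed)
  finally show ?case using vertex(1) by (cases "v = w") auto
qed simp_all

text \<open>The word is built up by multiplying letters from the left. The two lengths depend on the
  cancellations; only their difference, the degree, is known beforehand.\<close>

lemma path_span_word:
  assumes "c \<in> carrier K"
  shows "w \<noteq> [] \<Longrightarrow> set w \<subseteq> lpa_gens E \<Longrightarrow> \<exists>a b. int a - int b = deg w \<and> path_span a b (cl (mono c w))"
proof (induction w)
  case (Cons x w)
  have x: "x \<in> lpa_gens E" using Cons.prems by simp
  show ?case
  proof (cases "w = []")
    case True
    have "mono c [x] = c \<odot>\<^bsub>Fr\<^esub> gvar x" using assms by (auto simp: Fr_simps var_mono mono_def)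
    then have s: "cl (mono c [x]) = c \<odot>\<^bsub>L\<^esub> cl (gvar x)" by (simp add: L_smult[OF assms var_closed[OF x]])
    show ?thesis
    proof (cases x)
      case (Vert v)
      then have "path_span 0 0 (cl (mono c [x]))" using path_span.vertex[OF assms, of v] x by (simp add: s[unfolded Vert] Vert gV_def)
      then show ?thesis using True Vert by (intro exI[of _ 0]) simp
    next
      case (Edge e)
      then have e: "e \<in> arcs E" and h: "head E e \<in> verts E" using x by auto
      \<comment> \<open>The scalar is moved to the range of the edge, since the rules of
        \<open>path_span\<close> start from multiples of a vertex.\<close>
      have "c \<odot>\<^bsub>L\<^esub> gX e = gX e \<otimes>\<^bsub>L\<^esub> (c \<odot>\<^bsub>L\<^esub> gV (head E e))"
        using assms h e gen_products(2)[OF h e] by (simp add: L_smult_mult L_gens_closed)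
      then have "path_span 1 0 (cl (mono c [x]))"
        using path_span.edge[OF e path_span.vertex[OF assms h]] by (simp add: s[unfolded Edge] Edge gX_def)
      then show ?thesis using True Edge by (intro exI[of _ 1] exI[of _ 0]) simp
    next
      case (Ghost e)
      then have e: "e \<in> arcs E" and h: "head E e \<in> verts E" using x by auto
      have "c \<odot>\<^bsub>L\<^esub> gY e = (c \<odot>\<^bsub>L\<^esub> gV (head E e)) \<otimes>\<^bsub>L\<^esub> gY e"
        using assms h e gen_products(3)[OF h e] by (simp add: L_smult_mult L_gens_closed)
      then have "path_span 0 1 (cl (mono c [x]))"
        using path_span.ghost[OF e path_span.vertex[OF assms h]] by (simp add: s[unfolded Ghost] Ghost gY_def)
      then show ?thesis using True Ghost by (intro exI[of _ 0] exI[of _ 1]) simp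
    qed
  next
    case False
    have w: "set w \<subseteq> lpa_gens E" using Cons.prems by simp
    obtain a b where ab: "int a - int b = deg w" "path_span a b (cl (mono c w))" using Cons.IH[OF False w] by blast
    have m: "cl (mono c (x # w)) = cl (gvar x) \<otimes>\<^bsub>L\<^esub> cl (mono c w)"
      using mono_append(1)[OF assms, of x w] cl_mult[OF var_closed[OF x] mono_Fr[OF assms w]] by (simp add: L_simps(2))
    show ?thesis
    proof (cases x)
      case (Vert v)
      then have "path_span a b (cl (mono c (x # w)))"
        using path_span_gV_left[OF ab(2), of v] x m by (simp add: gV_def)
      then show ?thesis using ab(1) Vert by (intro exI[of _ a] exI[of _ b]) simp
    next
      case (Edge e)
      then have "path_span (Suc a) b (cl (mono c (x # w)))"
        using path_span.edge[OF _ ab(2), of e] x m by (simp add: gX_def)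
      then show ?thesis using ab(1) Edge by (intro exI[of _ "Suc a"] exI[of _ b]) simp
    next
      case (Ghost e)
      then have e: "e \<in> arcs E" using x by simp
      have g: "cl (mono c (x # w)) = gY e \<otimes>\<^bsub>L\<^esub> cl (mono c w)" using m Ghost by (simp add: gY_def)
      show ?thesis
      proof (cases a)
        case 0
        then have "path_span 0 (Suc b) (cl (mono c (x # w)))" using path_span_gY_left[OF ab(2) e] g by simp
        then show ?thesis using ab(1) Ghost 0 by (intro exI[of _ 0] exI[of _ "Suc b"]) simp
      next
        case (Suc a')
        then have "path_span a' b (cl (mono c (x # w)))" using path_span_gY_left[OF ab(2) e] g by simp
        then show ?thesis using ab(1) Ghost Suc by (intro exI[of _ a'] exI[of _ b]) simp
      qed
    qed
  qed
qed simp

text \<open>The bound \<open>m\<close> on the length of the adjoint paths is the quantity on which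
  the proof of injectivity inducts.\<close>

inductive degree_span :: "int \<Rightarrow> nat \<Rightarrow> (('v, 'e) lpa_gen list \<Rightarrow> 'k) set \<Rightarrow> bool" where
  zero: "degree_span n m \<zero>\<^bsub>L\<^esub>"
| path: "path_span a b u \<Longrightarrow> int a - int b = n \<Longrightarrow> b \<le> m \<Longrightarrow> degree_span n m u"
| add: "degree_span n m u \<Longrightarrow> degree_span n m u' \<Longrightarrow> degree_span n m (u \<oplus>\<^bsub>L\<^esub> u')"

lemma degree_span_closed: "degree_span n m u \<Longrightarrow> u \<in> carrier L"
  by (induction rule: degree_span.induct) (simp_all add: path_span_closed)

lemma degree_span_mono: "degree_span n m u \<Longrightarrow> m \<le> m' \<Longrightarrow> degree_span n m' u"
  by (induction rule: degree_span.induct) (auto intro: degree_span.intros)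

text \<open>An element involves finitely many words, and bounds may be enlarged to a common
  one.\<close>

lemma grade_degree_span:
  assumes "u \<in> grade L n"
  shows "\<exists>m. degree_span n m u"
proof -
  obtain f where f: "f \<in> grade Fr n" "f \<in> F0" "u = cl f" using assms by (auto simp: L_simps(7))
  have "\<exists>m. degree_span n m (cl f)"
    using F0_closed[OF f(2)]
  proof (induction f rule: free_induct)
    case zero
    then show ?case using degree_span.zero cl_zero by (auto simp: L_simps(4))
  next
    case (mono w)
    have w: "w \<noteq> []" "deg w = n" using mono f by (auto simp: F0_def Fr_simps(6))
    obtain a b where "int a - int b = n" "path_span a b (cl (local.mono (f w) w))"
      using path_span_word[OF Fr_closed[OF F0_closed[OF f(2)]] w(1) mono(2)] w(2) by metis
    then show ?case using degree_span.path[OF _ _ order_refl] by blast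
  next
    case (add g h)
    then obtain m m' where "degree_span n m (cl g)" "degree_span n m' (cl h)" by blast
    then have "degree_span n (max m m') (cl g \<oplus>\<^bsub>L\<^esub> cl h)"
      by (intro degree_span.add) (auto elim: degree_span_mono)
    then show ?case using add(1,2) by (auto simp: cl_add L_simps(5))
  qed
  then show ?thesis using f by simp
qed

text \<open>An edge on the right cancels the last adjoint edge or, if there is none, lengthens the
  path. Either way the degree rises by 1 and the smaller bound holds.\<close>

lemma degree_span_gX_right: "degree_span n m u \<Longrightarrow> m = Suc m' \<Longrightarrow> e \<in> arcs E \<Longrightarrow> degree_span (n + 1) m' (u \<otimes>\<^bsub>L\<^esub> gX e)"
proof (induction rule: degree_span.induct)
  case (zero n m)
  then show ?case using degree_span.zero by (simp add: L_gens_closed)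
next
  case (path a b u n m)
  show ?case
  proof (cases b)
    case 0
    then show ?thesis using path path_span_gX_right[OF path(1,5)] by (intro degree_span.path[of "Suc a" 0]) auto
  next
    case (Suc b')
    then show ?thesis using path path_span_gX_right[OF path(1,5)] by (intro degree_span.path[of a b']) auto
  qed
next
  case (add n m u u')
  then show ?case by (simp add: L.l_distr L_gens_closed degree_span_closed degree_span.add)
qed

text \<open>At a sink all terms with a nontrivial adjoint path vanish, so the bound drops to 0 at
  once.\<close>

lemma degree_span_sink:
  "degree_span n m u \<Longrightarrow> w \<in> verts E \<Longrightarrow> out_arcs E w = {} \<Longrightarrow> degree_span n 0 (u \<otimes>\<^bsub>L\<^esub> gV w)"
proof (induction rule: degree_span.induct)
  case (zero n m)
  then show ?case using degree_span.zero by (simp add: L_gens_closed)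
next
  case (path a b u n m)
  show ?case
  proof (cases b)
    case 0
    then show ?thesis using path path_span_gV_right[OF path(1,4)] by (intro degree_span.path[of a 0]) auto
  next
    case (Suc b')
    then show ?thesis using path_span_sink[OF path(1,4,5)] degree_span.zero by simp
  qed
next
  case (add n m u u')
  then show ?case by (simp add: L.l_distr L_gens_closed degree_span_closed degree_span.add)
qed

text \<open>Without adjoint paths the degree is the length, so all paths involved have the same
  length.\<close>

lemma degree_span_0: "degree_span n m u \<Longrightarrow> m = 0 \<Longrightarrow> u = \<zero>\<^bsub>L\<^esub> \<or> (\<exists>a. n = int a \<and> path_span a 0 u)"
proof (induction rule: degree_span.induct)
  case (add n m u u')
  then show ?case using path_span_closed path_span.add by fastforce
qed auto

lemma L_eq_zeroI:
  assumes u: "u \<in> carrier L"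
  shows "(\<And>v. v \<in> verts E \<Longrightarrow> gV v \<otimes>\<^bsub>L\<^esub> u = \<zero>\<^bsub>L\<^esub>) \<Longrightarrow> u = \<zero>\<^bsub>L\<^esub>"
    "(\<And>v. v \<in> verts E \<Longrightarrow> u \<otimes>\<^bsub>L\<^esub> gV v = \<zero>\<^bsub>L\<^esub>) \<Longrightarrow> u = \<zero>\<^bsub>L\<^esub>"
proof -
  have c: "gV \<in> verts E \<rightarrow> carrier L" by (auto simp: L_gens_closed)
  have l: "u = (\<Oplus>\<^bsub>L\<^esub> v\<in>verts E. gV v \<otimes>\<^bsub>L\<^esub> u)"
    using L.finsum_ldistr[OF finite_verts u c] LF.p_one u by simp
  have r: "u = (\<Oplus>\<^bsub>L\<^esub> v\<in>verts E. u \<otimes>\<^bsub>L\<^esub> gV v)"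
    using L.finsum_rdistr[OF finite_verts u c] LF.p_one u by simp
  show "u = \<zero>\<^bsub>L\<^esub>" if "\<And>v. v \<in> verts E \<Longrightarrow> gV v \<otimes>\<^bsub>L\<^esub> u = \<zero>\<^bsub>L\<^esub>"
  proof -
    have "(\<Oplus>\<^bsub>L\<^esub> v\<in>verts E. gV v \<otimes>\<^bsub>L\<^esub> u) = (\<Oplus>\<^bsub>L\<^esub> v\<in>verts E. \<zero>\<^bsub>L\<^esub>)" by (rule L.finsum_cong') (use that in auto)
    then show ?thesis using l by simp
  qed
  show "u = \<zero>\<^bsub>L\<^esub>" if "\<And>v. v \<in> verts E \<Longrightarrow> u \<otimes>\<^bsub>L\<^esub> gV v = \<zero>\<^bsub>L\<^esub>"
  proof -
    have "(\<Oplus>\<^bsub>L\<^esub> v\<in>verts E. u \<otimes>\<^bsub>L\<^esub> gV v) = (\<Oplus>\<^bsub>L\<^esub> v\<in>verts E. \<zero>\<^bsub>L\<^esub>)" by (rule L.finsum_cong') (use that in auto)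
    then show ?thesis using r by simp
  qed
qed

end

context leavitt_target
begin

section \<open>Injectivity of the homomorphism\<close>

sublocale psi: ring_hom_ring L A psi
  by (rule ring_hom_ringI2[OF L.ring_axioms T.ring_axioms psi_ring_hom])

text \<open>A nonzero \<open>c\<close> could be inverted in the field, which would force
  \<open>p v\<close> to vanish.\<close>

lemma psi_smult_zero:
  assumes c: "c \<in> carrier K" and v: "v \<in> verts E" "p v \<noteq> \<zero>\<^bsub>A\<^esub>" and z: "psi (c \<odot>\<^bsub>L\<^esub> gV v) = \<zero>\<^bsub>A\<^esub>"
  shows "c = \<zero>"
proof (rule ccontr)
  assume "c \<noteq> \<zero>"
  then have u: "c \<in> Units K" using c K.field_Units by simp
  have "c \<odot>\<^bsub>A\<^esub> p v = \<zero>\<^bsub>A\<^esub>" using z psi_smult[OF c L_gens_closed(1)[OF v(1)]] psi_gen(1)[OF v(1)] by simp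
  then have "inv c \<odot>\<^bsub>A\<^esub> (c \<odot>\<^bsub>A\<^esub> p v) = \<zero>\<^bsub>A\<^esub>" using u by simp
  then have "p v = \<zero>\<^bsub>A\<^esub>"
    using u c T.p_closed[OF v(1)] ev.AM.smult_assoc1[of "inv c" c "p v"] ev.AM.smult_one[of "p v"] by simp
  then show False using v(2) by simp
qed

text \<open>Multiplication by an adjoint edge stays in the kernel and shortens the paths;
  \<open>path_span_expand\<close> recombines the results. At length 0 every coefficient is tested
  against a nonzero \<open>p v\<close>.\<close>

lemma psi_path_injective:
  assumes p: "\<And>v. v \<in> verts E \<Longrightarrow> p v \<noteq> \<zero>\<^bsub>A\<^esub>"
  shows "path_span a 0 u \<Longrightarrow> psi u = \<zero>\<^bsub>A\<^esub> \<Longrightarrow> u = \<zero>\<^bsub>L\<^esub>"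
proof (induction a arbitrary: u)
  case 0
  note u = path_span_closed[OF 0(1)]
  show ?case
  proof (rule L_eq_zeroI(1)[OF u])
    fix v assume v: "v \<in> verts E"
    obtain c where c: "c \<in> carrier K" "gV v \<otimes>\<^bsub>L\<^esub> u = c \<odot>\<^bsub>L\<^esub> gV v" using path_span_00[OF 0(1) _ _ v] by blast
    have "psi (gV v \<otimes>\<^bsub>L\<^esub> u) = \<zero>\<^bsub>A\<^esub>" using 0(2) u L_gens_closed(1)[OF v] psi.hom_closed by simp
    then have "c = \<zero>" using psi_smult_zero[OF c(1) v p[OF v]] c(2) by simp
    then show "gV v \<otimes>\<^bsub>L\<^esub> u = \<zero>\<^bsub>L\<^esub>" using c(2) L_smult_zero(2) L_gens_closed(1)[OF v] by simp
  qed
next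
  case (Suc a)
  note u = path_span_closed[OF Suc.prems(1)]
  have "gY e \<otimes>\<^bsub>L\<^esub> u = \<zero>\<^bsub>L\<^esub>" if e: "e \<in> arcs E" for e
  proof (rule Suc.IH)
    show "path_span a 0 (gY e \<otimes>\<^bsub>L\<^esub> u)" using path_span_gY_left[OF Suc.prems(1) e] by simp
    show "psi (gY e \<otimes>\<^bsub>L\<^esub> u) = \<zero>\<^bsub>A\<^esub>" using Suc.prems(2) u L_gens_closed(3)[OF e] psi.hom_closed by simp
  qed
  then have "(\<Oplus>\<^bsub>L\<^esub> e\<in>arcs E. gX e \<otimes>\<^bsub>L\<^esub> (gY e \<otimes>\<^bsub>L\<^esub> u)) = (\<Oplus>\<^bsub>L\<^esub> e\<in>arcs E. \<zero>\<^bsub>L\<^esub>)"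
    by (intro L.finsum_cong') (auto simp: L_gens_closed)
  then show ?case using path_span_expand[OF Suc.prems(1) HOL.refl] by simp
qed

text \<open>Multiplying on the right by all edges and all sinks removes the adjoint paths and loses no
  information, since \<open>v = \<Sum> e e\<^sup>*\<close> for every vertex \<open>v\<close> that is not a sink.\<close>

lemma psi_homogeneous_injective:
  assumes p: "\<And>v. v \<in> verts E \<Longrightarrow> p v \<noteq> \<zero>\<^bsub>A\<^esub>"
  shows "degree_span n m u \<Longrightarrow> psi u = \<zero>\<^bsub>A\<^esub> \<Longrightarrow> u = \<zero>\<^bsub>L\<^esub>"
proof (induction m arbitrary: n u)
  case 0
  then show ?case using degree_span_0[OF 0(1) HOL.refl] psi_path_injective[OF p] by blast
next
  case (Suc m)
  note u = degree_span_closed[OF Suc.prems(1)]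
  show ?case
  proof (rule L_eq_zeroI(2)[OF u])
    fix v assume v: "v \<in> verts E"
    show "u \<otimes>\<^bsub>L\<^esub> gV v = \<zero>\<^bsub>L\<^esub>"
    proof (cases "out_arcs E v = {}")
      case True
      have "degree_span n 0 (u \<otimes>\<^bsub>L\<^esub> gV v)" by (rule degree_span_sink[OF Suc.prems(1) v True])
      moreover have "psi (u \<otimes>\<^bsub>L\<^esub> gV v) = \<zero>\<^bsub>A\<^esub>" using Suc.prems(2) u L_gens_closed(1)[OF v] psi.hom_closed by simp
      ultimately show ?thesis using degree_span_0[OF _ HOL.refl] psi_path_injective[OF p] by blast
    next
      case False
      have o: "e \<in> arcs E" if "e \<in> out_arcs E v" for e using that by auto
      have z: "u \<otimes>\<^bsub>L\<^esub> gX e = \<zero>\<^bsub>L\<^esub>" if e: "e \<in> arcs E" for e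
      proof (rule Suc.IH)
        show "degree_span (n + 1) m (u \<otimes>\<^bsub>L\<^esub> gX e)" by (rule degree_span_gX_right[OF Suc.prems(1) HOL.refl e])
        show "psi (u \<otimes>\<^bsub>L\<^esub> gX e) = \<zero>\<^bsub>A\<^esub>" using Suc.prems(2) u L_gens_closed(2)[OF e] psi.hom_closed by simp
      qed
      have z': "u \<otimes>\<^bsub>L\<^esub> (gX e \<otimes>\<^bsub>L\<^esub> gY e) = \<zero>\<^bsub>L\<^esub>" if e: "e \<in> arcs E" for e
        using L.m_assoc[OF u L_gens_closed(2)[OF e] L_gens_closed(3)[OF e]] z[OF e] L_gens_closed(3)[OF e] by simp
      have "u \<otimes>\<^bsub>L\<^esub> gV v = u \<otimes>\<^bsub>L\<^esub> (\<Oplus>\<^bsub>L\<^esub> e\<in>out_arcs E v. gX e \<otimes>\<^bsub>L\<^esub> gY e)"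
        using LF.x_y[OF v False] by simp
      also have "... = (\<Oplus>\<^bsub>L\<^esub> e\<in>out_arcs E v. u \<otimes>\<^bsub>L\<^esub> (gX e \<otimes>\<^bsub>L\<^esub> gY e))"
        by (rule L.finsum_rdistr[OF finite_out_arcs u]) (use o L_gens_closed in \<open>auto simp del: in_out_arcs_conv\<close>)
      also have "... = (\<Oplus>\<^bsub>L\<^esub> e\<in>out_arcs E v. \<zero>\<^bsub>L\<^esub>)"
        by (rule L.finsum_cong') (use o z' in \<open>auto simp del: in_out_arcs_conv\<close>)
      finally show ?thesis by simp
    qed
  qed
qed

text \<open>\<open>psi\<close> preserves degrees and hence commutes with components. The components
  of an element of the kernel therefore lie in the kernel, where the homogeneous case applies to
  each.\<close>

theorem psi_injective:
  assumes p: "\<And>v. v \<in> verts E \<Longrightarrow> p v \<noteq> \<zero>\<^bsub>A\<^esub>"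
  shows "inj_on psi (carrier L)"
proof (rule inj_onI)
  fix a b assume a: "a \<in> carrier L" and b: "b \<in> carrier L" and ab: "psi a = psi b"
  let ?d = "a \<ominus>\<^bsub>L\<^esub> b"
  have d: "?d \<in> carrier L" using a b by simp
  have d0: "psi ?d = \<zero>\<^bsub>A\<^esub>" using a b ab psi.hom_closed by (simp add: a_minus_def T.r_neg)
  have "component L n ?d = \<zero>\<^bsub>L\<^esub>" for n
  proof -
    have "psi (component L n ?d) = component A n (psi ?d)"
      by (rule component_hom[OF L.graded_group_axioms T.graded_group_axioms _ _ _ d, symmetric])
        (use psi.hom_closed psi_grade in auto)
    also have "... = \<zero>\<^bsub>A\<^esub>" using d0 T.component_grade[OF T.grade_zero[of 0]] by simp
    finally have "psi (component L n ?d) = \<zero>\<^bsub>A\<^esub>" .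
    moreover obtain m where "degree_span n m (component L n ?d)"
      using grade_degree_span[OF L.component_decomp(1)[OF d]] by blast
    ultimately show ?thesis using psi_homogeneous_injective[OF p] by blast
  qed
  then have "?d = \<zero>\<^bsub>L\<^esub>" by (rule L.component_zero_imp[OF d])
  then show "a = b" using a b by simp
qed

text \<open>Over the positions of one list both classes are sums of shifted left ideals, with
  idempotents that correspond under \<open>psi\<close>; \<open>extension_of_scalars_sum\<close>
  takes one sum to the other.\<close>

theorem Vgr_map_psi:
  assumes t: "t \<in> carrier (talented_monoid E)"
  shows "Vgr_map L A psi (LF.theta t) = T.theta t"
proof -
  obtain a where a: "set_mset a \<subseteq> verts E \<times> UNIV" "t = talented_class E a" using t by (rule talented_carrierE)
  obtain l where l: "mset l = a" using ex_mset by blast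
  let ?I = "{..<length l}" and ?f = "(!) l"
  have la: "image_mset ?f (mset_set ?I) = a" using l by (simp add: mset_index)
  have fl: "?f ` ?I \<subseteq> verts E \<times> UNIV"
    by (rule image_subsetI) (metis a(1) l lessThan_iff nth_mem_mset subsetD)
  have fv: "fst (?f j) \<in> verts E" if "j \<in> ?I" for j using fl that by fastforce
  have tL: "LF.theta t = Vgr_class L (LF.ideal_sum ?I ?f)" using LF.theta_sum[OF _ fl] by (simp add: la a)
  have tA: "T.theta t = Vgr_class A (T.ideal_sum ?I ?f)" using T.theta_sum[OF _ fl] by (simp add: la a)
  \<comment> \<open>\<open>Vgr_map\<close> is a union over all members of the class, so every member
    is treated, and one is shown to exist.\<close>
  have "Vgr_class A (extension_of_scalars L A psi P) = T.theta t" if PC: "P \<in> LF.theta t" for P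
  proof -
    have P: "graded_module L P" "graded_isomorphic L P (LF.ideal_sum ?I ?f)"
      using PC unfolding tL by (auto simp: Vgr_class_def fg_projective_graded)
    obtain h k where hk: "h \<in> graded_module_hom L P (LF.ideal_sum ?I ?f)" "k \<in> graded_module_hom L (LF.ideal_sum ?I ?f) P"
      "\<And>m. m \<in> carrier P \<Longrightarrow> k (h m) = m" "\<And>f. f \<in> carrier (LF.ideal_sum ?I ?f) \<Longrightarrow> h (k f) = f"
      using graded_isoE[OF P(1) LF.ideal_sum_graded[OF finite_lessThan fl] P(2)] by blast
    interpret se: scalar_extension L A psi P ?I "\<lambda>j. gV (fst (?f j))" "\<lambda>j. snd (?f j)" h k
      by unfold_locales (use hk P(1) psi_ring_hom psi_grade LF.p_idem fv in \<open>auto simp: LF.ideal_sum_def\<close>)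
    have e: "T.ideal_sum ?I ?f = graded_sum ?I (\<lambda>j. shift (snd (?f j)) (principal_left_ideal A (psi (gV (fst (?f j))))))"
      unfolding T.ideal_sum_def by (rule graded_sum_cong) (use fv in \<open>auto simp: psi_gen\<close>)
    show ?thesis unfolding tA e by (rule Vgr_class_eqI[OF se.extension_of_scalars_sum(2,1)])
  qed
  moreover have "LF.theta t \<in> carrier (Vgr L)"
    using LF.theta_hom t by (auto simp: zmonoid_hom_def hom_def)
  then have "\<exists>P. P \<in> LF.theta t" by (rule Vgr_carrier_nonempty)
  ultimately show ?thesis unfolding Vgr_map_def by blast
qed

end

theorem theorem9p5:
  fixes K :: "('k, 'z) ring_scheme"
    and E :: "('v, 'e) pre_digraph"
    and A :: "('k, 'a) gmodule"
    and \<phi> :: "('v \<times> int) multiset set \<Rightarrow> ('a, nat \<Rightarrow> 'a) gmodule set"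
  assumes "field K"
    and "fin_digraph E"
    and "graded_algebra K A"
    and "\<phi> \<in> zmonoid_hom (talented_monoid E) (Vgr A)"
    and "\<phi> (talented_unit E) = Vgr_class A (regular_module A)"
  shows "\<exists>\<psi> \<in> graded_algebra_hom K (leavitt K E) A.
    (\<forall>t \<in> carrier (talented_monoid E).
       Vgr_map (leavitt K E) A \<psi> (talented_to_Vgr K E t) = \<phi> t) \<and>
    ((\<forall>v \<in> verts E. \<phi> (talented_gen E v 0) \<noteq> \<one>\<^bsub>Vgr A\<^esub>) \<longrightarrow>
       inj_on \<psi> (carrier (leavitt K E)))"
proof -
  interpret A: graded_ring A by (rule graded_algebra_graded_ring[OF assms(3)])
  obtain p x y where fam: "leavitt_family A E p x y"
    and gen: "\<And>v. v \<in> verts E \<Longrightarrow> \<phi> (talented_gen E v 0) = Vgr_class A (principal_left_ideal A (p v))"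
    using A.leavitt_family_of_hom[OF assms(2,4,5)] by blast
  interpret T: leavitt_target K E A p x y
    using assms fam by (simp add: leavitt_target_def leavitt_path_algebra_def leavitt_target_axioms_def)
  \<comment> \<open>\<phi> agrees with the \<open>theta\<close> of the family in \<open>A\<close>,
    since both take the same values at the vertices.\<close>
  have "Vgr_map (leavitt K E) A T.psi (talented_to_Vgr K E t) = \<phi> t" if "t \<in> carrier (talented_monoid E)" for t
    using T.Vgr_map_psi[OF that] T.T.zmonoid_hom_eq_theta[OF assms(4) gen that] by (simp add: T.talented_to_Vgr_theta)
  moreover have "inj_on T.psi (carrier (leavitt K E))" if ne: "\<forall>v\<in>verts E. \<phi> (talented_gen E v 0) \<noteq> \<one>\<^bsub>Vgr A\<^esub>"
  proof (rule T.psi_injective)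
    fix v assume v: "v \<in> verts E"
    show "p v \<noteq> \<zero>\<^bsub>A\<^esub>"
    proof
      assume z: "p v = \<zero>\<^bsub>A\<^esub>"
      \<comment> \<open>A vanishing idempotent would make \<open>\<phi> (talented_gen E v 0)\<close>
        the class of a zero module.\<close>
      have "carrier (principal_left_ideal A (p v)) = {\<zero>\<^bsub>A\<^esub>}"
        unfolding A.principal_left_ideal_carrier[OF T.T.p_idem[OF v]] using z by auto
      then have "Vgr_class A (principal_left_ideal A (p v)) = \<one>\<^bsub>Vgr A\<^esub>"
        by (intro Vgr_one T.T.Ap_graded[OF v]) (simp add: A.principal_left_ideal_simps)
      then show False using ne v gen by simp
    qed
  qed
  ultimately show ?thesis using T.psi_hom by blast
qed

end
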